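(* Let $X\subset\mathbb{C}^m$ be an unbounded algebraic set of pure dimension $k$. Then $C_{4,\infty}(X)$ is an algebraic subset of $\mathbb{C}^m$ and $k\leq\dim C_{4,\infty}(X)\leq 2k+1$.
   Context: Let $X\subset\mathbb{C}^m$ be an unbounded pure $k$-dimensional (complex, closed) algebraic set, $\mathrm{Sing}\,X$ its set of singular points, and $T_pX$ the complex tangent space at $p\in X\setminus\mathrm{Sing}\,X$, viewed as a linear subspace of $\mathbb{C}^m$. The tangent cone at infinity $C_{4,\infty}(X)$ is the set of $v\in\mathbb{C}^m$ for which there exist a sequence $(p_j)_j$ in $X\setminus\mathrm{Sing}\,X$ and vectors $v_j\in T_{p_j}X$ with $\lim_{j\to\infty}\|p_j\|=\infty$ and $\lim_{j\to\infty}v_j=v$. *)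

theory Defs
  imports "HOL-Analysis.Analysis"
begin

text \<open>Polynomials in \<open>m = CARD('m)\<close> complex variables, as functions on \<open>\<complex>\<^sup>m\<close>; as \<open>\<complex>\<close> is infinite,
  a polynomial and its function determine each other.\<close>

inductive cpoly_fun :: "(complex^'m::finite \<Rightarrow> complex) \<Rightarrow> bool" where
  const: "cpoly_fun (\<lambda>x. c)"
| coord: "cpoly_fun (\<lambda>x. x $ i)"
| add: "cpoly_fun f \<Longrightarrow> cpoly_fun g \<Longrightarrow> cpoly_fun (\<lambda>x. f x + g x)"
| mult: "cpoly_fun f \<Longrightarrow> cpoly_fun g \<Longrightarrow> cpoly_fun (\<lambda>x. f x * g x)"

definition algebraic_set :: "(complex^'m::finite) set \<Rightarrow> bool" where
  "algebraic_set X \<longleftrightarrow> (\<exists>F. (\<forall>f\<in>F. cpoly_fun f) \<and> X = {x. \<forall>f\<in>F. f x = 0})"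

definition irreducible_algebraic :: "(complex^'m::finite) set \<Rightarrow> bool" where
  "irreducible_algebraic Z \<longleftrightarrow> algebraic_set Z \<and> Z \<noteq> {} \<and>
     (\<forall>A B. algebraic_set A \<and> algebraic_set B \<and> Z = A \<union> B \<longrightarrow> Z = A \<or> Z = B)"

definition irreducible_component :: "(complex^'m::finite) set \<Rightarrow> (complex^'m) set \<Rightarrow> bool" where
  "irreducible_component Z X \<longleftrightarrow> irreducible_algebraic Z \<and> Z \<subseteq> X \<and>
     (\<forall>W. irreducible_algebraic W \<and> Z \<subseteq> W \<and> W \<subseteq> X \<longrightarrow> W = Z)"

text \<open>Krull dimension in the Zariski topology, for algebraic \<open>X\<close>. The supremum is taken in \<^typ>\<open>enat\<close>,
  so it is a genuine supremum; the empty set gets dimension \<open>0\<close> instead of \<open>-\<infinity>\<close>.\<close>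

definition alg_dim :: "(complex^'m::finite) set \<Rightarrow> enat" where
  "alg_dim X = (SUP n \<in> {n. \<exists>Z. (\<forall>i\<le>n. irreducible_algebraic (Z i) \<and> Z i \<subseteq> X) \<and>
                                 (\<forall>i<n. Z i \<subset> Z (Suc i))}. enat n)"

definition pure_dim :: "(complex^'m::finite) set \<Rightarrow> nat \<Rightarrow> bool" where
  "pure_dim X k \<longleftrightarrow> (\<forall>Z. irreducible_component Z X \<longrightarrow> alg_dim Z = enat k)"

definition local_alg_dim :: "(complex^'m::finite) set \<Rightarrow> complex^'m \<Rightarrow> enat" where
  "local_alg_dim X p = (SUP Z \<in> {Z. irreducible_component Z X \<and> p \<in> Z}. alg_dim Z)"

text \<open>The Zariski tangent space: the common kernel of the differentials at \<open>p\<close> of all polynomials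
  vanishing on \<open>X\<close> (the full ideal of \<open>X\<close>, not just some defining equations). The real Frechet
  derivative of a polynomial is its complex differential.\<close>

definition tangent_space :: "(complex^'m::finite) set \<Rightarrow> complex^'m \<Rightarrow> (complex^'m) set" where
  "tangent_space X p =
     {v. \<forall>f. cpoly_fun f \<and> (\<forall>x\<in>X. f x = 0) \<longrightarrow> frechet_derivative f (at p) v = 0}"

text \<open>\<^const>\<open>vec.dim\<close> is the dimension over the scalar field, here \<open>\<complex>\<close>.\<close>

definition Sing :: "(complex^'m::finite) set \<Rightarrow> (complex^'m) set" where
  "Sing X = {p \<in> X. enat (vec.dim (tangent_space X p)) \<noteq> local_alg_dim X p}"

definition C4_inf :: "(complex^'m::finite) set \<Rightarrow> (complex^'m) set" where
  "C4_inf X = {v. \<exists>p w. (\<forall>j::nat. p j \<in> X - Sing X \<and> w j \<in> tangent_space X (p j)) \<and>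
                        filterlim (\<lambda>j. norm (p j)) at_top sequentially \<and> w \<longlonglongrightarrow> v}"

end

(* Vectors are treated as points of affine spaces with freely chosen finite sets of variables, and an irreducible set
   is studied through its vanishing ideal. Pseudo-division by minimal relations gives elimination: a generic point of
   the projection of an irreducible set lifts to the set. Together with Noether normalization, where finiteness is
   read as properness, and the continuity of roots, this shows that the usual closure of the projection of a locally
   closed set is algebraic. Apply this to the tangent vectors over the regular points p, with the inverse t of
   the i-th coordinate of p as an additional variable: C4_inf X is the union over i of the slices t = 0 of the closures
   of the projections to (t, v), hence algebraic.

   Algebraic independence of coordinates computes the Krull dimension, and at generic points it also computes the
   dimension of the Zariski tangent space. The tangent space of the tangent bundle at (p, v) is an extension of a
   subspace of T_p X by a subspace of T_p X, so any 2k + 1 coordinates of v satisfy a polynomial relation on the tangent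
   bundle, and the relation survives in the limit. For the lower bound, generic points of an unbounded component are regular
   and dense, so regular points tend to infinity; a limit of their k-dimensional tangent spaces lies in C4_inf X. *)
theory Submission
  imports Defs "HOL-Library.Function_Algebras" "HOL-Computational_Algebra.Fundamental_Theorem_Algebra"
    "HOL-Complex_Analysis.Conformal_Mappings"
begin

section \<open>Polynomial functions and Zariski closure\<close>

text \<open>\<open>C4_inf X\<close> is defined by limits in the usual topology, while elimination
  controls only Zariski closures, which could a priori be larger. The core of the proof is therefore
  \<open>closure_locally_closed\<close>, and everything to which it is applied must be given by
  polynomial equations and inequations. Regularity is not of this form by definition: purity reduces
  it to a condition on the dimension of the tangent space, and Jacobian minors express that
  condition. Points going to infinity have no affine limit. Keeping only t and v makes the remaining
  data converge, at the price of projecting p away; this is why closures of projections are needed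
  and not just closures. Density of generic points amounts to openness of a finite map onto affine
  space, usually deduced from integral closedness. Here analysis takes over: properness bounds the
  roots of a minimal relation, hence its normalized coefficients, and a locally bounded quotient of
  polynomials is a polynomial. The upper bound uses relations between the coordinates of v alone, so
  that the escape of p does not disturb the limit; this gives 2k.\<close>

inductive pfun :: "'v set \<Rightarrow> (('v \<Rightarrow> complex) \<Rightarrow> complex) \<Rightarrow> bool" for V where
  pfun_const: "pfun V (\<lambda>x. c)"
| pfun_var: "i \<in> V \<Longrightarrow> pfun V (\<lambda>x. x i)"
| pfun_add: "pfun V f \<Longrightarrow> pfun V g \<Longrightarrow> pfun V (\<lambda>x. f x + g x)"
| pfun_mult: "pfun V f \<Longrightarrow> pfun V g \<Longrightarrow> pfun V (\<lambda>x. f x * g x)"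

definition van :: "'p set \<Rightarrow> ('p \<Rightarrow> complex) \<Rightarrow> bool" where
  "van A f \<longleftrightarrow> (\<forall>x\<in>A. f x = 0)"

text \<open>Up to the irrelevant coordinates outside \<open>V\<close>, \<open>zcl V A\<close> is the Zariski closure of the projection of \<open>A\<close>
  to \<open>\<complex>\<^sup>V\<close>.\<close>

definition zcl :: "'v set \<Rightarrow> ('v \<Rightarrow> complex) set \<Rightarrow> ('v \<Rightarrow> complex) set" where
  "zcl V A = {z. \<forall>f. pfun V f \<longrightarrow> van A f \<longrightarrow> f z = 0}"

text \<open>The set \<open>A\<close> need not be closed.\<close>

definition irr :: "('v \<Rightarrow> complex) set \<Rightarrow> bool" where
  "irr A \<longleftrightarrow> A \<noteq> {} \<and> (\<forall>f g. pfun UNIV f \<longrightarrow> pfun UNIV g \<longrightarrow> van A (\<lambda>x. f x * g x) \<longrightarrow> van A f \<or> van A g)"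

lemma pfun_mono: "pfun V f \<Longrightarrow> V \<subseteq> W \<Longrightarrow> pfun W f"
  by (induction rule: pfun.induct) (auto intro: pfun.intros)

lemma pfun_0 [intro]: "pfun V 0" "pfun V (\<lambda>x. 0)"
  and pfun_1 [intro]: "pfun V 1" "pfun V (\<lambda>x. 1)"
  unfolding zero_fun_def one_fun_def by (rule pfun_const)+

lemma pfun_plus: "pfun V f \<Longrightarrow> pfun V g \<Longrightarrow> pfun V (f + g)"
  and pfun_times: "pfun V f \<Longrightarrow> pfun V g \<Longrightarrow> pfun V (f * g)"
  unfolding plus_fun_def times_fun_def by (auto intro: pfun.intros)

lemma pfun_uminus: "pfun V f \<Longrightarrow> pfun V (- f)"
  using pfun_mult[OF pfun_const[of V "-1"], of f] by (simp add: fun_Compl_def)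

lemma pfun_minus: "pfun V f \<Longrightarrow> pfun V g \<Longrightarrow> pfun V (f - g)"
  using pfun_plus[OF _ pfun_uminus, of V f g] by simp

lemma pfun_diff: "pfun V f \<Longrightarrow> pfun V g \<Longrightarrow> pfun V (\<lambda>x. f x - g x)"
  using pfun_minus by (simp add: fun_diff_def)

lemma pfun_power: "pfun V f \<Longrightarrow> pfun V (f ^ n)"
  by (induction n) (auto intro: pfun_times)

lemma power_fun_apply: "((f :: 'p \<Rightarrow> complex) ^ n) x = f x ^ n"
  by (induction n) auto

lemma pfun_pow: "pfun V f \<Longrightarrow> pfun V (\<lambda>x. f x ^ n)"
  using pfun_power by (simp add: power_fun_apply fun_eq_iff[symmetric] flip: power_fun_apply)

lemma sum_fun_apply: "(sum F S) x = (\<Sum>i\<in>S. (F i :: 'p \<Rightarrow> complex) x)"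
  by (induction S rule: infinite_finite_induct) auto

lemma pfun_sum: "(\<And>i. i \<in> S \<Longrightarrow> pfun V (F i)) \<Longrightarrow> pfun V (sum F S)"
  by (induction S rule: infinite_finite_induct) (auto intro: pfun_plus)

lemma pfun_sum': "(\<And>i. i \<in> S \<Longrightarrow> pfun V (F i)) \<Longrightarrow> pfun V (\<lambda>x. \<Sum>i\<in>S. F i x)"
  using pfun_sum[of S V F] by (simp add: sum_fun_apply[abs_def])

lemma pfun_prod: "(\<And>i. i \<in> S \<Longrightarrow> pfun V (F i)) \<Longrightarrow> pfun V (\<lambda>x. \<Prod>i\<in>S. F i x)"
  by (induction S rule: infinite_finite_induct) (auto intro: pfun.intros)

lemma pfun_cong: "pfun V f \<Longrightarrow> (\<And>i. i \<in> V \<Longrightarrow> x i = y i) \<Longrightarrow> f x = f y"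
  by (induction rule: pfun.induct) auto

lemma pfun_upd: "pfun V f \<Longrightarrow> t \<notin> V \<Longrightarrow> f (x(t := c)) = f x"
  using pfun_cong[of V f "x(t := c)" x] by (metis fun_upd_apply)

lemma pfun_comp: "pfun V f \<Longrightarrow> (\<And>i. i \<in> V \<Longrightarrow> pfun W (\<lambda>y. h y i)) \<Longrightarrow> pfun W (\<lambda>y. f (h y))"
proof (induction rule: pfun.induct)
  case (pfun_add f g)
  show ?case using pfun.pfun_add[OF pfun_add.IH] pfun_add.prems by blast
next
  case (pfun_mult f g)
  show ?case using pfun.pfun_mult[OF pfun_mult.IH] pfun_mult.prems by blast
qed (auto intro: pfun_const)

text \<open>A polynomial function in the variables \<open>insert t V\<close> is handled as a univariate polynomial \<open>P\<close> over the ring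
  of functions, with coefficients in \<open>V\<close>: \<open>ev t P\<close> substitutes the variable \<open>t\<close>, \<open>pev z P\<close> evaluates the
  coefficients at \<open>z\<close>.\<close>

definition pcoef :: "'v set \<Rightarrow> (('v \<Rightarrow> complex) \<Rightarrow> complex) poly \<Rightarrow> bool" where
  "pcoef V P \<longleftrightarrow> (\<forall>i. pfun V (coeff P i))"

definition ev :: "'v \<Rightarrow> (('v \<Rightarrow> complex) \<Rightarrow> complex) poly \<Rightarrow> ('v \<Rightarrow> complex) \<Rightarrow> complex" where
  "ev t P = poly P (\<lambda>x. x t)"

definition pev :: "('v \<Rightarrow> complex) \<Rightarrow> (('v \<Rightarrow> complex) \<Rightarrow> complex) poly \<Rightarrow> complex poly" where
  "pev z P = map_poly (\<lambda>a. a z) P"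

lemma coeff_pev [simp]: "coeff (pev z P) i = coeff P i z"
  by (simp add: pev_def coeff_map_poly)

lemma pev_add [simp]: "pev z (P + Q) = pev z P + pev z Q"
  and pev_mult [simp]: "pev z (P * Q) = pev z P * pev z Q"
  and pev_smult [simp]: "pev z (smult a P) = smult (a z) (pev z P)"
  by (auto intro!: poly_eqI simp: coeff_mult sum_fun_apply)

lemma degree_pev: "degree (pev z P) \<le> degree P"
  by (rule degree_le) (simp add: coeff_eq_0)

lemma ev_add [simp]: "ev t (P + Q) = ev t P + ev t Q"
  and ev_mult [simp]: "ev t (P * Q) = ev t P * ev t Q"
  and ev_smult [simp]: "ev t (smult a P) = a * ev t P"
  and ev_0 [simp]: "ev t 0 = 0"
  by (simp_all add: ev_def)

lemma ev_altdef: "ev t P x = (\<Sum>i\<le>degree P. coeff P i x * x t ^ i)"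
  by (simp add: ev_def poly_altdef sum_fun_apply power_fun_apply)

lemma poly_altdef_le: "degree (p :: complex poly) \<le> n \<Longrightarrow> poly p x = (\<Sum>i\<le>n. coeff p i * x ^ i)"
  unfolding poly_altdef by (rule sum.mono_neutral_left) (auto simp: coeff_eq_0)

lemma ev_pev: "ev t P x = poly (pev x P) (x t)"
proof -
  have "poly (pev x P) (x t) = (\<Sum>i\<le>degree P. coeff P i x * x t ^ i)"
    using poly_altdef_le[OF degree_pev, of x P "x t"] by simp
  then show ?thesis by (simp add: ev_altdef)
qed

lemma pev_upd: "pcoef V P \<Longrightarrow> t \<notin> V \<Longrightarrow> pev (x(t := c)) P = pev x P"
  by (rule poly_eqI) (metis coeff_pev pcoef_def pfun_upd)

lemma ev_upd: "pcoef V P \<Longrightarrow> t \<notin> V \<Longrightarrow> ev t P (x(t := c)) = poly (pev x P) c"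
  by (simp add: ev_pev pev_upd)

lemma pfun_ev: "pcoef V P \<Longrightarrow> pfun (insert t V) (ev t P)"
  unfolding ev_altdef[abs_def]
  by (intro pfun_sum' pfun_mult pfun_pow pfun_var) (auto simp: pcoef_def intro: pfun_mono)

lemma pcoef_0 [intro]: "pcoef V 0"
  by (auto simp: pcoef_def)

lemma pcoef_add: "pcoef V P \<Longrightarrow> pcoef V Q \<Longrightarrow> pcoef V (P + Q)"
  and pcoef_diff: "pcoef V P \<Longrightarrow> pcoef V Q \<Longrightarrow> pcoef V (P - Q)"
  and pcoef_smult: "pfun V a \<Longrightarrow> pcoef V P \<Longrightarrow> pcoef V (smult a P)"
  and pcoef_mult: "pcoef V P \<Longrightarrow> pcoef V Q \<Longrightarrow> pcoef V (P * Q)"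
  and pcoef_monom: "pfun V a \<Longrightarrow> pcoef V (monom a n)"
  by (auto simp: pcoef_def coeff_mult intro!: pfun_plus pfun_minus pfun_times pfun_sum)

lemma pcoef_mono: "pcoef V P \<Longrightarrow> V \<subseteq> W \<Longrightarrow> pcoef W P"
  by (auto simp: pcoef_def intro: pfun_mono)

lemma pfun_ev_ex:
  assumes "pfun W f" "W \<subseteq> insert t V"
  shows "\<exists>P. pcoef V P \<and> f = ev t P"
  using assms
proof (induction rule: pfun.induct)
  case (pfun_const c)
  show ?case
    by (intro exI[of _ "[:\<lambda>x. c:]"]) (auto simp: pcoef_def ev_def coeff_pCons intro: pfun.intros split: nat.splits)
next
  case (pfun_var i)
  show ?case
  proof (cases "i = t")
    case True
    then show ?thesis
      by (intro exI[of _ "[:0, 1:]"]) (auto simp: pcoef_def ev_def coeff_pCons split: nat.splits)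
  next
    case False
    with pfun_var show ?thesis
      by (intro exI[of _ "[:\<lambda>x. x i:]"]) (auto simp: pcoef_def ev_def coeff_pCons intro: pfun.intros split: nat.splits)
  qed
next
  case (pfun_add f g)
  then obtain P Q where "pcoef V P" "f = ev t P" "pcoef V Q" "g = ev t Q" by blast
  then show ?case
    by (intro exI[of _ "P + Q"]) (auto simp: plus_fun_def intro: pcoef_add)
next
  case (pfun_mult f g)
  then obtain P Q where "pcoef V P" "f = ev t P" "pcoef V Q" "g = ev t Q" by blast
  then show ?case
    by (intro exI[of _ "P * Q"]) (auto simp: times_fun_def intro: pcoef_mult)
qed

text \<open>The coefficients are functions and cannot be inverted, so a power of the leading
  coefficient is spent instead. Saying that the coefficients of \<open>R\<close> vanish from
  \<open>degree M\<close> on, rather than comparing degrees, also covers a constant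
  \<open>M\<close>, where \<open>R\<close> must be 0.\<close>

lemma pseudo_division:
  assumes "pcoef V M" "pcoef V P"
  shows "\<exists>N S R. pcoef V S \<and> pcoef V R \<and> smult (lead_coeff M ^ N) P = S * M + R \<and>
           (\<forall>i\<ge>degree M. coeff R i = 0)"
proof -
  let ?l = "lead_coeff M"
  have l: "pfun V ?l" using assms by (auto simp: pcoef_def)
  \<comment> \<open>Induction on the excess \<open>n\<close> of \<open>P\<close> over the degree of
    \<open>M\<close>: each step multiplies by the leading coefficient and cancels the top
    term.\<close>
  have "pcoef V P \<Longrightarrow> (\<forall>i\<ge>degree M + n. coeff P i = 0) \<Longrightarrow>
     \<exists>N S R. pcoef V S \<and> pcoef V R \<and> smult (?l ^ N) P = S * M + R \<and> (\<forall>i\<ge>degree M. coeff R i = 0)" for n P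
  proof (induction n arbitrary: P)
    case 0
    then have "pcoef V 0 \<and> pcoef V P \<and> smult (?l ^ 0) P = 0 * M + P \<and> (\<forall>i\<ge>degree M. coeff P i = 0)"
      by auto
    then show ?case by blast
  next
    case (Suc n)
    define c where "c = coeff P (degree M + n)"
    have c: "pfun V c" using Suc by (auto simp: c_def pcoef_def)
    define Q where "Q = smult ?l P - monom c n * M"
    have Q: "pcoef V Q" unfolding Q_def
      using l c Suc assms by (intro pcoef_diff pcoef_smult pcoef_mult pcoef_monom) auto
    have "coeff Q i = 0" if "i \<ge> degree M + n" for i
    proof (cases "i = degree M + n")
      case True
      then show ?thesis
        by (simp add: Q_def c_def coeff_monom_mult)
    next
      case False
      with that have "i \<ge> degree M + Suc n" by simp
      with Suc.prems have "coeff P i = 0" by blast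
      moreover from that False have "coeff M (i - n) = 0" by (intro coeff_eq_0) linarith
      ultimately show ?thesis
        by (simp only: Q_def coeff_monom_mult coeff_diff coeff_smult mult_zero_right) simp
    qed
    with Suc.IH[OF Q] obtain N S R where *: "pcoef V S" "pcoef V R" "smult (?l ^ N) Q = S * M + R"
        "\<forall>i\<ge>degree M. coeff R i = 0" by blast
    have "smult (?l ^ Suc N) P = smult (?l ^ N) (Q + monom c n * M)"
      by (simp add: Q_def mult.commute)
    also have "\<dots> = (S + smult (?l^N) (monom c n)) * M + R"
      by (simp add: smult_add_right * algebra_simps)
    finally have "smult (?l ^ Suc N) P = (S + smult (?l^N) (monom c n)) * M + R" .
    moreover have "pcoef V (S + smult (?l^N) (monom c n))"
      by (rule pcoef_add[OF *(1) pcoef_smult[OF pfun_power[OF l] pcoef_monom[OF c]]])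
    ultimately show ?case using * by blast
  qed
  from this[OF assms(2), of "Suc (degree P)"] show ?thesis
    by (simp add: coeff_eq_0)
qed

section \<open>Vanishing, Zariski closure and irreducibility\<close>

lemma vanI: "(\<And>x. x \<in> A \<Longrightarrow> f x = 0) \<Longrightarrow> van A f"
  and vanD: "van A f \<Longrightarrow> x \<in> A \<Longrightarrow> f x = 0"
  by (auto simp: van_def)

lemma zclI: "(\<And>f. pfun V f \<Longrightarrow> van A f \<Longrightarrow> f z = 0) \<Longrightarrow> z \<in> zcl V A"
  and zclD: "z \<in> zcl V A \<Longrightarrow> pfun V f \<Longrightarrow> van A f \<Longrightarrow> f z = 0"
  by (auto simp: zcl_def)

lemma subset_zcl: "A \<subseteq> zcl V A"
  by (auto simp: zcl_def van_def)

lemma van_zcl: "pfun V f \<Longrightarrow> van (zcl V A) f \<longleftrightarrow> van A f"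
  by (auto simp: zcl_def van_def)

lemma zcl_mono: "A \<subseteq> B \<Longrightarrow> zcl V A \<subseteq> zcl V B"
  by (auto simp: zcl_def van_def)

lemma zcl_zcl [simp]: "zcl V (zcl V A) = zcl V A"
  by (auto simp: zcl_def van_def)

lemma zcl_vars_mono: "V \<subseteq> W \<Longrightarrow> zcl W A \<subseteq> zcl V A"
  by (auto simp: zcl_def intro: pfun_mono)

lemma van_add: "van A f \<Longrightarrow> van A g \<Longrightarrow> van A (f + g)"
  and van_diff: "van A f \<Longrightarrow> van A g \<Longrightarrow> van A (f - g)"
  and van_mult_left: "van A f \<Longrightarrow> van A (f * g)"
  and van_mult_right: "van A g \<Longrightarrow> van A (f * g)"
  by (auto simp: van_def)

lemma irrD: "irr A \<Longrightarrow> pfun V f \<Longrightarrow> pfun W g \<Longrightarrow> van A (f * g) \<Longrightarrow> van A f \<or> van A g"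
  unfolding irr_def times_fun_def by (meson pfun_mono subset_UNIV)

lemma irr_pow: "irr A \<Longrightarrow> pfun V f \<Longrightarrow> van A (f ^ n) \<Longrightarrow> van A f"
proof (induction n)
  case 0
  then show ?case by (auto simp: irr_def van_def)
next
  case (Suc n)
  then show ?case using irrD[of A V f V "f ^ n"] pfun_power[of V f n] by (simp only: power_Suc) blast
qed

lemma irr_image:
  assumes "irr A" "\<And>i. pfun UNIV (\<lambda>y. h y i)"
  shows "irr (h ` A)"
  unfolding irr_def
proof (intro conjI allI impI)
  show "h ` A \<noteq> {}" using assms by (auto simp: irr_def)
  fix f g assume fg: "pfun UNIV f" "pfun UNIV g" "van (h ` A) (\<lambda>x. f x * g x)"
  have "van A ((\<lambda>y. f (h y)) * (\<lambda>y. g (h y)))" using fg(3) by (auto simp: van_def)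
  moreover have "pfun UNIV (\<lambda>y. f (h y))" "pfun UNIV (\<lambda>y. g (h y))"
    using fg(1,2) assms(2) by (auto intro: pfun_comp[where h = h])
  ultimately have "van A (\<lambda>y. f (h y)) \<or> van A (\<lambda>y. g (h y))"
    using irrD[OF assms(1), of UNIV "\<lambda>y. f (h y)" UNIV "\<lambda>y. g (h y)"] by blast
  then show "van (h ` A) f \<or> van (h ` A) g" by (auto simp: van_def)
qed

lemma irr_zcl: "irr A \<Longrightarrow> irr (zcl UNIV A)"
  unfolding irr_def using subset_zcl[of A UNIV]
  by (auto simp: van_zcl pfun_mult)

text \<open>Restriction to a complex line reduces questions of nonvanishing to univariate
  polynomials, which have finitely many roots.\<close>

lemma pfun_line: "pfun V f \<Longrightarrow> \<exists>q. \<forall>s. f (\<lambda>i. y i + s * v i) = poly q s"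
proof (induction rule: pfun.induct)
  case (pfun_const c)
  show ?case by (rule exI[of _ "[:c:]"]) simp
next
  case (pfun_var i)
  show ?case by (rule exI[of _ "[:y i, v i:]"]) simp
next
  case (pfun_add f g)
  then obtain p q where "\<forall>s. f (\<lambda>i. y i + s * v i) = poly p s" "\<forall>s. g (\<lambda>i. y i + s * v i) = poly q s" by blast
  then show ?case by (intro exI[of _ "p + q"]) simp
next
  case (pfun_mult f g)
  then obtain p q where "\<forall>s. f (\<lambda>i. y i + s * v i) = poly p s" "\<forall>s. g (\<lambda>i. y i + s * v i) = poly q s" by blast
  then show ?case by (intro exI[of _ "p * q"]) simp
qed

lemma pfun_prod_nonzero:
  assumes "pfun V f" "pfun W g" "f a \<noteq> 0" "g b \<noteq> 0"
  shows "\<exists>s. f (\<lambda>i. a i + s * (b i - a i)) \<noteq> 0 \<and> g (\<lambda>i. a i + s * (b i - a i)) \<noteq> 0"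
proof -
  obtain p q where p: "\<forall>s. f (\<lambda>i. a i + s * (b i - a i)) = poly p s"
    and q: "\<forall>s. g (\<lambda>i. a i + s * (b i - a i)) = poly q s"
    using pfun_line[OF assms(1), of a "\<lambda>i. b i - a i"] pfun_line[OF assms(2), of a "\<lambda>i. b i - a i"] by auto
  have "p \<noteq> 0" using p[rule_format, of 0] assms by auto
  moreover have "q \<noteq> 0" using q[rule_format, of 1] assms by auto
  ultimately have "p * q \<noteq> 0" by (rule no_zero_divisors)
  then obtain s where "poly (p * q) s \<noteq> 0" using poly_all_0_iff_0 by blast
  then show ?thesis using p q by auto
qed

text \<open>If \<open>f\<close> is nonzero at \<open>a\<close> and \<open>g\<close> at
  \<open>b\<close>, both are nonzero at some point of the line through \<open>a\<close> and
  \<open>b\<close>, and that line stays in \<open>A\<close>. Applied to the whole space and to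
  linear subspaces.\<close>

lemma irr_affine:
  assumes "A \<noteq> {}" "\<And>a b s. a \<in> A \<Longrightarrow> b \<in> A \<Longrightarrow> (\<lambda>i. a i + s * (b i - a i)) \<in> A"
  shows "irr A"
  unfolding irr_def
proof (intro conjI allI impI)
  fix f g assume fg: "pfun UNIV f" "pfun UNIV g" "van A (\<lambda>x. f x * g x)"
  show "van A f \<or> van A g"
  proof (rule ccontr)
    assume "\<not> (van A f \<or> van A g)"
    then obtain a b where ab: "a \<in> A" "b \<in> A" "f a \<noteq> 0" "g b \<noteq> 0" by (auto simp: van_def)
    define l where "l s = (\<lambda>i. a i + s * (b i - a i))" for s
    obtain s where "f (l s) \<noteq> 0" "g (l s) \<noteq> 0"
      using pfun_prod_nonzero[OF fg(1,2), of a b] ab(3,4) unfolding l_def by blast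
    moreover have "l s \<in> A" using assms(2)[OF ab(1,2), of s] by (simp only: l_def)
    ultimately show False using fg(3) by (auto simp: van_def)
  qed
qed fact

lemma irr_UNIV: "irr UNIV"
  by (rule irr_affine) auto

text \<open>On the line from \<open>y\<close> towards a point where \<open>f\<close> is nonzero,
  arbitrarily small parameters avoid the finitely many roots. The direction is 0 outside
  \<open>V\<close>, so the other coordinates stay fixed.\<close>

lemma pfun_dense:
  assumes "pfun V f" "f a \<noteq> 0" "finite V" "\<epsilon> > 0"
  shows "\<exists>x. f x \<noteq> 0 \<and> (\<forall>i\<in>V. cmod (x i - y i) < \<epsilon>) \<and> (\<forall>i. i \<notin> V \<longrightarrow> x i = y i)"
proof -
  define v where "v = (\<lambda>i. if i \<in> V then a i - y i else 0)"
  obtain q where q: "\<And>s. f (\<lambda>i. y i + s * v i) = poly q s"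
    using pfun_line[OF assms(1), of y v] by auto
  have "f (\<lambda>i. y i + 1 * v i) = f a"
    by (rule pfun_cong[OF assms(1)]) (auto simp: v_def)
  with q[of 1] assms(2) have "q \<noteq> 0" by auto
  define B where "B = (\<Sum>i\<in>V. cmod (v i)) + 1"
  have B: "B > 0" by (simp add: B_def add_nonneg_pos sum_nonneg)
  have "infinite (ball (0::complex) (\<epsilon> / B))"
    using B assms(4) by (intro uncountable_infinite uncountable_ball) auto
  moreover have "finite {s. poly q s = 0}" using \<open>q \<noteq> 0\<close> poly_roots_finite by blast
  ultimately have "\<not> ball 0 (\<epsilon> / B) \<subseteq> {s. poly q s = 0}"
    by (metis finite_subset)
  then obtain s where "s \<in> ball 0 (\<epsilon> / B)" "s \<notin> {s. poly q s = 0}" by blast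
  then have s: "cmod s < \<epsilon> / B" "poly q s \<noteq> 0" by auto
  show ?thesis
  proof (intro exI conjI ballI allI impI)
    show "f (\<lambda>i. y i + s * v i) \<noteq> 0" using q s by simp
    fix i assume i: "i \<in> V"
    have "cmod (v i) \<le> B" using member_le_sum[OF i, of "\<lambda>i. cmod (v i)"] assms(3) by (simp add: B_def)
    then have "cmod s * cmod (v i) \<le> cmod s * B" by (simp add: mult_left_mono)
    also have "\<dots> < \<epsilon>" using s(1) B by (simp add: field_simps)
    finally show "cmod (y i + s * v i - y i) < \<epsilon>" by (simp add: norm_mult)
  next
    fix i assume "i \<notin> V" then show "y i + s * v i = y i" by (simp add: v_def)
  qed
qed

section \<open>Elimination\<close>

text \<open>The minimality clause speaks about all relations of smaller degree modulo the vanishing ideal of \<open>A\<close>, which is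
  the form in which pseudo-division by \<open>P\<close> uses it.\<close>

definition minpol :: "('v \<Rightarrow> complex) set \<Rightarrow> 'v set \<Rightarrow> 'v \<Rightarrow> (('v \<Rightarrow> complex) \<Rightarrow> complex) poly \<Rightarrow> bool" where
  "minpol A V t P \<longleftrightarrow> pcoef V P \<and> \<not> van A (lead_coeff P) \<and> van A (ev t P) \<and>
     (\<forall>R. pcoef V R \<longrightarrow> van A (ev t R) \<longrightarrow> (\<forall>i\<ge>degree P. coeff R i = 0) \<longrightarrow> (\<forall>i. van A (coeff R i)))"

text \<open>For irreducible \<open>A\<close> this is algebraicity of \<open>t\<close> over the
  subfield generated by \<open>V\<close> in the function field of \<open>A\<close>; hence the
  nontriviality of the relation is required modulo the vanishing ideal and not merely as a
  polynomial.\<close>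

definition alg_over :: "('v \<Rightarrow> complex) set \<Rightarrow> 'v set \<Rightarrow> 'v \<Rightarrow> bool" where
  "alg_over A V t \<longleftrightarrow> (\<exists>P. pcoef V P \<and> van A (ev t P) \<and> (\<exists>i. \<not> van A (coeff P i)))"

lemma van_ev_coeffs:
  assumes "\<And>i. van A (coeff R i)"
  shows "van A (ev t R)"
  using assms by (auto simp: van_def ev_altdef)

lemma not_van_ev:
  assumes "\<not> alg_over A V t" "pcoef V P"
  shows "van A (ev t P) \<longleftrightarrow> (\<forall>i. van A (coeff P i))"
  using assms van_ev_coeffs[of A P t] unfolding alg_over_def by blast

text \<open>A nontrivial relation of least degree works: if its leading coefficient vanished on
  \<open>A\<close>, dropping the top term would leave a nontrivial relation of smaller
  degree.\<close>

lemma minpol_exists: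
  assumes "alg_over A V t"
  shows "\<exists>P. minpol A V t P"
proof -
  define good where "good P \<longleftrightarrow> pcoef V P \<and> van A (ev t P) \<and> (\<exists>i. \<not> van A (coeff P i))" for P
  obtain P0 where "good P0" using assms by (auto simp: alg_over_def good_def)
  then obtain P where P: "good P" and min: "\<And>R. good R \<Longrightarrow> degree P \<le> degree R"
    using ex_has_least_nat[of good P0 degree] by blast
  have lc: "\<not> van A (lead_coeff P)"
  proof
    assume v: "van A (lead_coeff P)"
    define R where "R = P - monom (lead_coeff P) (degree P)"
    have P': "pcoef V P" "van A (ev t P)" using P by (auto simp: good_def)
    have "pcoef V R" using P' unfolding R_def
      by (intro pcoef_diff pcoef_monom) (auto simp: pcoef_def)
    moreover have "van A (ev t R)"
    proof (rule vanI)
      fix x assume x: "x \<in> A"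
      have "ev t P = ev t R + ev t (monom (lead_coeff P) (degree P))"
        by (simp flip: ev_add add: R_def)
      moreover have "van A (ev t (monom (lead_coeff P) (degree P)))"
        using v by (intro van_ev_coeffs) (auto simp: van_def)
      ultimately show "ev t R x = 0" using vanD[OF P'(2) x] vanD[OF _ x] by (metis add.right_neutral plus_fun_apply)
    qed
    moreover obtain i where i: "\<not> van A (coeff P i)" using P by (auto simp: good_def)
    have "coeff R i = coeff P i" using i v by (auto simp: R_def)
    ultimately have "good R" using i unfolding good_def by metis
    have "i < degree P" using i v by (metis coeff_eq_0 linorder_neqE_nat van_def zero_fun_apply)
    have "degree R < degree P"
    proof (rule ccontr)
      assume "\<not> degree R < degree P"
      moreover have "degree R \<le> degree P" unfolding R_def
        by (intro degree_diff_le degree_monom_le) simp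
      ultimately have "degree R = degree P" by simp
      then have "lead_coeff R = 0" by (simp add: R_def)
      then have "R = 0" by simp
      then have "coeff R i = 0" by simp
      then show False using \<open>coeff R i = coeff P i\<close> i by (simp add: van_def)
    qed
    with min[OF \<open>good R\<close>] show False by simp
  qed
  have "van A (coeff R i)" if R: "pcoef V R" "van A (ev t R)" "\<forall>i\<ge>degree P. coeff R i = 0" for R i
  proof (rule ccontr)
    assume "\<not> van A (coeff R i)"
    with R have "good R" by (auto simp: good_def)
    from min[OF this] R(3) have "lead_coeff R = 0" by blast
    then have "R = 0" by simp
    then show False using \<open>\<not> van A (coeff R i)\<close> by (simp add: van_def)
  qed
  with P lc show ?thesis unfolding minpol_def good_def by blast
qed

lemma minpol_degree:
  assumes "minpol A V t P"
  shows "degree P > 0"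
proof (rule ccontr)
  assume "\<not> degree P > 0"
  then have "ev t P = lead_coeff P" by (intro ext) (simp add: ev_altdef)
  with assms show False by (auto simp: minpol_def)
qed

text \<open>Pseudo-division by \<open>P\<close> leaves a remainder whose coefficients vanish on
  \<open>A\<close> by minimality, hence also at \<open>z\<close>. So every polynomial vanishing on
  \<open>A\<close> is, over \<open>z\<close> and up to a nonzero factor, a multiple of
  \<open>P\<close>.\<close>

lemma minpol_zcl:
  assumes A: "irr A" and P: "minpol A V t P" and t: "t \<notin> V" and z: "z \<in> zcl V A"
    and l: "lead_coeff P z \<noteq> 0" and c: "poly (pev z P) c = 0"
  shows "z(t := c) \<in> zcl (insert t V) A"
proof (rule zclI)
  fix f assume f: "pfun (insert t V) f" "van A f"
  obtain F where F: "pcoef V F" "f = ev t F" using pfun_ev_ex[OF f(1) subset_refl] by blast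
  have P': "pcoef V P" "van A (ev t P)"
    and min: "\<And>R i. pcoef V R \<Longrightarrow> van A (ev t R) \<Longrightarrow> (\<forall>i\<ge>degree P. coeff R i = 0) \<Longrightarrow> van A (coeff R i)"
    using P by (auto simp: minpol_def)
  obtain N S R where *: "pcoef V S" "pcoef V R" "smult (lead_coeff P ^ N) F = S * P + R"
     "\<forall>i\<ge>degree P. coeff R i = 0" using pseudo_division[OF P'(1) F(1)] by blast
  have "lead_coeff P ^ N * ev t F = ev t S * ev t P + ev t R" 
    using arg_cong[OF *(3), of "ev t"] by simp
  then have eq: "lead_coeff P x ^ N * ev t F x = ev t S x * ev t P x + ev t R x" for x
    by (metis plus_fun_apply times_fun_apply power_fun_apply)
  have "van A (ev t R)"
  proof (rule vanI)
    fix x assume "x \<in> A"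
    then show "ev t R x = 0" using eq[of x] f(2) P'(2) F(2) by (simp add: van_def)
  qed
  from min[OF *(2) this *(4)] have "coeff R i z = 0" for i
    using z *(2) by (auto intro: zclD simp: pcoef_def)
  then have "ev t R (z(t := c)) = 0" using ev_upd[OF *(2) t] by (simp add: poly_altdef)
  moreover have "ev t P (z(t := c)) = 0" using ev_upd[OF P'(1) t] c by simp
  moreover have "lead_coeff P (z(t := c)) = lead_coeff P z"
    using P'(1) t by (intro pfun_upd) (auto simp: pcoef_def)
  ultimately show "f (z(t := c)) = 0" using eq[of "z(t := c)"] l F(2) by simp
qed

lemma degree_lt_of_coeffs:
  assumes "\<forall>i\<ge>n. coeff R i = 0" shows "R = 0 \<or> degree R < n"
proof (cases "R = 0")
  case False
  then have "lead_coeff R \<noteq> 0" by simp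
  with assms show ?thesis by (meson leI)
qed auto

text \<open>Euclidean algorithm for \<open>P\<close> and \<open>L\<close> modulo the vanishing ideal.\<close>

lemma eliminate_alg:
  assumes A: "irr A" and P: "minpol A V t P" and t: "t \<notin> V"
    and L: "pfun (insert t V) L" "\<not> van A L"
  shows "\<exists>b S. pfun V b \<and> \<not> van A b \<and> pfun (insert t V) S \<and> van A (b - S * L)"
proof -
  have P': "pcoef V P" "van A (ev t P)" "\<not> van A (lead_coeff P)"
    and min: "\<And>R i. pcoef V R \<Longrightarrow> van A (ev t R) \<Longrightarrow> (\<forall>i\<ge>degree P. coeff R i = 0) \<Longrightarrow> van A (coeff R i)"
    using P by (auto simp: minpol_def)
  have lP: "pfun V (lead_coeff P)" using P' by (auto simp: pcoef_def)
  \<comment> \<open>These are the nonvanishing multiples of \<open>L\<close> modulo the ideal of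
    \<open>A\<close>, written as polynomials in \<open>t\<close>; one of degree 0 is the required
    \<open>b\<close>.\<close>
  define good where "good M \<longleftrightarrow> pcoef V M \<and> \<not> van A (ev t M) \<and> (\<exists>S. pfun (insert t V) S \<and> van A (ev t M - S * L))" for M
  obtain F where F: "pcoef V F" "L = ev t F" using pfun_ev_ex[OF L(1) subset_refl] by blast
  have "good F" unfolding good_def using F L by (auto intro!: exI[of _ 1] simp: van_def)
  then obtain M where M: "good M" and least: "\<And>R. good R \<Longrightarrow> degree M \<le> degree R"
    using ex_has_least_nat[of good F degree] by blast
  obtain S0 where M': "pcoef V M" "\<not> van A (ev t M)" "pfun (insert t V) S0" "van A (ev t M - S0 * L)"
    using M by (auto simp: good_def)
  have bad: "van A (ev t R)" if "pcoef V R" "pfun (insert t V) S" "van A (ev t R - S * L)" "\<forall>i\<ge>degree M. coeff R i = 0" for R S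
  proof (rule ccontr)
    assume n: "\<not> van A (ev t R)"
    with that least[of R] have "degree M \<le> degree R" by (auto simp: good_def)
    with degree_lt_of_coeffs[OF that(4)] have "R = 0" by auto
    with n show False by (simp add: van_def)
  qed
  have lM: "pfun V (lead_coeff M)" using M' by (auto simp: pcoef_def)
  have nlM: "\<not> van A (lead_coeff M)"
  proof
    assume v: "van A (lead_coeff M)"
    define R where "R = M - monom (lead_coeff M) (degree M)"
    have evM: "ev t M = ev t R + ev t (monom (lead_coeff M) (degree M))"
      by (simp flip: ev_add add: R_def)
    have v2: "van A (ev t (monom (lead_coeff M) (degree M)))"
      using v by (intro van_ev_coeffs) (auto simp: van_def)
    have R: "pcoef V R" using M' lM unfolding R_def by (intro pcoef_diff pcoef_monom) 
    have "coeff R i = 0" if "i \<ge> degree M" for i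
      using that by (cases "i = degree M") (auto simp: R_def coeff_eq_0)
    moreover have "van A (ev t R - S0 * L)" using M'(4) evM v2 by (auto simp: van_def)
    ultimately have "van A (ev t R)" using bad[OF R M'(3)] by blast
    then show False using M'(2) evM v2 by (auto simp: van_def)
  qed
  \<comment> \<open>Otherwise dividing \<open>P\<close> by \<open>M\<close> leaves a remainder in
    the ideal, and irreducibility puts the cofactor \<open>S\<close> there too. But \<open>S\<close>
    has smaller degree than \<open>P\<close>, so by minimality its leading coefficient vanishes on
    \<open>A\<close>, contradicting the product formula for leading coefficients.\<close>
  have "degree M = 0"
  proof (rule ccontr)
    assume d: "degree M \<noteq> 0"
    have "degree M < degree P"
    proof (rule ccontr)
      assume c: "\<not> degree M < degree P"
      obtain N S R where *: "pcoef V S" "pcoef V R" "smult (lead_coeff P ^ N) M = S * P + R"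
        "\<forall>i\<ge>degree P. coeff R i = 0" using pseudo_division[OF P'(1) M'(1)] by blast
      have eq: "lead_coeff P ^ N * ev t M = ev t S * ev t P + ev t R" 
        using arg_cong[OF *(3), of "ev t"] by simp
      have e: "lead_coeff P ^ N * (ev t M - S0 * L) = ev t S * ev t P + (ev t R - lead_coeff P ^ N * S0 * L)"
        using eq by (simp add: algebra_simps)
      have "van A (ev t R - lead_coeff P ^ N * S0 * L)"
        using e van_mult_right[OF M'(4), of "lead_coeff P ^ N"] van_mult_right[OF P'(2), of "ev t S"]
        by (metis add_diff_cancel_left' van_diff)
      then have "van A (ev t R)"
        using c *(2,4) by (intro bad[of R "lead_coeff P ^ N * S0"])
           (auto intro!: pfun_times M'(3) pfun_power pfun_mono[OF lP])
      then have "van A (lead_coeff P ^ N * ev t M)"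
        using eq van_mult_right[OF P'(2), of "ev t S"] by (simp add: van_add)
      then show False
        using irrD[OF A pfun_power[OF lP] pfun_ev[OF M'(1)]] irr_pow[OF A lP] P'(3) M'(2) by blast
    qed
    obtain N S R where *: "pcoef V S" "pcoef V R" "smult (lead_coeff M ^ N) P = S * M + R"
        "\<forall>i\<ge>degree M. coeff R i = 0" using pseudo_division[OF M'(1) P'(1)] by blast
    have eq: "lead_coeff M ^ N * ev t P = ev t S * ev t M + ev t R" 
      using arg_cong[OF *(3), of "ev t"] by simp
    have "ev t R - (- ev t S * S0) * L = lead_coeff M ^ N * ev t P - ev t S * (ev t M - S0 * L)"
      using eq by (simp add: algebra_simps)
    then have "van A (ev t R - (- ev t S * S0) * L)"
      using van_diff[OF van_mult_right[OF P'(2)] van_mult_right[OF M'(4)]] by metis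
    then have "van A (ev t R)"
      using *(4) by (intro bad[OF *(2), of "- ev t S * S0"]) (auto intro!: pfun_times pfun_uminus pfun_ev *(1) M'(3))
    with eq have "van A (ev t S * ev t M)"
      using van_mult_right[OF P'(2), of "lead_coeff M ^ N"] by (metis add_diff_cancel_right' van_diff)
    then have vS: "van A (ev t S)" using irrD[OF A pfun_ev[OF *(1)] pfun_ev[OF M'(1)]] M'(2) by blast
    have nz: "\<not> van A (lead_coeff M ^ N * lead_coeff P)"
      using irrD[OF A pfun_power[OF lM] lP] irr_pow[OF A lM] P'(3) nlM by blast
    have top: "lead_coeff M ^ N * coeff P i = coeff (S * M) i" if "i \<ge> degree M" for i
      using arg_cong[OF *(3), of "\<lambda>p. coeff p i"] *(4) that by simp
    have lS: "pfun V (lead_coeff S)" using *(1) by (auto simp: pcoef_def)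
    \<comment> \<open>Functions have zero divisors, so degrees need not add. Polynomial functions
      have none, which is \<open>irr_UNIV\<close>.\<close>
    have "degree S + degree M = degree P"
    proof (rule ccontr)
      assume ne: "degree S + degree M \<noteq> degree P"
      show False
      proof (cases "degree S + degree M < degree P")
        case True
        then have "degree (S * M) < degree P" using degree_mult_le[of S M] by linarith
        then have "coeff (S * M) (degree P) = 0" by (rule coeff_eq_0)
        with top[of "degree P"] \<open>degree M < degree P\<close> nz show False by (simp add: van_def)
      next
        case False
        then have "coeff P (degree S + degree M) = 0" using ne by (intro coeff_eq_0) simp
        with top[of "degree S + degree M"] have "lead_coeff S * lead_coeff M = 0"
          by (simp add: coeff_mult_degree_sum)
        then have "van UNIV (lead_coeff S) \<or> van UNIV (lead_coeff M)"
          using irrD[OF irr_UNIV lS lM] by (simp add: van_def)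
        then have "lead_coeff S = 0" using nlM by (intro ext) (auto simp: van_def)
        then have "S = 0" by simp
        with top[of "degree P"] \<open>degree M < degree P\<close> nz show False by (simp add: van_def)
      qed
    qed
    then have "van A (lead_coeff S)" using d by (intro min[OF *(1) vS]) (auto intro: coeff_eq_0)
    moreover have "lead_coeff M ^ N * lead_coeff P = lead_coeff S * lead_coeff M"
      using top[of "degree P"] \<open>degree M < degree P\<close> \<open>degree S + degree M = degree P\<close>
      by (metis coeff_mult_degree_sum less_imp_le)
    ultimately show False using nz van_mult_left by metis
  qed
  then have "ev t M = lead_coeff M" by (intro ext) (simp add: ev_altdef)
  then show ?thesis using M' nlM lM by (intro exI[of _ "lead_coeff M"] exI[of _ S0]) auto
qed


text \<open>Elimination gives \<open>b = S * L\<close> on the closure of \<open>A\<close>. Where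
  \<open>b\<close> and the leading coefficient are nonzero, every root of the minimal relation
  therefore yields a point of the closure at which \<open>L\<close> is nonzero.\<close>

lemma extend_alg:
  assumes A: "irr A" and P: "minpol A V t P" and t: "t \<notin> V"
    and L: "pfun (insert t V) L" "\<not> van A L"
  shows "\<exists>L'. pfun V L' \<and> \<not> van A L' \<and> (\<forall>z\<in>zcl V A. L' z \<noteq> 0 \<longrightarrow> lead_coeff P z \<noteq> 0 \<and>
    (\<forall>c. poly (pev z P) c = 0 \<longrightarrow> z(t := c) \<in> zcl (insert t V) A \<and> L (z(t := c)) \<noteq> 0))"
proof -
  obtain b S where b: "pfun V b" "\<not> van A b" "pfun (insert t V) S" "van A (b - S * L)"
    using eliminate_alg[OF A P t L] by blast
  have lP: "pfun V (lead_coeff P)" "\<not> van A (lead_coeff P)" using P by (auto simp: minpol_def pcoef_def)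
  show ?thesis
  proof (intro exI[of _ "b * lead_coeff P"] conjI ballI impI allI)
    show "pfun V (b * lead_coeff P)" by (rule pfun_times[OF b(1) lP(1)])
    show "\<not> van A (b * lead_coeff P)" using irrD[OF A b(1) lP(1)] b(2) lP(2) by blast
    fix z assume z: "z \<in> zcl V A" "(b * lead_coeff P) z \<noteq> 0"
    then show lz: "lead_coeff P z \<noteq> 0" by auto
    fix c assume c: "poly (pev z P) c = 0"
    show *: "z(t := c) \<in> zcl (insert t V) A" by (rule minpol_zcl[OF A P t z(1) lz c])
    have "pfun (insert t V) (b - S * L)"
      by (intro pfun_minus pfun_times b L pfun_mono[OF b(1)]) auto
    from zclD[OF * this b(4)] have "b (z(t := c)) = S (z(t := c)) * L (z(t := c))" by simp
    moreover have "b (z(t := c)) = b z" by (rule pfun_upd[OF b(1) t])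
    ultimately show "L (z(t := c)) \<noteq> 0" using z(2) by auto
  qed
qed

lemma extend_step:
  assumes A: "irr A" and t: "t \<notin> V" and L: "pfun (insert t V) L" "\<not> van A L"
  shows "\<exists>L'. pfun V L' \<and> \<not> van A L' \<and>
    (\<forall>z\<in>zcl V A. L' z \<noteq> 0 \<longrightarrow> (\<exists>c. z(t := c) \<in> zcl (insert t V) A \<and> L (z(t := c)) \<noteq> 0))"
proof (cases "alg_over A V t")
  case True
  obtain P where P: "minpol A V t P" using minpol_exists[OF True] by (elim exE)
  from extend_alg[OF A P t L] obtain L' where L': "pfun V L'" "\<not> van A L'"
    "\<And>z c. z \<in> zcl V A \<Longrightarrow> L' z \<noteq> 0 \<Longrightarrow> lead_coeff P z \<noteq> 0"
    "\<And>z c. z \<in> zcl V A \<Longrightarrow> L' z \<noteq> 0 \<Longrightarrow> poly (pev z P) c = 0 \<Longrightarrow>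
        z(t := c) \<in> zcl (insert t V) A \<and> L (z(t := c)) \<noteq> 0" by blast
  have "\<exists>c. poly (pev z P) c = 0" if "z \<in> zcl V A" "L' z \<noteq> 0" for z
  proof -
    have "coeff (pev z P) (degree P) \<noteq> 0" using L'(3)[OF that] by simp
    then have "degree P \<le> degree (pev z P)" by (rule le_degree)
    with minpol_degree[OF P] have "degree (pev z P) \<noteq> 0" by linarith
    then show ?thesis using Fundamental_Theorem_Algebra.fundamental_theorem_of_algebra[of "pev z P"] by (simp add: constant_degree)
  qed
  with L' show ?thesis by blast
next
  case False
  obtain F where F: "pcoef V F" "L = ev t F" using pfun_ev_ex[OF L(1) subset_refl] by blast
  \<comment> \<open>In the transcendental case the whole line over a point of the closure belongs to
    the closure, so one nonzero coefficient of \<open>L\<close> is enough to find a suitable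
    value.\<close>
  then obtain j where j: "\<not> van A (coeff F j)" using L(2) van_ev_coeffs[of A F t] by auto
  show ?thesis
  proof (intro exI[of _ "coeff F j"] conjI ballI impI)
    show "pfun V (coeff F j)" using F by (auto simp: pcoef_def)
    show "\<not> van A (coeff F j)" by fact
    fix z assume z: "z \<in> zcl V A" "coeff F j z \<noteq> 0"
    then have "pev z F \<noteq> 0" by (metis coeff_0 coeff_pev)
    then obtain c where c: "poly (pev z F) c \<noteq> 0" using poly_all_0_iff_0 by blast
    have "z(t := c) \<in> zcl (insert t V) A"
    proof (rule zclI)
      fix g assume g: "pfun (insert t V) g" "van A g"
      obtain G where G: "pcoef V G" "g = ev t G" using pfun_ev_ex[OF g(1) subset_refl] by blast
      with g have "van A (coeff G i)" for i using not_van_ev[OF False G(1)] by blast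
      then have "coeff G i z = 0" for i using zclD[OF z(1), of "coeff G i"] G(1) by (auto simp: pcoef_def)
      then show "g (z(t := c)) = 0" using ev_upd[OF G(1) t] G(2) by (simp add: poly_altdef)
    qed
    moreover have "L (z(t := c)) \<noteq> 0" using c ev_upd[OF F(1) t] F(2) by simp
    ultimately show "\<exists>c. z(t := c) \<in> zcl (insert t V) A \<and> L (z(t := c)) \<noteq> 0" by blast
  qed
qed

text \<open>The irreducible case of Chevalley's theorem, one variable at a time. Carrying the
  inequation \<open>L\<close> along makes the induction work, and later keeps lifted points inside
  locally closed sets.\<close>

lemma extend:
  assumes A: "irr A" and "finite T" "T \<inter> V = {}" "pfun (V \<union> T) L" "\<not> van A L"
  shows "\<exists>L'. pfun V L' \<and> \<not> van A L' \<and>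
    (\<forall>z\<in>zcl V A. L' z \<noteq> 0 \<longrightarrow> (\<exists>z'. (\<forall>i. i \<notin> T \<longrightarrow> z' i = z i) \<and> z' \<in> zcl (V \<union> T) A \<and> L z' \<noteq> 0))"
  using assms(2-)
proof (induction T arbitrary: L)
  case empty
  then show ?case by (intro exI[of _ L]) auto
next
  case (insert t T)
  have "pfun (insert t (V \<union> T)) L" "t \<notin> V \<union> T" using insert.prems insert.hyps by auto
  from extend_step[OF A this(2) this(1) insert.prems(3)] obtain L1 where L1: "pfun (V \<union> T) L1" "\<not> van A L1"
    "\<And>z. z \<in> zcl (V \<union> T) A \<Longrightarrow> L1 z \<noteq> 0 \<Longrightarrow> \<exists>c. z(t := c) \<in> zcl (insert t (V \<union> T)) A \<and> L (z(t := c)) \<noteq> 0"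
    by blast
  from insert.IH[OF _ L1(1,2)] insert.prems obtain L' where L': "pfun V L'" "\<not> van A L'"
    "\<And>z. z \<in> zcl V A \<Longrightarrow> L' z \<noteq> 0 \<Longrightarrow> \<exists>z'. (\<forall>i. i \<notin> T \<longrightarrow> z' i = z i) \<and> z' \<in> zcl (V \<union> T) A \<and> L1 z' \<noteq> 0"
    by blast
  show ?case
  proof (intro exI[of _ L'] conjI ballI impI)
    fix z assume z: "z \<in> zcl V A" "L' z \<noteq> 0"
    from L'(3)[OF this] obtain z' where z': "\<forall>i. i \<notin> T \<longrightarrow> z' i = z i" "z' \<in> zcl (V \<union> T) A" "L1 z' \<noteq> 0" by blast
    from L1(3)[OF z'(2,3)] obtain c where "z'(t := c) \<in> zcl (insert t (V \<union> T)) A" "L (z'(t := c)) \<noteq> 0" by blast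
    then show "\<exists>z'. (\<forall>i. i \<notin> insert t T \<longrightarrow> z' i = z i) \<and> z' \<in> zcl (V \<union> insert t T) A \<and> L z' \<noteq> 0"
      using z'(1) by (intro exI[of _ "z'(t := c)"]) auto
  qed (use L' in auto)
qed

lemma alg_over_mono: "alg_over A V t \<Longrightarrow> V \<subseteq> W \<Longrightarrow> alg_over A W t"
  unfolding alg_over_def by (blast intro: pcoef_mono)

text \<open>A substitute for the norm: when the variables \<open>T\<close> are algebraic over
  \<open>V\<close>, some multiple of \<open>L\<close> is, modulo the ideal, a nonzero polynomial in
  \<open>V\<close> alone.\<close>

lemma eliminate:
  assumes A: "irr A" and "finite T" "T \<inter> V = {}" "\<And>t. t \<in> T \<Longrightarrow> alg_over A V t" "pfun (V \<union> T) L" "\<not> van A L"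
  shows "\<exists>b S. pfun V b \<and> \<not> van A b \<and> van A (b - S * L)"
  using assms(2-)
proof (induction T arbitrary: L)
  case empty
  then show ?case by (intro exI[of _ L] exI[of _ 1]) (auto simp: van_def)
next
  case (insert t T)
  have *: "pfun (insert t (V \<union> T)) L" "t \<notin> V \<union> T" using insert.prems insert.hyps by auto
  have "alg_over A (V \<union> T) t" using insert.prems(2) by (auto intro: alg_over_mono)
  from minpol_exists[OF this] obtain P where P: "minpol A (V \<union> T) t P" by (elim exE)
  obtain b S where b: "pfun (V \<union> T) b" "\<not> van A b" "van A (b - S * L)"
    using eliminate_alg[OF A P *(2,1) insert.prems(4)] by blast
  obtain b' S' where b': "pfun V b'" "\<not> van A b'" "van A (b' - S' * b)"
    using insert.IH[OF _ _ b(1,2)] insert.prems by blast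
  have "van A (b' - S' * S * L)" using b(3) b'(3) by (auto simp: van_def)
  with b' show ?case by blast
qed

section \<open>Hilbert's basis theorem and irreducible decomposition\<close>

inductive idl :: "'v set \<Rightarrow> (('v \<Rightarrow> complex) \<Rightarrow> complex) set \<Rightarrow> (('v \<Rightarrow> complex) \<Rightarrow> complex) \<Rightarrow> bool"
  for V G where
  idl_0: "idl V G 0"
| idl_step: "pfun V a \<Longrightarrow> g \<in> G \<Longrightarrow> idl V G h \<Longrightarrow> idl V G (a * g + h)"

lemma idl_base: "g \<in> G \<Longrightarrow> idl V G g"
  using idl_step[OF pfun_1(1) _ idl_0, of g G V] by simp

lemma idl_add: "idl V G f \<Longrightarrow> idl V G h \<Longrightarrow> idl V G (f + h)"
proof (induction rule: idl.induct)
  case (idl_step a g f)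
  then show ?case using idl.idl_step[of V a g G "f + h"] by (simp add: func_plus func_times add.assoc)
qed simp

lemma idl_mult: "idl (V :: 'v set) G f \<Longrightarrow> pfun V a \<Longrightarrow> idl V G (a * f)"
proof (induction rule: idl.induct)
  case (idl_step b g f)
  then show ?case using idl.idl_step[of V "a * b" g G "a * f"] pfun_times[of V a b]
    by (simp add: func_plus func_times distrib_left mult.assoc)
next
  case idl_0
  have "a * (0 :: ('v \<Rightarrow> complex) \<Rightarrow> complex) = 0" by simp
  then show ?case using idl.idl_0[of V G] unfolding func_zero by simp
qed

lemma idl_diff: "idl V G f \<Longrightarrow> idl V G h \<Longrightarrow> idl V G (f - h)"
  using idl_add[of V G f "-1 * h"] idl_mult[of V G h "-1"] pfun_uminus[OF pfun_1(1), of V] by simp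

lemma idl_trans: "idl V G f \<Longrightarrow> (\<And>g. g \<in> G \<Longrightarrow> idl V H g) \<Longrightarrow> idl V H f"
  by (induction rule: idl.induct) (auto intro: idl_0 idl_add idl_mult)

lemma idl_mono: "idl V G f \<Longrightarrow> G \<subseteq> H \<Longrightarrow> idl V H f"
  by (erule idl_trans) (auto intro: idl_base)

lemma idl_finite: "idl V G f \<Longrightarrow> \<exists>H. finite H \<and> H \<subseteq> G \<and> idl V H f"
proof (induction rule: idl.induct)
  case idl_0
  show ?case using idl.idl_0[of V "{}"] by (intro exI[of _ "{}"]) (simp add: func_zero)
next
  case (idl_step a g f)
  then obtain H where "finite H" "H \<subseteq> G" "idl V H f" by blast
  moreover from this have "idl V (insert g H) (a * g + f)"
    using idl_step.hyps by (intro idl.idl_step) (auto intro: idl_mono)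
  ultimately have "finite (insert g H) \<and> insert g H \<subseteq> G \<and> idl V (insert g H) (a * g + f)"
    using idl_step.hyps by auto
  then show ?case unfolding func_plus func_times by blast
qed

lemma idl_van: "idl V G f \<Longrightarrow> (\<And>g. g \<in> G \<Longrightarrow> van A g) \<Longrightarrow> van A f"
  by (induction rule: idl.induct) (auto simp: van_def)

definition noeth :: "'v set \<Rightarrow> bool" where
  "noeth V \<longleftrightarrow> (\<forall>G. (\<forall>g\<in>G. pfun V g) \<longrightarrow> (\<exists>H. finite H \<and> H \<subseteq> G \<and> (\<forall>g\<in>G. idl V H g)))"

text \<open>Forming combinations commutes with taking the coefficient of degree \<open>n\<close>, so
  a representation of a leading coefficient lifts to a representation of a polynomial having that
  leading coefficient.\<close>

lemma idl_lift_coeff: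
  assumes "idl V B a"
    and "\<And>b. b \<in> B \<Longrightarrow> \<exists>Q. pcoef V Q \<and> idl (insert t V) H (ev t Q) \<and> (\<forall>i>n. coeff Q i = 0) \<and> coeff Q n = b"
  shows "\<exists>Q. pcoef V Q \<and> idl (insert t V) H (ev t Q) \<and> (\<forall>i>n. coeff Q i = 0) \<and> coeff Q n = a"
  using assms(1)
proof (induction rule: idl.induct)
  case idl_0
  have "idl (insert t V) H (ev t 0)" by (simp add: idl.idl_0)
  then show ?case by (intro exI[of _ 0]) (auto simp: zero_fun_def)
next
  case (idl_step a g h)
  from idl_step.IH obtain Q where Q: "pcoef V Q" "idl (insert t V) H (ev t Q)" "\<forall>i>n. coeff Q i = 0" "coeff Q n = h"
    by blast
  from assms(2)[OF idl_step.hyps(2)] obtain R where R: "pcoef V R" "idl (insert t V) H (ev t R)" "\<forall>i>n. coeff R i = 0" "coeff R n = g"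
    by blast
  have "pfun (insert t V) a" using idl_step.hyps(1) by (auto intro: pfun_mono)
  then have "idl (insert t V) H (a * ev t R + ev t Q)" using Q R by (intro idl_add idl_mult)
  moreover have "pcoef V (smult a R + Q)" using Q R idl_step by (intro pcoef_add pcoef_smult)
  ultimately have "pcoef V (smult a R + Q) \<and> idl (insert t V) H (ev t (smult a R + Q)) \<and>
      (\<forall>i>n. coeff (smult a R + Q) i = 0) \<and> coeff (smult a R + Q) n = a * g + h"
    using Q R by simp
  then show ?case unfolding func_plus func_times by blast
qed

text \<open>Hilbert's argument: \<open>Lc n\<close> collects the leading coefficients in degree
  \<open>n\<close>. Generators \<open>C\<close> of the union of all \<open>Lc n\<close> occur in
  degrees at most \<open>D\<close>; they serve every degree above \<open>D\<close>, while separate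
  finite families \<open>B n\<close> serve the degrees up to \<open>D\<close>.\<close>

lemma noeth_insert:
  assumes V: "noeth V" and t: "t \<notin> V"
  shows "noeth (insert t V)"
  unfolding noeth_def
proof (intro allI impI)
  fix G assume G: "\<forall>g\<in>G. pfun (insert t V) g"
  define W where "W = insert t V"
  define J where "J = {P. pcoef V P \<and> idl W G (ev t P)}"
  define Lc where "Lc n = {coeff P n | P. P \<in> J \<and> (\<forall>i>n. coeff P i = 0)}" for n
  have pLc: "\<forall>g\<in>Lc n. pfun V g" for n by (auto simp: Lc_def J_def pcoef_def)
  then have "\<forall>n. \<exists>B. finite B \<and> B \<subseteq> Lc n \<and> (\<forall>g\<in>Lc n. idl V B g)" using V unfolding noeth_def by simp
  from choice[OF this] obtain B where "\<forall>n. finite (B n) \<and> B n \<subseteq> Lc n \<and> (\<forall>g\<in>Lc n. idl V (B n) g)" by (elim exE)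
  then have B: "\<And>n. finite (B n)" "\<And>n. B n \<subseteq> Lc n" "\<And>n g. g \<in> Lc n \<Longrightarrow> idl V (B n) g" by auto
  have "\<forall>g\<in>(\<Union>n. Lc n). pfun V g" using pLc by blast
  with V obtain C where C': "finite C" "C \<subseteq> (\<Union>n. Lc n)" "\<forall>g\<in>(\<Union>n. Lc n). idl V C g"
    unfolding noeth_def by meson
  have C: "finite C" "C \<subseteq> (\<Union>n. Lc n)" "\<And>g n. g \<in> Lc n \<Longrightarrow> idl V C g" using C' by auto
  have "\<forall>b\<in>C. \<exists>n P. P \<in> J \<and> (\<forall>i>n. coeff P i = 0) \<and> coeff P n = b"
    using C(2) unfolding Lc_def by blast
  from bchoice[OF this] obtain N where "\<forall>b\<in>C. \<exists>P. P \<in> J \<and> (\<forall>i>N b. coeff P i = 0) \<and> coeff P (N b) = b" by (elim exE)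
  from bchoice[OF this] obtain PC where PC: "\<forall>b\<in>C. PC b \<in> J \<and> (\<forall>i>N b. coeff (PC b) i = 0) \<and> coeff (PC b) (N b) = b" by (elim exE)
  have "\<forall>n. \<forall>b\<in>B n. \<exists>P. P \<in> J \<and> (\<forall>i>n. coeff P i = 0) \<and> coeff P n = b"
    using B(2) unfolding Lc_def by blast
  then have "\<forall>n. \<exists>P. \<forall>b\<in>B n. P b \<in> J \<and> (\<forall>i>n. coeff (P b) i = 0) \<and> coeff (P b) n = b"
    by (intro allI bchoice) blast
  from choice[OF this] obtain PB where
    PB: "\<forall>n. \<forall>b\<in>B n. PB n b \<in> J \<and> (\<forall>i>n. coeff (PB n b) i = 0) \<and> coeff (PB n b) n = b" by (elim exE)
  define D where "D = Max (insert 0 (N ` C))"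
  have D: "N b \<le> D" if "b \<in> C" for b using that C(1) by (auto simp: D_def)
  define H where "H = (\<lambda>b. ev t (PC b)) ` C \<union> (\<Union>n\<le>D. (\<lambda>b. ev t (PB n b)) ` B n)"
  have finH: "finite H" using B(1) C(1) by (auto simp: H_def)
  have HJ: "idl W G h" if "h \<in> H" for h using that PB PC by (auto simp: H_def J_def)
  define low where "low n P \<longleftrightarrow> (\<forall>i\<ge>n. coeff P i = 0)" for n and P :: "(('a \<Rightarrow> complex) \<Rightarrow> complex) poly"
  have main: "idl W H (ev t P)" if "P \<in> J" "low n P" for n P
    using that
  proof (induction n arbitrary: P)
    case 0
    then have "P = 0" by (intro poly_eqI) (simp add: low_def)
    then show "idl W H (ev t P)" by (simp add: idl_0)
  next
    case (Suc n)
    have a: "coeff P n \<in> Lc n" using Suc.prems by (auto simp: Lc_def low_def)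
    have "\<exists>Q. pcoef V Q \<and> idl (insert t V) H (ev t Q) \<and> (\<forall>i>n. coeff Q i = 0) \<and> coeff Q n = coeff P n"
    proof (cases "n \<le> D")
      case True
      show ?thesis
      proof (rule idl_lift_coeff[OF B(3)[OF a]])
        fix b assume b: "b \<in> B n"
        then have "ev t (PB n b) \<in> H" using True by (auto simp: H_def)
        then show "\<exists>Q. pcoef V Q \<and> idl (insert t V) H (ev t Q) \<and> (\<forall>i>n. coeff Q i = 0) \<and> coeff Q n = b"
          using bspec[OF spec[OF PB] b] by (intro exI[of _ "PB n b"]) (auto simp: J_def intro: idl_base)
      qed
    next
      case False
      show ?thesis
      proof (rule idl_lift_coeff[OF C(3)[OF a]])
        fix b assume b: "b \<in> C"
        then have h: "ev t (PC b) \<in> H" by (auto simp: H_def)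
        have le: "N b \<le> n" using D[OF b] False by simp
        \<comment> \<open>Multiplying by a power of the variable moves the leading coefficient
          \<open>b\<close> from degree \<open>N b\<close> to degree \<open>n\<close>.\<close>
        define Q where "Q = monom 1 (n - N b) * PC b"
        have PCb: "pcoef V (PC b)" "\<And>i. i > N b \<Longrightarrow> coeff (PC b) i = 0" "coeff (PC b) (N b) = b"
          using bspec[OF PC b] by (auto simp: J_def)
        have m: "pcoef V (monom 1 (n - N b))" by (rule pcoef_monom) auto
        have "pcoef V Q" unfolding Q_def by (intro pcoef_mult m PCb)
        moreover have "idl (insert t V) H (ev t Q)" unfolding Q_def ev_mult
          by (intro idl_mult idl_base h pfun_ev m)
        moreover have "\<forall>i>n. coeff Q i = 0"
        proof (intro allI impI)
          fix i assume "i > n"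
          then have "i - (n - N b) > N b" using le by linarith
          with PCb(2) show "coeff Q i = 0" by (simp only: Q_def coeff_monom_mult) simp
        qed
        moreover have "coeff Q n = b" using PCb(3) le by (simp add: Q_def coeff_monom_mult)
        ultimately show "\<exists>Q. pcoef V Q \<and> idl (insert t V) H (ev t Q) \<and> (\<forall>i>n. coeff Q i = 0) \<and> coeff Q n = b"
          by blast
      qed
    qed
    then obtain Q where Q: "pcoef V Q" "idl W H (ev t Q)" "\<forall>i>n. coeff Q i = 0" "coeff Q n = coeff P n"
      unfolding W_def by blast
    have "idl W G (ev t Q)" using Q(2) HJ by (rule idl_trans)
    have eq: "ev t P = ev t (P - Q) + ev t Q" by (simp flip: ev_add)
    have "idl W G (ev t P - ev t Q)" using Suc.prems \<open>idl W G (ev t Q)\<close> by (intro idl_diff) (auto simp: J_def)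
    with eq have "idl W G (ev t (P - Q))" by simp
    then have "P - Q \<in> J" using Suc.prems Q by (auto simp: J_def intro: pcoef_diff)
    moreover have "low n (P - Q)" unfolding low_def
    proof (intro allI impI)
      fix i assume "i \<ge> n"
      then show "coeff (P - Q) i = 0" using Q(3,4) Suc.prems(2) by (cases "i = n") (auto simp: low_def)
    qed
    ultimately have "idl W H (ev t (P - Q))" by (rule Suc.IH)
    then show ?case unfolding eq using Q(2) by (rule idl_add)
  qed
  have GH: "idl W H g" if "g \<in> G" for g
  proof -
    have "pfun (insert t V) g" using G that by blast
    from pfun_ev_ex[OF this subset_refl] obtain P where P: "pcoef V P" "g = ev t P" by (elim exE conjE)
    then have "P \<in> J" using that by (auto simp: J_def intro: idl_base)
    from main[OF this, of "Suc (degree P)"] P show ?thesis by (simp add: coeff_eq_0 low_def)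
  qed
  have "\<forall>h\<in>H. \<exists>K. finite K \<and> K \<subseteq> G \<and> idl W K h" using HJ idl_finite by blast
  then obtain K where K: "\<And>h. h \<in> H \<Longrightarrow> finite (K h)" "\<And>h. h \<in> H \<Longrightarrow> K h \<subseteq> G" "\<And>h. h \<in> H \<Longrightarrow> idl W (K h) h" by metis
  show "\<exists>H. finite H \<and> H \<subseteq> G \<and> (\<forall>g\<in>G. idl (insert t V) H g)"
  proof (intro exI[of _ "\<Union>(K ` H)"] conjI ballI)
    show "finite (\<Union>(K ` H))" using finH K by auto
    show "\<Union>(K ` H) \<subseteq> G" using K by auto
    fix g assume "g \<in> G"
    then have "idl W H g" by (rule GH)
    then show "idl (insert t V) (\<Union>(K ` H)) g" unfolding W_def[symmetric]
    proof (rule idl_trans)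
      fix h assume "h \<in> H"
      then show "idl W (\<Union>(K ` H)) h" using K(3) by (auto intro: idl_mono[of W "K h"])
    qed
  qed
qed

lemma pfun_empty: "pfun {} f \<Longrightarrow> \<exists>c. f = (\<lambda>x. c)"
  by (induction rule: pfun.induct) auto

lemma noeth_empty: "noeth {}"
  unfolding noeth_def
proof (intro allI impI)
  fix G :: "(('a \<Rightarrow> complex) \<Rightarrow> complex) set" assume G: "\<forall>g\<in>G. pfun {} g"
  show "\<exists>H. finite H \<and> H \<subseteq> G \<and> (\<forall>g\<in>G. idl {} H g)"
  proof (cases "\<exists>g\<in>G. g \<noteq> 0")
    case True
    then obtain g where g: "g \<in> G" "g \<noteq> 0" by blast
    have "pfun {} g" using G g by blast
    from pfun_empty[OF this] obtain c where c: "g = (\<lambda>x. c)" by (elim exE)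
    then have c0: "c \<noteq> 0" using g by (auto simp: zero_fun_def)
    have "idl {} {g} h" if "h \<in> G" for h
    proof -
      have "pfun {} h" using G that by blast
      from pfun_empty[OF this] obtain d where d: "h = (\<lambda>x. d)" by (elim exE)
      have "h = (\<lambda>x. d / c) * g" using d c c0 by (intro ext) simp
      moreover have "idl {} {g} ((\<lambda>x. d / c) * g)" by (intro idl_mult idl_base pfun_const) simp
      ultimately show ?thesis by simp
    qed
    then show ?thesis using g by (intro exI[of _ "{g}"]) auto
  next
    case False
    then show ?thesis by (intro exI[of _ "{}"]) (auto intro: idl_0)
  qed
qed

lemma noeth_finite: "finite V \<Longrightarrow> noeth V"
  by (induction rule: finite_induct) (auto intro: noeth_empty noeth_insert)

text \<open>The polynomials vanishing on some member of a descending chain form a finitely generated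
  ideal; the generators all vanish from one index on, where the chain of closures has to
  stop.\<close>

lemma wf_zcl: "wf {(S', S :: ('v::finite \<Rightarrow> complex) set). zcl UNIV S' \<subset> zcl UNIV S}"
proof (rule ccontr)
  assume "\<not> ?thesis"
  then obtain S where S: "\<And>i. zcl UNIV (S (Suc i)) \<subset> zcl UNIV (S i :: ('v \<Rightarrow> complex) set)"
    unfolding wf_iff_no_infinite_down_chain by auto
  have mono: "zcl UNIV (S j) \<subseteq> zcl UNIV (S i)" if "i \<le> j" for i j
    using that
  proof (induction j rule: dec_induct)
    case (step n)
    then show ?case using S[of n] by blast
  qed simp
  define G where "G = {f. pfun UNIV f \<and> (\<exists>i. van (S i) f)}"
  have G: "\<forall>g\<in>G. pfun UNIV g" by (auto simp: G_def)
  from noeth_finite[OF finite, unfolded noeth_def, THEN spec, THEN mp, OF G]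
  obtain H where H': "finite H" "H \<subseteq> G" "\<forall>g\<in>G. idl UNIV H g" by (elim exE conjE)
  have H: "finite H" "H \<subseteq> G" "\<And>g. g \<in> G \<Longrightarrow> idl UNIV H g" using H' by auto
  have "\<forall>h\<in>H. \<exists>i. pfun UNIV h \<and> van (S i) h" using H(2) by (auto simp: G_def)
  then obtain n where n: "\<And>h. h \<in> H \<Longrightarrow> pfun UNIV h \<and> van (S (n h)) h" by metis
  define N where "N = Max (insert 0 (n ` H))"
  have vH: "van (S N) h" if "h \<in> H" for h
  proof -
    have "n h \<le> N" using that H(1) by (auto simp: N_def)
    have "van (zcl UNIV (S (n h))) h" using n[OF that] by (simp add: van_zcl)
    then have "van (zcl UNIV (S N)) h" using mono[OF \<open>n h \<le> N\<close>] by (auto simp: van_def)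
    then show ?thesis using n[OF that] by (simp add: van_zcl)
  qed
  have "zcl UNIV (S N) \<subseteq> zcl UNIV (S (Suc N))"
  proof (intro subsetI zclI)
    fix z f assume z: "z \<in> zcl UNIV (S N)" and f: "pfun UNIV f" "van (S (Suc N)) f"
    then have "f \<in> G" by (auto simp: G_def)
    have "van (S N) f" by (rule idl_van[OF H(3)[OF \<open>f \<in> G\<close>] vH])
    with z f show "f z = 0" by (auto intro: zclD)
  qed
  with S[of N] show False by blast
qed

text \<open>Noetherian induction on the closure: if a product vanishes on \<open>S\<close> but
  neither factor does, the zeros of the factors split \<open>S\<close> into two pieces with smaller
  closures. \<open>S\<close> is arbitrary, which allows locally closed sets and tangent
  bundles.\<close>

theorem irr_decomposition:
  fixes S :: "('v::finite \<Rightarrow> complex) set"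
  shows "\<exists>\<A>. finite \<A> \<and> S = \<Union>\<A> \<and> (\<forall>A\<in>\<A>. irr A)"
  using wf_zcl
proof (induction S rule: wf_induct_rule)
  case (less S)
  show ?case
  proof (cases "S = {} \<or> irr S")
    case True
    then show ?thesis
    proof
      assume "S = {}" then show ?thesis by (intro exI[of _ "{}"]) auto
    next
      assume "irr S" then show ?thesis by (intro exI[of _ "{S}"]) auto
    qed
  next
    case False
    then obtain f g where fg: "pfun UNIV f" "pfun UNIV g" "van S (\<lambda>x. f x * g x)" "\<not> van S f" "\<not> van S g"
      unfolding irr_def by blast
    define F where "F h = {x\<in>S. h x = 0}" for h :: "('v \<Rightarrow> complex) \<Rightarrow> complex"
    have sub: "zcl UNIV (F h) \<subset> zcl UNIV S" if h: "pfun UNIV h" "\<not> van S h" for h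
    proof
      show "zcl UNIV (F h) \<subseteq> zcl UNIV S" by (rule zcl_mono) (auto simp: F_def)
      obtain x where x: "x \<in> S" "h x \<noteq> 0" using h by (auto simp: van_def)
      have "van (F h) h" by (auto simp: F_def van_def)
      then have "x \<notin> zcl UNIV (F h)" using h(1) x by (auto dest: zclD)
      then show "zcl UNIV (F h) \<noteq> zcl UNIV S" using x subset_zcl[of S UNIV] by blast
    qed
    obtain A B where "finite A" "F f = \<Union>A" "\<forall>X\<in>A. irr X" "finite B" "F g = \<Union>B" "\<forall>X\<in>B. irr X"
      using less[of "F f"] less[of "F g"] sub[OF fg(1,4)] sub[OF fg(2,5)] by auto
    moreover have "S = F f \<union> F g" using fg(3) by (auto simp: F_def van_def)
    ultimately show ?thesis by (intro exI[of _ "A \<union> B"]) auto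
  qed
qed

section \<open>Locally bounded rational functions\<close>

lemma pfun_bounded:
  assumes "pfun V f"
  shows "\<exists>M\<ge>0. \<forall>x. (\<forall>i\<in>V. cmod (x i) \<le> R) \<longrightarrow> cmod (f x) \<le> M"
  using assms
proof (induction rule: pfun.induct)
  case (pfun_const c)
  show ?case by (intro exI[of _ "cmod c"]) simp
next
  case (pfun_var i)
  then show ?case by (intro exI[of _ "max R 0"]) auto
next
  case (pfun_add f g)
  then obtain M N where *: "M \<ge> 0" "\<forall>x. (\<forall>i\<in>V. cmod (x i) \<le> R) \<longrightarrow> cmod (f x) \<le> M"
    "N \<ge> 0" "\<forall>x. (\<forall>i\<in>V. cmod (x i) \<le> R) \<longrightarrow> cmod (g x) \<le> N" by auto
  have "cmod (f x + g x) \<le> M + N" if "\<forall>i\<in>V. cmod (x i) \<le> R" for x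
    using * that by (intro order_trans[OF norm_triangle_ineq] add_mono) auto
  with * show ?case by (intro exI[of _ "M + N"]) auto
next
  case (pfun_mult f g)
  then obtain M N where *: "M \<ge> 0" "\<forall>x. (\<forall>i\<in>V. cmod (x i) \<le> R) \<longrightarrow> cmod (f x) \<le> M"
    "N \<ge> 0" "\<forall>x. (\<forall>i\<in>V. cmod (x i) \<le> R) \<longrightarrow> cmod (g x) \<le> N" by auto
  have "cmod (f x * g x) \<le> M * N" if "\<forall>i\<in>V. cmod (x i) \<le> R" for x
    unfolding norm_mult using * that by (intro mult_mono) auto
  with * show ?case by (intro exI[of _ "M * N"]) auto
qed

lemma pfun_tendsto:
  assumes "pfun V f" "\<And>i. i \<in> V \<Longrightarrow> ((\<lambda>n. X n i) \<longlongrightarrow> x i) F"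
  shows "((\<lambda>n. f (X n)) \<longlongrightarrow> f x) F"
  using assms by (induction rule: pfun.induct) (auto intro: tendsto_intros)

lemma zcl_tendsto:
  assumes "\<And>n. X n \<in> zcl V A" "\<And>i. i \<in> V \<Longrightarrow> (\<lambda>n. X n i) \<longlonglongrightarrow> x i"
  shows "x \<in> zcl V A"
proof (rule zclI)
  fix f assume f: "pfun V f" "van A f"
  have "(\<lambda>n. f (X n)) \<longlonglongrightarrow> f x" by (rule pfun_tendsto[OF f(1) assms(2)])
  moreover have "f (X n) = 0" for n using zclD[OF assms(1) f] .
  ultimately show "f x = 0" by (simp add: LIMSEQ_const_iff)
qed

lemma fun_convergent_subseq:
  fixes X :: "nat \<Rightarrow> 'v::finite \<Rightarrow> complex"
  assumes "\<And>n v. cmod (X n v) \<le> M"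
  shows "\<exists>x s. strict_mono s \<and> (\<forall>v. (\<lambda>n. X (s n) v) \<longlonglongrightarrow> x v)"
proof -
  define Y where "Y n = (\<chi> v. X n v)" for n
  have "norm (Y n) \<le> (\<Sum>v\<in>(UNIV :: 'v set). M)" for n
  proof -
    have "norm (Y n) \<le> (\<Sum>v\<in>UNIV. norm (Y n $ v))" unfolding norm_vec_def by (rule L2_set_le_sum) simp
    also have "\<dots> \<le> (\<Sum>v\<in>(UNIV :: 'v set). M)" using assms by (intro sum_mono) (simp add: Y_def)
    finally show ?thesis .
  qed
  then have "bounded (range Y)" by (auto simp: bounded_iff)
  then obtain l s where "strict_mono s" "(Y \<circ> s) \<longlonglongrightarrow> l"
    using bounded_imp_convergent_subsequence by blast
  then have "strict_mono s \<and> (\<forall>v. (\<lambda>n. X (s n) v) \<longlonglongrightarrow> l $ v)"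
    using tendsto_vec_nth[of "Y \<circ> s" l] by (simp add: Y_def o_def)
  then show ?thesis by blast
qed

text \<open>Vieta's formulas in the form of an estimate: roots are split off one at a time, and a
  factor \<open>X - c\<close> changes the constant \<open>K\<close> at most to
  \<open>K + M * K\<close>.\<close>

lemma coeff_le_of_roots:
  assumes "M \<ge> 0"
  shows "\<exists>K\<ge>0. \<forall>q :: complex poly. degree q = n \<longrightarrow> (\<forall>c. poly q c = 0 \<longrightarrow> cmod c \<le> M) \<longrightarrow>
            (\<forall>i. cmod (coeff q i) \<le> K * cmod (lead_coeff q))"
proof (induction n)
  case 0
  have "cmod (coeff q i) \<le> 1 * cmod (lead_coeff q)" if "degree q = 0" for q :: "complex poly" and i
    using that by (cases i) (auto simp: coeff_eq_0)
  then show ?case by (intro exI[of _ 1]) auto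
next
  case (Suc n)
  then obtain K where K: "K \<ge> 0" "\<And>q i. degree q = n \<Longrightarrow> (\<forall>c. poly q c = 0 \<longrightarrow> cmod c \<le> M) \<Longrightarrow>
      cmod (coeff q i) \<le> K * cmod (lead_coeff q)" by auto
  have "cmod (coeff q i) \<le> (K + M * K) * cmod (lead_coeff q)"
    if q: "degree q = Suc n" "\<forall>c. poly q c = 0 \<longrightarrow> cmod c \<le> M" for q :: "complex poly" and i
  proof -
    have "\<not> constant (poly q)" using q by (simp add: constant_degree)
    then obtain c where c: "poly q c = 0" using Fundamental_Theorem_Algebra.fundamental_theorem_of_algebra by blast
    then obtain r where r: "q = [:-c, 1:] * r" by (auto simp: poly_eq_0_iff_dvd dvd_def)
    then have r0: "r \<noteq> 0" using q by auto
    have "degree q = degree [:-c, 1:] + degree r" unfolding r by (rule degree_mult_eq) (use r0 in auto)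
    then have "degree r = n" using q by simp
    have lc: "lead_coeff q = lead_coeff r" unfolding r lead_coeff_mult by simp
    have bd: "cmod (coeff r j) \<le> K * cmod (lead_coeff q)" for j
      unfolding lc using q(2) r by (intro K(2) \<open>degree r = n\<close>) auto
    have "coeff q i = (if i = 0 then 0 else coeff r (i - 1)) - c * coeff r i"
      unfolding r by (cases i) (auto simp: coeff_pCons)
    then have "cmod (coeff q i) \<le> cmod (if i = 0 then 0 else coeff r (i - 1)) + cmod (c * coeff r i)"
      by (metis norm_triangle_ineq4)
    also have "\<dots> \<le> K * cmod (lead_coeff q) + M * (K * cmod (lead_coeff q))"
      unfolding norm_mult using bd c q(2) assms K(1) by (intro add_mono mult_mono) auto
    finally show ?thesis by (simp add: algebra_simps)
  qed
  then show ?case using K(1) assms by (intro exI[of _ "K + M * K"]) auto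
qed

text \<open>A crude Cauchy estimate. After the constant term is removed, dividing by the variable
  costs nothing on the unit circle, and the maximum modulus principle extends the bound to the disc;
  each step doubles it.\<close>

lemma coeff_le_of_disc:
  fixes q :: "complex poly"
  assumes "\<And>c. cmod c \<le> 1 \<Longrightarrow> cmod (poly q c) \<le> B"
  shows "cmod (coeff q i) \<le> 2 ^ i * B"
  using assms
proof (induction i arbitrary: q B)
  case 0
  from 0[of 0] show ?case by (simp add: poly_0_coeff_0)
next
  case (Suc i)
  obtain a p where q: "q = pCons a p" by (cases q)
  have a: "cmod a \<le> B" using Suc.prems[of 0] q by simp
  have circ: "cmod (poly p c) \<le> 2 * B" if "cmod c = 1" for c
  proof -
    have "poly q c = a + c * poly p c" by (simp add: q)
    then have "cmod (c * poly p c) \<le> cmod (poly q c) + cmod a"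
      by (metis add_diff_cancel_left' norm_triangle_ineq4)
    also have "\<dots> \<le> 2 * B" using Suc.prems[of c] a that by simp
    finally show ?thesis using that by (simp add: norm_mult)
  qed
  have "cmod (poly p c) \<le> 2 * B" if "cmod c \<le> 1" for c
  proof (rule maximum_modulus_frontier[of "poly p" "cball 0 1"])
    show "poly p holomorphic_on interior (cball 0 1)" by (intro holomorphic_intros)
    show "continuous_on (closure (cball 0 1)) (poly p)" by (intro continuous_intros)
  qed (use that circ in auto)
  from Suc.IH[OF this] show ?case by (simp add: q)
qed

text \<open>The nonzero set of \<open>G\<close> is dense, so the inequality extends by continuity;
  the approximating points need the slightly larger radius \<open>R + 1\<close>.\<close>

lemma bound_dense:
  assumes V: "finite V" and f: "pfun V f" "pfun V g" and G: "pfun V G" "G a \<noteq> 0"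
    and le: "\<And>x. (\<forall>i\<in>V. cmod (x i) \<le> R + 1) \<Longrightarrow> G x \<noteq> 0 \<Longrightarrow> cmod (f x) \<le> M * cmod (g x)"
    and x: "\<forall>i\<in>V. cmod (x i) \<le> R"
  shows "cmod (f x) \<le> M * cmod (g x)"
proof -
  have "\<exists>y. G y \<noteq> 0 \<and> (\<forall>i\<in>V. cmod (y i - x i) < inverse (real (Suc n)))" for n
    using pfun_dense[OF G V, of "inverse (real (Suc n))" x] by auto
  then obtain Y where Y: "\<And>n. G (Y n) \<noteq> 0" "\<And>n i. i \<in> V \<Longrightarrow> cmod (Y n i - x i) < inverse (real (Suc n))"
    by metis
  have lim: "(\<lambda>n. Y n i) \<longlonglongrightarrow> x i" if "i \<in> V" for i
  proof -
    have "(\<lambda>n. Y n i - x i) \<longlonglongrightarrow> 0"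
      using Y(2)[OF that] by (intro Lim_null_comparison[OF _ LIMSEQ_inverse_real_of_nat]) (auto intro!: always_eventually less_imp_le)
    then show ?thesis by (simp add: LIM_zero_iff)
  qed
  have "cmod (f (Y n)) \<le> M * cmod (g (Y n))" for n
  proof (rule le[OF _ Y(1)], intro ballI)
    fix i assume i: "i \<in> V"
    have "cmod (Y n i) \<le> cmod (x i) + cmod (Y n i - x i)" by (metis add.commute diff_add_cancel norm_triangle_ineq)
    also have "\<dots> \<le> R + inverse (real (Suc n))" using x i Y(2)[OF i, of n] by (intro add_mono) auto
    also have "\<dots> \<le> R + 1" by (simp add: field_simps)
    finally show "cmod (Y n i) \<le> R + 1" .
  qed
  moreover have "(\<lambda>n. cmod (f (Y n))) \<longlonglongrightarrow> cmod (f x)" "(\<lambda>n. M * cmod (g (Y n))) \<longlonglongrightarrow> M * cmod (g x)"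
    by (intro tendsto_intros pfun_tendsto[OF f(1) lim] pfun_tendsto[OF f(2) lim]; assumption)+
  ultimately show ?thesis by (intro LIMSEQ_le) auto
qed

text \<open>The bound forces every root of \<open>q\<close> to be a root of \<open>p\<close>.
  Cancelling a common linear factor keeps the bound away from the root and, by continuity, also at
  it.\<close>

lemma dvd_of_bounded_quotient:
  fixes p q :: "complex poly"
  assumes "q \<noteq> 0" "\<And>r. \<exists>M. \<forall>c. cmod c \<le> r \<longrightarrow> cmod (poly p c) \<le> M * cmod (poly q c)"
  shows "q dvd p"
  using assms
proof (induction "degree q" arbitrary: p q)
  case 0
  then obtain b where "q = [:b:]" "b \<noteq> 0" by (metis degree_eq_zeroE pCons_0_0)
  then have "p = q * smult (1 / b) p" by simp
  then show ?case by (metis dvd_triv_left)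
next
  case (Suc n)
  have "\<not> constant (poly q)" using Suc by (simp add: constant_degree)
  then obtain c where c: "poly q c = 0" using Fundamental_Theorem_Algebra.fundamental_theorem_of_algebra by blast
  then obtain q' where q': "q = [:-c, 1:] * q'" by (auto simp: poly_eq_0_iff_dvd dvd_def)
  then have q'0: "q' \<noteq> 0" using Suc by auto
  obtain M where "cmod (poly p c) \<le> M * cmod (poly q c)" using Suc.prems(2)[of "cmod c"] by auto
  with c have "poly p c = 0" by simp
  then obtain p' where p': "p = [:-c, 1:] * p'" by (auto simp: poly_eq_0_iff_dvd dvd_def)
  have "degree q = degree [:-c, 1:] + degree q'" unfolding q' by (rule degree_mult_eq) (use q'0 in auto)
  then have "n = degree q'" using Suc.hyps(2) by simp
  moreover have "\<exists>M. \<forall>z. cmod z \<le> r \<longrightarrow> cmod (poly p' z) \<le> M * cmod (poly q' z)" for r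
  proof -
    obtain M where M: "\<And>z. cmod z \<le> r + 1 \<Longrightarrow> cmod (poly p z) \<le> M * cmod (poly q z)"
      using Suc.prems(2)[of "r + 1"] by auto
    have off: "cmod (poly p' z) \<le> M * cmod (poly q' z)" if "cmod z \<le> r + 1" "z \<noteq> c" for z
    proof -
      have "cmod (z - c) * cmod (poly p' z) \<le> cmod (z - c) * (M * cmod (poly q' z))"
        using M[OF that(1)] by (simp add: p' q' norm_mult algebra_simps flip: norm_mult)
      then show ?thesis using that(2) by simp
    qed
    have "cmod (poly p' c) \<le> M * cmod (poly q' c)" if "cmod c \<le> r"
    proof -
      define Y where "Y n = c + of_real (inverse (real (Suc n)))" for n
      have Y: "Y \<longlonglongrightarrow> c" unfolding Y_def
        using tendsto_add[OF tendsto_const tendsto_of_real[OF LIMSEQ_inverse_real_of_nat], of c] by simp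
      have "cmod (Y n) \<le> r + 1" for n
      proof -
        have "cmod (Y n) \<le> cmod c + inverse (real (Suc n))"
          unfolding Y_def by (metis norm_triangle_ineq norm_of_real abs_of_nonneg inverse_nonnegative_iff_nonnegative of_nat_0_le_iff)
        also have "\<dots> \<le> r + 1" using that by (intro add_mono) (auto simp: field_simps)
        finally show ?thesis .
      qed
      moreover have "Y n \<noteq> c" for n by (auto simp: Y_def simp del: of_nat_Suc)
      ultimately have "cmod (poly p' (Y n)) \<le> M * cmod (poly q' (Y n))" for n by (intro off)
      moreover have "(\<lambda>n. cmod (poly p' (Y n))) \<longlonglongrightarrow> cmod (poly p' c)"
        "(\<lambda>n. M * cmod (poly q' (Y n))) \<longlonglongrightarrow> M * cmod (poly q' c)"
        by (intro tendsto_intros Y)+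
      ultimately show ?thesis by (intro LIMSEQ_le) auto
    qed
    then have "cmod (poly p' z) \<le> M * cmod (poly q' z)" if "cmod z \<le> r" for z
      using off[of z] that by (cases "z = c") auto
    then show ?thesis by blast
  qed
  ultimately have "q' dvd p'" using Suc.hyps(1) q'0 by blast
  then show ?case unfolding p' q' by (rule mult_dvd_mono[OF dvd_refl])
qed

text \<open>This replaces the normality of polynomial rings in the density theorem below.\<close>

lemma bounded_quotient:
  assumes "finite V" "pfun V p" "pfun V q" "q \<noteq> 0"
    "\<And>R. \<exists>M. \<forall>x. (\<forall>i\<in>V. cmod (x i) \<le> R) \<longrightarrow> cmod (p x) \<le> M * cmod (q x)"
  shows "\<exists>h. pfun V h \<and> p = h * q"
  using assms
proof (induction V arbitrary: p q)
  case empty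
  from pfun_empty[OF empty(1)] obtain a where a: "p = (\<lambda>x. a)" by (elim exE)
  from pfun_empty[OF empty(2)] obtain b where b: "q = (\<lambda>x. b)" by (elim exE)
  have "b \<noteq> 0" using empty(3) b by (auto simp: zero_fun_def)
  then have "p = (\<lambda>x. a / b) * q" using a b by (intro ext) simp
  then show ?case using pfun_const by blast
next
  case (insert t V)
  have t: "t \<notin> V" by fact
  from pfun_ev_ex[OF insert.prems(1) subset_refl] obtain P where P: "pcoef V P" "p = ev t P" by (elim exE conjE)
  from pfun_ev_ex[OF insert.prems(2) subset_refl] obtain Q where Q: "pcoef V Q" "q = ev t Q" by (elim exE conjE)
  define l where "l = lead_coeff Q"
  have "Q \<noteq> 0" using Q insert.prems(3) by auto
  then have l0: "l \<noteq> 0" by (simp add: l_def)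
  then obtain a where a: "l a \<noteq> 0" by (auto simp: fun_eq_iff)
  have l: "pfun V l" using Q by (auto simp: l_def pcoef_def)
  from pseudo_division[OF Q(1) P(1)] obtain N S R where *: "pcoef V S" "pcoef V R"
    "smult (l ^ N) P = S * Q + R" "\<forall>i\<ge>degree Q. coeff R i = 0" unfolding l_def by (elim exE conjE)
  have "coeff R i z = 0" if lz: "l z \<noteq> 0" for i z
  proof -
    have cz: "coeff (pev z Q) (degree Q) \<noteq> 0" using lz by (simp add: l_def)
    then have "degree Q \<le> degree (pev z Q)" by (rule le_degree)
    have nz: "pev z Q \<noteq> 0" using cz by (metis coeff_0)
    have "pev z Q dvd pev z P"
    proof (rule dvd_of_bounded_quotient[OF nz])
      fix r
      define r' where "r' = Max (insert r ((\<lambda>i. cmod (z i)) ` V))"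
      have r': "r \<le> r'" "\<And>i. i \<in> V \<Longrightarrow> cmod (z i) \<le> r'" using \<open>finite V\<close> by (auto simp: r'_def)
      obtain M where M: "\<And>x. (\<forall>i\<in>insert t V. cmod (x i) \<le> r') \<Longrightarrow> cmod (p x) \<le> M * cmod (q x)"
        using insert.prems(4)[of r'] by auto
      have "cmod (poly (pev z P) c) \<le> M * cmod (poly (pev z Q) c)" if "cmod c \<le> r" for c
        using M[of "z(t := c)"] that r' t ev_upd[OF P(1) t] ev_upd[OF Q(1) t] P(2) Q(2) by fastforce
      then show "\<exists>M. \<forall>c. cmod c \<le> r \<longrightarrow> cmod (poly (pev z P) c) \<le> M * cmod (poly (pev z Q) c)" by blast
    qed
    moreover have "smult ((l ^ N) z) (pev z P) = pev z S * pev z Q + pev z R"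
      using arg_cong[OF *(3), of "pev z"] by simp
    ultimately have "pev z Q dvd pev z R"
      by (metis dvd_add_times_triv_left_iff dvd_smult mult.commute)
    moreover have "pev z R = 0 \<or> degree (pev z R) < degree Q"
    proof (cases "pev z R = 0")
      case False
      then have "coeff (pev z R) (degree (pev z R)) \<noteq> 0" by (simp only: leading_coeff_neq_0 not_False_eq_True)
      then have "coeff R (degree (pev z R)) \<noteq> 0" by (metis coeff_pev zero_fun_apply)
      then show ?thesis using *(4) by (meson leI)
    qed simp
    ultimately have "pev z R = 0" using \<open>degree Q \<le> degree (pev z Q)\<close>
      using dvd_imp_degree_le by fastforce
    then show ?thesis by (metis coeff_0 coeff_pev)
  qed
  then have "van UNIV (coeff R i * l)" for i by (auto simp: van_def)
  moreover have "\<not> van UNIV l" using a by (auto simp: van_def)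
  ultimately have "van UNIV (coeff R i)" for i
    using irrD[OF irr_UNIV _ l, of V "coeff R i"] *(2) by (auto simp: pcoef_def)
  then have "coeff R i = 0" for i by (intro ext) (auto simp: van_def)
  then have "R = 0" by (intro poly_eqI) simp
  then have PS: "smult (l ^ N) P = S * Q" using *(3) by simp
  have eq: "l x ^ N * p x = ev t S x * q x" for x
    using arg_cong[OF PS, of "\<lambda>p. ev t p x"] by (simp add: P Q power_fun_apply)
  obtain b where b: "q b \<noteq> 0" using insert.prems(3) by (auto simp: fun_eq_iff)
  have fin: "finite (insert t V)" using \<open>finite V\<close> by simp
  have lN: "pfun V (l ^ N)" by (rule pfun_power[OF l])
  have lN0: "l ^ N \<noteq> 0" using a by (metis power_fun_apply power_not_zero zero_fun_apply)
  \<comment> \<open>Since \<open>l ^ N * p = ev t S * q\<close>, the quotient of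
    \<open>ev t S\<close> by \<open>l ^ N\<close> is locally bounded as well. The Cauchy estimate
    passes this to the coefficients of \<open>S\<close>, which involve only \<open>V\<close>, so the
    induction hypothesis divides them by \<open>l ^ N\<close>.\<close>
  have "\<forall>i. \<exists>h. pfun V h \<and> coeff S i = h * l ^ N"
  proof (intro allI, goal_cases)
  case (1 i)
  show ?case
  proof (rule insert.IH[OF _ lN lN0])
    show "pfun V (coeff S i)" using *(1) by (auto simp: pcoef_def)
    fix R :: real
    define R' where "R' = max R 1"
    obtain M where M: "\<And>x. (\<forall>i\<in>insert t V. cmod (x i) \<le> R' + 1) \<Longrightarrow> cmod (p x) \<le> M * cmod (q x)"
      using insert.prems(4)[of "R' + 1"] by auto
    have 1: "cmod (ev t S x) \<le> M * cmod ((l ^ N) x)" if "\<forall>i\<in>insert t V. cmod (x i) \<le> R'" for x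
    proof (rule bound_dense[OF fin pfun_ev[OF *(1)] pfun_mono[OF lN] insert.prems(2) b _ that])
      fix x assume x: "\<forall>i\<in>insert t V. cmod (x i) \<le> R' + 1" "q x \<noteq> 0"
      have "cmod (ev t S x) * cmod (q x) = cmod (l x ^ N) * cmod (p x)"
        by (simp add: eq flip: norm_mult)
      also have "\<dots> \<le> cmod (l x ^ N) * (M * cmod (q x))" using M[OF x(1)] by (rule mult_left_mono) simp
      finally show "cmod (ev t S x) \<le> M * cmod ((l ^ N) x)" using x(2) by (simp add: power_fun_apply mult.commute)
    qed auto
    have "cmod (coeff S i z) \<le> (2 ^ i * M) * cmod ((l ^ N) z)" if z: "\<forall>i\<in>V. cmod (z i) \<le> R" for z
    proof -
      have "cmod (poly (pev z S) c) \<le> M * cmod ((l ^ N) z)" if c: "cmod c \<le> 1" for c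
      proof -
        have "\<forall>i\<in>insert t V. cmod ((z(t := c)) i) \<le> R'" using z c by (auto simp: R'_def)
        from 1[OF this] show ?thesis unfolding ev_upd[OF *(1) t] pfun_upd[OF lN t] .
      qed
      from coeff_le_of_disc[OF this, of i] show ?thesis by (simp add: mult.assoc)
    qed
    then show "\<exists>M. \<forall>x. (\<forall>i\<in>V. cmod (x i) \<le> R) \<longrightarrow> cmod (coeff S i x) \<le> M * cmod ((l ^ N) x)" by blast
  qed
  qed
  from choice[OF this] obtain h where h: "\<forall>i. pfun V (h i) \<and> coeff S i = h i * l ^ N" by (elim exE)
  define H where "H = (\<Sum>i\<le>degree S. monom (h i) i)"
  have H: "pcoef V H" using h unfolding H_def pcoef_def by (auto simp: coeff_sum intro!: pfun_sum)
  have "S = smult (l ^ N) H"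
  proof (rule poly_eqI)
    fix i
    have "coeff H i = (if i \<le> degree S then h i else 0)" by (simp add: H_def coeff_sum)
    then show "coeff S i = coeff (smult (l ^ N) H) i"
      using spec[OF h, of i] coeff_eq_0[of S i] by (cases "i \<le> degree S") (auto simp: mult.commute)
  qed
  then have "smult (l ^ N) P = smult (l ^ N) (H * Q)" using PS by simp
  then have "ev t (smult (l ^ N) P) = ev t (smult (l ^ N) (H * Q))" by simp
  then have "l ^ N * p = l ^ N * (ev t H * q)" by (simp add: P Q)
  then have "van UNIV (l ^ N * (p - ev t H * q))" by (simp add: van_def right_diff_distrib flip: times_fun_apply minus_apply)
  moreover have "pfun (insert t V) (p - ev t H * q)"
    by (intro pfun_minus insert.prems pfun_times pfun_ev H)
  ultimately have "van UNIV (l ^ N) \<or> van UNIV (p - ev t H * q)" using irrD[OF irr_UNIV lN] by simp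
  then have "p - ev t H * q = 0" using lN0 by (auto simp: van_def fun_eq_iff)
  then show ?case using pfun_ev[OF H, of t] by auto
qed

section \<open>Noether normalization\<close>

text \<open>Finiteness of a map in Noether normalization, expressed analytically as properness.\<close>

definition proper_on :: "('v \<Rightarrow> complex) set \<Rightarrow> 'i set \<Rightarrow> ('i \<Rightarrow> ('v \<Rightarrow> complex) \<Rightarrow> complex) \<Rightarrow> bool" where
  "proper_on Z J g \<longleftrightarrow> (\<forall>R. \<exists>M. \<forall>y\<in>Z. (\<forall>j\<in>J. cmod (g j y) \<le> R) \<longrightarrow> (\<forall>v. cmod (y v) \<le> M))"

text \<open>The coefficient \<open>c N\<close> is the top homogeneous component of \<open>Q\<close>.\<close>

lemma pfun_rays:
  assumes Q: "pfun J Q" "Q a \<noteq> 0"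
  shows "\<exists>N c b. (\<forall>i\<le>N. pfun J (c i)) \<and> c N b \<noteq> 0 \<and> (\<forall>\<tau> w. Q (\<lambda>j. \<tau> * w j) = (\<Sum>i\<le>N. c i w * \<tau> ^ i))"
proof -
  \<comment> \<open>\<open>None\<close> carries the scaling factor; expanding in this variable
    separates the homogeneous components of \<open>Q\<close>.\<close>
  define Q' where "Q' z = Q (\<lambda>j. z None * z (Some j))" for z
  have "pfun (insert None (Some ` J)) Q'" unfolding Q'_def
    by (rule pfun_comp[OF Q(1)]) (auto intro!: pfun.intros)
  from pfun_ev_ex[OF this subset_refl] obtain P where P: "pcoef (Some ` J) P" "Q' = ev None P" by (elim exE conjE)
  define c where "c i w = coeff P i (case_option 0 w)" for i w
  have c: "pfun J (c i)" for i unfolding c_def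
    by (rule pfun_comp[of "Some ` J"]) (use P(1) in \<open>auto simp: pcoef_def intro: pfun_var\<close>)
  have "ev None P (case_option 1 a) = Q a" by (simp flip: P(2) add: Q'_def)
  then have "P \<noteq> 0" using Q(2) by auto
  then have "lead_coeff P \<noteq> 0" by simp
  then obtain z where z: "lead_coeff P z \<noteq> 0" by (auto simp: fun_eq_iff)
  have pc: "coeff P i z = c i (z \<circ> Some)" for i z
    unfolding c_def by (rule pfun_cong[of "Some ` J"]) (use P(1) in \<open>auto simp: pcoef_def\<close>)
  have "c (degree P) (z \<circ> Some) \<noteq> 0" using z pc[of "degree P" z] by simp
  moreover have "Q (\<lambda>j. \<tau> * w j) = (\<Sum>i\<le>degree P. c i w * \<tau> ^ i)" for \<tau> w
  proof -
    have "Q (\<lambda>j. \<tau> * w j) = ev None P (case_option \<tau> w)" by (simp flip: P(2) add: Q'_def)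
    also have "\<dots> = (\<Sum>i\<le>degree P. c i w * \<tau> ^ i)" by (simp add: ev_altdef pc o_def)
    finally show ?thesis .
  qed
  ultimately show ?thesis using c by blast
qed

text \<open>Noether's linear change of coordinates, projecting along a direction \<open>e\<close>
  where the top form of the relation is nonzero. If the projected coordinates stayed bounded while
  \<open>g j0\<close> escaped, the rescaled points would tend to \<open>e\<close>, and the relation
  would force its top form to vanish there.\<close>

lemma proper_reduce:
  assumes J: "finite J" and g: "\<And>j. pfun UNIV (g j)" and pr: "proper_on Z J g"
    and Q: "pfun J Q" "Q a \<noteq> 0" "\<And>y. y \<in> Z \<Longrightarrow> Q (\<lambda>j. g j y) = 0" and Z: "Z \<noteq> {}"
  shows "\<exists>j\<in>J. \<exists>g'. (\<forall>i. pfun UNIV (g' i)) \<and> proper_on Z (J - {j}) g'"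
proof -
  have "J \<noteq> {}"
  proof
    assume "J = {}"
    with Q(1) have "pfun {} Q" by simp
    from pfun_empty[OF this] obtain d where "Q = (\<lambda>x. d)" by (elim exE)
    with Q(2,3) Z show False by auto
  qed
  then obtain j0 where j0: "j0 \<in> J" by blast
  from pfun_rays[OF Q(1,2)] obtain N c b where c: "\<And>i. i \<le> N \<Longrightarrow> pfun J (c i)" "c N b \<noteq> 0"
    "\<And>\<tau> w. Q (\<lambda>j. \<tau> * w j) = (\<Sum>i\<le>N. c i w * \<tau> ^ i)" by blast
  \<comment> \<open>Besides the top form, \<open>e j0\<close> must be nonzero in order to project
    along \<open>e\<close> and drop the coordinate \<open>j0\<close>.\<close>
  obtain e where e: "c N e \<noteq> 0" "e j0 \<noteq> 0"
    using pfun_prod_nonzero[OF c(1)[of N] pfun_var[OF j0], of b "\<lambda>_. 1"] c(2) by auto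
  define g' where "g' j = (\<lambda>y. g j y - (e j / e j0) * g j0 y)" for j
  have g': "pfun UNIV (g' j)" for j
    unfolding g'_def by (intro pfun_diff pfun_mult pfun_const g)
  have "proper_on Z (J - {j0}) g'"
    unfolding proper_on_def
  proof
    fix R :: real
    have "\<exists>M. \<forall>y\<in>Z. (\<forall>j\<in>J - {j0}. cmod (g' j y) \<le> R) \<longrightarrow> cmod (g j0 y) \<le> M"
    proof (rule ccontr)
      assume "\<not> ?thesis"
      then have "\<forall>n::nat. \<exists>y\<in>Z. (\<forall>j\<in>J - {j0}. cmod (g' j y) \<le> R) \<and> cmod (g j0 y) > real n"
        by (meson not_le)
      then obtain Y where Y: "\<And>n. Y n \<in> Z" "\<And>n j. j \<in> J - {j0} \<Longrightarrow> cmod (g' j (Y n)) \<le> R" "\<And>n. cmod (g j0 (Y n)) > real n"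
        by metis
      \<comment> \<open>This scale makes the \<open>j0\<close> component of the rescaled point
        exactly \<open>e j0\<close>; the other components differ from \<open>e j\<close> by a
        bounded quantity divided by \<open>\<tau> n\<close>.\<close>
      define \<tau> where "\<tau> n = g j0 (Y n) / e j0" for n
      have \<tau>0: "\<tau> n \<noteq> 0" for n using Y(3)[of n] e(2) by (auto simp: \<tau>_def)
      have "filterlim (\<lambda>n. cmod (g j0 (Y n))) at_top sequentially"
        by (rule filterlim_at_top_mono[OF filterlim_real_sequentially]) (auto intro: always_eventually less_imp_le Y(3))
      then have "filterlim (\<lambda>n. g j0 (Y n)) at_infinity sequentially"
        by (rule filterlim_norm_at_top_imp_at_infinity)
      then have "(\<lambda>n. inverse (g j0 (Y n))) \<longlonglongrightarrow> 0" by (rule filterlim_compose[OF tendsto_inverse_0])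
      then have "(\<lambda>n. inverse (g j0 (Y n)) * e j0) \<longlonglongrightarrow> 0" by (rule tendsto_mult_left_zero)
      moreover have "inverse (g j0 (Y n)) * e j0 = inverse (\<tau> n)" for n by (simp add: \<tau>_def field_simps)
      ultimately have inv: "(\<lambda>n. inverse (\<tau> n)) \<longlonglongrightarrow> 0" by simp
      define w where "w n j = g j (Y n) / \<tau> n" for n j
      have wj: "(\<lambda>n. w n j) \<longlonglongrightarrow> e j" if "j \<in> J" for j
      proof -
        have weq: "w n j = e j + g' j (Y n) * inverse (\<tau> n)" for n
          using \<tau>0[of n] e(2) by (simp add: w_def g'_def \<tau>_def divide_simps)
        have "(\<lambda>n. g' j (Y n) * inverse (\<tau> n)) \<longlonglongrightarrow> 0"
        proof (cases "j = j0")
          case True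
          then have "g' j (Y n) = 0" for n using e(2) by (simp add: g'_def)
          then show ?thesis by simp
        next
          case False
          then have "cmod (g' j (Y n) * inverse (\<tau> n)) \<le> R * cmod (inverse (\<tau> n))" for n
            unfolding norm_mult using Y(2)[of j n] that by (intro mult_right_mono) auto
          moreover have "(\<lambda>n. R * cmod (inverse (\<tau> n))) \<longlonglongrightarrow> 0"
            using tendsto_mult_right_zero[OF tendsto_norm_zero[OF inv]] .
          ultimately show ?thesis
            by (rule Lim_null_comparison[OF always_eventually[OF allI]])
        qed
        from tendsto_add[OF tendsto_const[of "e j"] this] show ?thesis unfolding weq by simp
      qed
      have lim: "(\<lambda>n. c i (w n)) \<longlonglongrightarrow> c i e" if "i \<le> N" for i
        by (rule pfun_tendsto[OF c(1)[OF that] wj])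
      have cN: "c N (w n) = - (\<Sum>i<N. c i (w n) * inverse (\<tau> n) ^ (N - i))" for n
      proof -
        have "(\<lambda>j. \<tau> n * w n j) = (\<lambda>j. g j (Y n))" using \<tau>0[of n] by (simp add: w_def)
        then have "(\<Sum>i\<le>N. c i (w n) * \<tau> n ^ i) = 0" using c(3)[of "\<tau> n" "w n"] Q(3)[OF Y(1)[of n]] by simp
        then have "inverse (\<tau> n) ^ N * (\<Sum>i\<le>N. c i (w n) * \<tau> n ^ i) = 0" by simp
        moreover have "inverse (\<tau> n) ^ N * (c i (w n) * \<tau> n ^ i) = c i (w n) * inverse (\<tau> n) ^ (N - i)" if "i \<le> N" for i
          using that \<tau>0[of n] by (simp add: power_inverse power_diff field_simps)
        ultimately have "(\<Sum>i\<le>N. c i (w n) * inverse (\<tau> n) ^ (N - i)) = 0"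
          by (simp add: sum_distrib_left)
        moreover have "{..N} = insert N {..<N}" by auto
        ultimately show ?thesis by (simp add: eq_neg_iff_add_eq_0)
      qed
      have "(\<lambda>n. - (\<Sum>i<N. c i (w n) * inverse (\<tau> n) ^ (N - i))) \<longlonglongrightarrow> - (\<Sum>i<N. c i e * 0 ^ (N - i))"
        by (intro tendsto_intros lim inv) auto
      moreover have "(\<Sum>i<N. c i e * 0 ^ (N - i)) = 0" by (intro sum.neutral) auto
      ultimately have "(\<lambda>n. c N (w n)) \<longlonglongrightarrow> 0" using cN by simp
      with lim[of N] e(1) show False by (auto dest: LIMSEQ_unique)
    qed
    then obtain M where M: "\<And>y. y \<in> Z \<Longrightarrow> (\<forall>j\<in>J - {j0}. cmod (g' j y) \<le> R) \<Longrightarrow> cmod (g j0 y) \<le> M" by blast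
    define R' where "R' = Max (insert M ((\<lambda>j. R + cmod (e j / e j0) * M) ` J))"
    obtain M' where M': "\<And>y v. y \<in> Z \<Longrightarrow> (\<forall>j\<in>J. cmod (g j y) \<le> R') \<Longrightarrow> cmod (y v) \<le> M'"
      using pr unfolding proper_on_def by blast
    have "cmod (y v) \<le> M'" if y: "y \<in> Z" "\<forall>j\<in>J - {j0}. cmod (g' j y) \<le> R" for y v
    proof (rule M'[OF y(1)], intro ballI)
      fix j assume j: "j \<in> J"
      show "cmod (g j y) \<le> R'"
      proof (cases "j = j0")
        case True
        then show ?thesis using M[OF y] J by (auto simp: R'_def intro: order_trans[OF _ Max_ge])
      next
        case False
        have "g j y = g' j y + (e j / e j0) * g j0 y" by (simp add: g'_def)
        then have "cmod (g j y) \<le> cmod (g' j y) + cmod (e j / e j0) * cmod (g j0 y)"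
          by (metis norm_mult norm_triangle_ineq)
        also have "\<dots> \<le> R + cmod (e j / e j0) * M"
          using y(2) j False M[OF y] by (intro add_mono mult_left_mono) auto
        also have "\<dots> \<le> R'" unfolding R'_def using J j by (intro Max_ge) auto
        finally show ?thesis .
      qed
    qed
    then show "\<exists>M. \<forall>y\<in>Z. (\<forall>j\<in>J - {j0}. cmod (g' j y) \<le> R) \<longrightarrow> (\<forall>v. cmod (y v) \<le> M)" by blast
  qed
  with j0 g' show ?thesis by blast
qed

text \<open>Start from all coordinates and take a proper family with the fewest members; any
  relation among them would allow \<open>proper_reduce\<close> to remove one more.\<close>

lemma noether_normalization:
  fixes Z :: "('v::finite \<Rightarrow> complex) set"
  assumes "Z \<noteq> {}"
  shows "\<exists>(J :: 'v set) g. (\<forall>j. pfun UNIV (g j)) \<and> proper_on Z J g \<and>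
    (\<forall>Q. pfun J Q \<longrightarrow> (\<forall>y\<in>Z. Q (\<lambda>j. g j y) = 0) \<longrightarrow> Q = 0)"
proof -
  define good where "good J \<longleftrightarrow> (\<exists>g. (\<forall>j. pfun UNIV (g j)) \<and> proper_on Z J g)" for J :: "'v set"
  have "good UNIV" unfolding good_def proper_on_def
    by (rule exI[of _ "\<lambda>j y. y j"]) (auto intro: pfun_var)
  then obtain J where J: "good J" and min: "\<And>K. good K \<Longrightarrow> card J \<le> card K"
    using ex_has_least_nat[of good UNIV card] by blast
  then obtain g where g: "\<And>j. pfun UNIV (g j)" "proper_on Z J g" by (auto simp: good_def)
  have "Q = 0" if Q: "pfun J Q" "\<forall>y\<in>Z. Q (\<lambda>j. g j y) = 0" for Q
  proof (rule ccontr)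
    assume "Q \<noteq> 0"
    then obtain a where a: "Q a \<noteq> 0" by (auto simp: fun_eq_iff)
    obtain j where "j \<in> J" "good (J - {j})"
      using proper_reduce[OF finite g Q(1) a _ assms] Q(2) by (auto simp: good_def)
    from min[OF this(2)] this(1) card_Diff1_less[OF finite, of j J] show False by simp
  qed
  with g show ?thesis by blast
qed


text \<open>The graph of the map given by \<open>u\<close> and \<open>g\<close>: its values become
  coordinates, so that elimination, which only knows coordinates, applies to them.\<close>

definition adjoin :: "('v \<Rightarrow> ('v \<Rightarrow> complex) \<Rightarrow> complex) \<Rightarrow> (('v \<Rightarrow> complex) \<Rightarrow> complex) \<Rightarrow> ('v \<Rightarrow> complex) \<Rightarrow> ('v option + 'v \<Rightarrow> complex)" where
  "adjoin g u y = case_sum (case_option (u y) (\<lambda>j. g j y)) y"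

lemma adjoin_simps [simp]:
  "adjoin g u y (Inl None) = u y" "adjoin g u y (Inl (Some j)) = g j y" "adjoin g u y (Inr v) = y v"
  by (simp_all add: adjoin_def)

lemma zcl_adjoin:
  fixes A :: "('v \<Rightarrow> complex) set"
  assumes g: "\<And>j. pfun UNIV (g j)" and u: "pfun UNIV u" and z: "\<xi> \<in> zcl UNIV (adjoin g u ` A)"
  shows "(\<lambda>v. \<xi> (Inr v)) \<in> zcl UNIV A" "g j (\<lambda>v. \<xi> (Inr v)) = \<xi> (Inl (Some j))" "u (\<lambda>v. \<xi> (Inr v)) = \<xi> (Inl None)"
proof -
  have lift: "pfun UNIV (\<lambda>\<xi> :: 'v option + 'v \<Rightarrow> complex. f (\<lambda>v. \<xi> (Inr v)))" if "pfun UNIV f" for f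
    by (rule pfun_comp[OF that]) (auto intro: pfun_var)
  show "(\<lambda>v. \<xi> (Inr v)) \<in> zcl UNIV A"
  proof (rule zclI)
    fix f assume f: "pfun UNIV f" "van A f"
    have "van (adjoin g u ` A) (\<lambda>\<xi>. f (\<lambda>v. \<xi> (Inr v)))" using f(2) by (auto simp: van_def)
    from zclD[OF z lift[OF f(1)] this] show "f (\<lambda>v. \<xi> (Inr v)) = 0" .
  qed
  have "van (adjoin g u ` A) (\<lambda>\<xi>. g j (\<lambda>v. \<xi> (Inr v)) - \<xi> (Inl (Some j)))" by (auto simp: van_def)
  from zclD[OF z pfun_diff[OF lift[OF g] pfun_var] this]
  show "g j (\<lambda>v. \<xi> (Inr v)) = \<xi> (Inl (Some j))" by simp
  have "van (adjoin g u ` A) (\<lambda>\<xi>. u (\<lambda>v. \<xi> (Inr v)) - \<xi> (Inl None))" by (auto simp: van_def)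
  from zclD[OF z pfun_diff[OF lift[OF u] pfun_var] this]
  show "u (\<lambda>v. \<xi> (Inr v)) = \<xi> (Inl None)" by simp
qed

text \<open>Generic roots of the minimal relation of \<open>u\<close> are attained on \<open>A\<close>, hence locally bounded by properness; so are
  the quotients of the coefficients by the leading one, which are therefore polynomials.\<close>

lemma monic_relation:
  fixes A :: "('v::finite \<Rightarrow> complex) set" and J :: "'v set"
  assumes A: "irr A" and g: "\<And>j. pfun UNIV (g j)" and pr: "proper_on (zcl UNIV A) J g"
    and ind: "\<forall>Q. pfun J Q \<longrightarrow> (\<forall>y\<in>zcl UNIV A. Q (\<lambda>j. g j y) = 0) \<longrightarrow> Q = 0"
    and u: "pfun UNIV u" and f: "pfun UNIV f" "\<not> van A f"
  shows "\<exists>P G a. pcoef J P \<and> lead_coeff P = 1 \<and> pfun J G \<and> G a \<noteq> 0 \<and>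
     (\<forall>y\<in>zcl UNIV A. poly (pev (\<lambda>j. g j y) P) (u y) = 0) \<and>
     (\<forall>x c. G x \<noteq> 0 \<longrightarrow> poly (pev x P) c = 0 \<longrightarrow>
        (\<exists>y\<in>zcl UNIV A. (\<forall>j\<in>J. g j y = x j) \<and> u y = c \<and> f y \<noteq> 0))"
proof -
  define A' where "A' = adjoin g u ` A"
  define V0 :: "('v option + 'v) set" where "V0 = Inl ` Some ` J"
  define t :: "'v option + 'v" where "t = Inl None"
  have t: "t \<notin> V0" by (auto simp: t_def V0_def)
  have irr': "irr A'" unfolding A'_def
  proof (rule irr_image[OF A])
    show "pfun UNIV (\<lambda>y. adjoin g u y i)" for i
      by (cases i; cases "projl i") (auto intro: g u pfun_var)
  qed
  \<comment> \<open>Independence of the \<open>g j\<close> carried over to the graph: there are no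
    relations in \<open>V0\<close>, so its closure in these variables is everything.\<close>
  have ind': "F = 0" if F: "pfun V0 F" "van A' F" for F
  proof -
    define Q where "Q w = F (case_sum (case_option 0 w) (\<lambda>_. 0))" for w
    have Q: "pfun J Q" unfolding Q_def
      by (rule pfun_comp[OF F(1)]) (auto simp: V0_def intro: pfun_var)
    have FQ: "F \<xi> = Q (\<lambda>j. \<xi> (Inl (Some j)))" for \<xi>
      unfolding Q_def by (rule pfun_cong[OF F(1)]) (auto simp: V0_def)
    have "van A (\<lambda>y. Q (\<lambda>j. g j y))" using F(2) by (auto simp: van_def A'_def FQ)
    moreover have "pfun UNIV (\<lambda>y. Q (\<lambda>j. g j y))" by (rule pfun_comp[OF Q]) (rule g)
    ultimately have "van (zcl UNIV A) (\<lambda>y. Q (\<lambda>j. g j y))" by (simp add: van_zcl)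
    then have "Q = 0" using ind[THEN spec, THEN mp, OF Q] by (auto simp: van_def)
    then show ?thesis by (intro ext) (simp add: FQ)
  qed
  have zcl0: "\<xi> \<in> zcl V0 A'" for \<xi> by (rule zclI) (auto dest: ind')
  note zA = zcl_adjoin[where g = g and u = u and A = A, OF g u, folded A'_def]
  have vbound: "\<exists>M. \<forall>y\<in>zcl UNIV A. (\<forall>j\<in>J. cmod (g j y) \<le> R) \<longrightarrow> cmod (u y) \<le> M" for R
  proof -
    obtain M where M: "\<And>y v. y \<in> zcl UNIV A \<Longrightarrow> (\<forall>j\<in>J. cmod (g j y) \<le> R) \<Longrightarrow> cmod (y v) \<le> M"
      using pr unfolding proper_on_def by blast
    obtain M' where "\<And>y. (\<forall>v\<in>UNIV. cmod (y v) \<le> M) \<Longrightarrow> cmod (u y) \<le> M'"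
      using pfun_bounded[OF u, of M] by blast
    with M show ?thesis by blast
  qed
  have T: "finite (- insert t V0)" "- insert t V0 \<inter> insert t V0 = {}" "insert t V0 \<union> - insert t V0 = UNIV" by auto
  \<comment> \<open>If \<open>u\<close> were transcendental over the base, it would take arbitrarily
    large values over one fixed base point, contradicting properness.\<close>
  have alg: "alg_over A' V0 t"
  proof (rule ccontr)
    assume na: "\<not> alg_over A' V0 t"
    have zcl1: "\<xi> \<in> zcl (insert t V0) A'" for \<xi>
    proof (rule zclI)
      fix F assume F: "pfun (insert t V0) F" "van A' F"
      from pfun_ev_ex[OF F(1) subset_refl] obtain P where P: "pcoef V0 P" "F = ev t P" by (elim exE conjE)
      have "van A' (coeff P i)" for i using not_van_ev[OF na P(1)] F(2) P(2) by blast
      then have "coeff P i = 0" for i using P(1) by (intro ind') (auto simp: pcoef_def)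
      then have "P = 0" by (intro poly_eqI) simp
      then show "F \<xi> = 0" using P by simp
    qed
    have "\<not> van A' (\<lambda>_. 1)" using irr' by (auto simp: irr_def van_def)
    from extend[OF irr' T(1,2) pfun_1(2) this] obtain L where L: "pfun (insert t V0) L" "\<not> van A' L"
      "\<And>z. L z \<noteq> 0 \<Longrightarrow> \<exists>z'. (\<forall>i\<in>insert t V0. z' i = z i) \<and> z' \<in> zcl UNIV A'"
      using zcl1 unfolding T(3) by (metis (no_types, lifting) ComplD)
    from pfun_ev_ex[OF L(1) subset_refl] obtain P where P: "pcoef V0 P" "L = ev t P" by (elim exE conjE)
    have "P \<noteq> 0" using L(2) P(2) by (auto simp: van_def)
    then obtain i where "coeff P i \<noteq> 0" by (metis leading_coeff_0_iff)
    then obtain \<xi> where "coeff P i \<xi> \<noteq> 0" by (auto simp: fun_eq_iff)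
    then have nz: "pev \<xi> P \<noteq> 0" by (metis coeff_0 coeff_pev)
    define R where "R = Max (insert 0 ((\<lambda>j. cmod (\<xi> (Inl (Some j)))) ` J))"
    have R: "cmod (\<xi> (Inl (Some j))) \<le> R" if "j \<in> J" for j using that by (auto simp: R_def)
    obtain M where M: "\<And>y. y \<in> zcl UNIV A \<Longrightarrow> (\<forall>j\<in>J. cmod (g j y) \<le> R) \<Longrightarrow> cmod (u y) \<le> M"
      using vbound[of R] by blast
    have "finite {c. poly (pev \<xi> P) c = 0}" using nz poly_roots_finite by blast
    then have "bounded {c. poly (pev \<xi> P) c = 0}" by (rule finite_imp_bounded)
    then obtain B where B: "\<And>c. poly (pev \<xi> P) c = 0 \<Longrightarrow> cmod c \<le> B" by (auto simp: bounded_iff)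
    \<comment> \<open>Larger than the bound \<open>M\<close> from properness and than all roots of
      the exceptional polynomial, so that the lift exists and is contradictory.\<close>
    define c :: complex where "c = of_real (\<bar>B\<bar> + \<bar>M\<bar> + 1)"
    have cc: "cmod c = \<bar>B\<bar> + \<bar>M\<bar> + 1" unfolding c_def norm_of_real by simp
    then have "poly (pev \<xi> P) c \<noteq> 0" using B[of c] by fastforce
    then have "L (\<xi>(t := c)) \<noteq> 0" using ev_upd[OF P(1) t] P(2) by simp
    from L(3)[OF this] obtain z where z: "\<And>i. i \<in> insert t V0 \<Longrightarrow> z i = (\<xi>(t := c)) i" "z \<in> zcl UNIV A'" by blast
    have "cmod (u (\<lambda>v. z (Inr v))) \<le> M"
    proof (rule M[OF zA(1)[OF z(2)]], intro ballI)
      fix j assume "j \<in> J"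
      then show "cmod (g j (\<lambda>v. z (Inr v))) \<le> R"
        using R z(1)[of "Inl (Some j)"] by (simp add: zA(2)[OF z(2)] V0_def t_def)
    qed
    moreover have "u (\<lambda>v. z (Inr v)) = c" using z(1)[of t] by (simp add: zA(3)[OF z(2)] flip: t_def)
    ultimately show False using cc by simp
  qed
  obtain P where P: "minpol A' V0 t P" using minpol_exists[OF alg] by (elim exE)
  then have P': "pcoef V0 P" "van A' (ev t P)" "\<not> van A' (lead_coeff P)" by (auto simp: minpol_def)
  define f' where "f' \<xi> = f (\<lambda>v. \<xi> (Inr v))" for \<xi> :: "'v option + 'v \<Rightarrow> complex"
  have f': "pfun UNIV f'" unfolding f'_def by (rule pfun_comp[OF f(1)]) (auto intro: pfun_var)
  have nf': "\<not> van A' f'" using f(2) by (auto simp: van_def A'_def f'_def)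
  from extend[OF irr' T(1,2), unfolded T(3), OF f' nf'] obtain L where L: "pfun (insert t V0) L" "\<not> van A' L"
    "\<And>z. z \<in> zcl (insert t V0) A' \<Longrightarrow> L z \<noteq> 0 \<Longrightarrow> \<exists>z'. (\<forall>i\<in>insert t V0. z' i = z i) \<and> z' \<in> zcl UNIV A' \<and> f' z' \<noteq> 0"
    by (metis (no_types, lifting) ComplD)
  from extend_alg[OF irr' P t L(1,2)] obtain G where G: "pfun V0 G" "\<not> van A' G"
    "\<And>z. G z \<noteq> 0 \<Longrightarrow> lead_coeff P z \<noteq> 0"
    "\<And>z c. G z \<noteq> 0 \<Longrightarrow> poly (pev z P) c = 0 \<Longrightarrow> z(t := c) \<in> zcl (insert t V0) A' \<and> L (z(t := c)) \<noteq> 0"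
    using zcl0 by blast
  have attain: "\<exists>y\<in>zcl UNIV A. (\<forall>j\<in>J. g j y = \<xi> (Inl (Some j))) \<and> u y = c \<and> f y \<noteq> 0"
    if \<xi>: "G \<xi> \<noteq> 0" "poly (pev \<xi> P) c = 0" for \<xi> c
  proof -
    from G(4)[OF \<xi>] L(3) obtain z where z: "\<And>i. i \<in> insert t V0 \<Longrightarrow> z i = (\<xi>(t := c)) i" "z \<in> zcl UNIV A'" "f' z \<noteq> 0"
      by blast
    show ?thesis
    proof (intro bexI[of _ "\<lambda>v. z (Inr v)"] conjI ballI)
      show "(\<lambda>v. z (Inr v)) \<in> zcl UNIV A" by (rule zA(1)[OF z(2)])
      show "u (\<lambda>v. z (Inr v)) = c" using z(1)[of t] by (simp add: zA(3)[OF z(2)] flip: t_def)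
      show "f (\<lambda>v. z (Inr v)) \<noteq> 0" using z(3) by (simp add: f'_def)
      fix j assume "j \<in> J"
      then show "g j (\<lambda>v. z (Inr v)) = \<xi> (Inl (Some j))"
        using z(1)[of "Inl (Some j)"] by (simp add: zA(2)[OF z(2)] V0_def t_def)
    qed
  qed
  obtain a where a: "G a \<noteq> 0" using G(2) by (auto simp: van_def)
  have finV0: "finite V0" by simp
  define l where "l = lead_coeff P"
  have l: "pfun V0 l" using P'(1) by (auto simp: l_def pcoef_def)
  have l0: "l \<noteq> 0" using P'(3) by (auto simp: l_def van_def)
  \<comment> \<open>Over generic base points all roots are values of \<open>u\<close>, so properness
    bounds them and \<open>coeff_le_of_roots\<close> bounds the coefficients by the leading one;
    \<open>bound_dense\<close> and \<open>bounded_quotient\<close> then make the quotients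
    polynomials.\<close>
  have "\<forall>i. \<exists>h. pfun V0 h \<and> coeff P i = h * l"
  proof (intro allI, goal_cases)
    case (1 i)
    show ?case
    proof (rule bounded_quotient[OF finV0 _ l l0])
      show c: "pfun V0 (coeff P i)" using P'(1) by (auto simp: pcoef_def)
      fix R
      obtain M where M: "\<And>y. y \<in> zcl UNIV A \<Longrightarrow> (\<forall>j\<in>J. cmod (g j y) \<le> R + 1) \<Longrightarrow> cmod (u y) \<le> M"
        using vbound[of "R + 1"] by blast
      have "max M 0 \<ge> 0" by simp
      from coeff_le_of_roots[OF this, of "degree P"] obtain K where K: "K \<ge> 0" "\<And>q i. degree q = degree P \<Longrightarrow>
         (\<forall>c. poly q c = 0 \<longrightarrow> cmod c \<le> max M 0) \<Longrightarrow> cmod (coeff q i) \<le> K * cmod (lead_coeff q)" by blast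
      have "cmod (coeff P i \<xi>) \<le> K * cmod (l \<xi>)" if \<xi>: "\<forall>i\<in>V0. cmod (\<xi> i) \<le> R" for \<xi>
      proof (rule bound_dense[OF finV0 c l G(1) a _ \<xi>])
        fix \<xi> assume \<xi>: "\<forall>i\<in>V0. cmod (\<xi> i) \<le> R + 1" "G \<xi> \<noteq> 0"
        have "coeff (pev \<xi> P) (degree P) \<noteq> 0" using G(3)[OF \<xi>(2)] by simp
        then have deg: "degree (pev \<xi> P) = degree P" using degree_pev[of \<xi> P] le_degree by (metis le_antisym)
        have "cmod c \<le> max M 0" if c: "poly (pev \<xi> P) c = 0" for c
        proof -
          from attain[OF \<xi>(2) c] obtain y where y: "y \<in> zcl UNIV A" "\<forall>j\<in>J. g j y = \<xi> (Inl (Some j))" "u y = c" by blast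
          have "cmod (u y) \<le> M" using y(2) \<xi>(1) by (intro M[OF y(1)]) (auto simp: V0_def)
          then show ?thesis using y(3) by simp
        qed
        then have "cmod (coeff (pev \<xi> P) i) \<le> K * cmod (lead_coeff (pev \<xi> P))" by (intro K(2) deg) auto
        then show "cmod (coeff P i \<xi>) \<le> K * cmod (l \<xi>)" by (simp add: deg l_def)
      qed
      then show "\<exists>M. \<forall>x. (\<forall>i\<in>V0. cmod (x i) \<le> R) \<longrightarrow> cmod (coeff P i x) \<le> M * cmod (l x)" by blast
    qed
  qed
  from choice[OF this] obtain h where h: "\<forall>i. pfun V0 (h i) \<and> coeff P i = h i * l" by (elim exE)
  define tr :: "('v \<Rightarrow> complex) \<Rightarrow> 'v option + 'v \<Rightarrow> complex" where "tr w = case_sum (case_option 0 w) (\<lambda>_. 0)" for w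
  have tr: "pfun J (\<lambda>w. F (tr w))" if "pfun V0 F" for F
    unfolding tr_def by (rule pfun_comp[OF that]) (auto simp: V0_def intro: pfun_var)
  have trc: "F (tr w) = F \<xi>" if "pfun V0 F" "\<And>j. j \<in> J \<Longrightarrow> \<xi> (Inl (Some j)) = w j" for F w \<xi>
    using that(1) by (rule pfun_cong) (use that(2) in \<open>auto simp: V0_def tr_def\<close>)
  define d where "d = degree P"
  \<comment> \<open>The relation divided by its leading coefficient and rewritten in the variables
    \<open>J\<close>; the top coefficient is put in literally as 1, which \<open>hd\<close>
    justifies.\<close>
  define H where "H = monom 1 d + (\<Sum>i<d. monom (\<lambda>w. h i (tr w)) i)"
  have cH: "coeff H i = (if i = d then 1 else if i < d then (\<lambda>w. h i (tr w)) else 0)" for i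
    by (auto simp: H_def coeff_sum)
  have degH: "degree H = d"
    by (rule antisym[OF degree_le le_degree]) (auto simp: cH fun_eq_iff)
  have hd: "h d \<xi> = 1" for \<xi>
  proof -
    have "van UNIV ((h d - 1) * l)" using spec[OF h, of d] by (auto simp: van_def d_def l_def algebra_simps fun_eq_iff)
    moreover have "pfun V0 (h d - 1)" using h by (intro pfun_minus) auto
    ultimately have "van UNIV (h d - 1) \<or> van UNIV l" using irrD[OF irr_UNIV _ l] by blast
    then have "van UNIV (h d - 1)" using l0 by (auto simp: van_def fun_eq_iff)
    then show ?thesis by (auto simp: van_def)
  qed
  have smH: "smult (l \<xi>) (pev (\<lambda>j. \<xi> (Inl (Some j))) H) = pev \<xi> P" for \<xi>
  proof (rule poly_eqI)
    fix i
    have "coeff P i = h i * l" using h by blast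
    moreover have "h i (tr (\<lambda>j. \<xi> (Inl (Some j)))) = h i \<xi>"
      by (rule trc[where F = "h i" and \<xi> = \<xi>]) (use h in auto)
    moreover have "coeff P i \<xi> = 0" if "i > d" using that by (simp add: d_def coeff_eq_0)
    ultimately show "coeff (smult (l \<xi>) (pev (\<lambda>j. \<xi> (Inl (Some j))) H)) i = coeff (pev \<xi> P) i"
      using hd[of \<xi>] by (auto simp: cH)
  qed
  show ?thesis
  proof (intro exI[of _ H] exI[of _ "\<lambda>w. G (tr w)"] exI[of _ "\<lambda>j. a (Inl (Some j))"] conjI ballI allI impI)
    show "pcoef J H" unfolding pcoef_def cH using h tr by auto
    show "lead_coeff H = 1" by (simp add: degH cH)
    show "pfun J (\<lambda>w. G (tr w))" by (rule tr[OF G(1)])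
    show "G (tr (\<lambda>j. a (Inl (Some j)))) \<noteq> 0" using trc[OF G(1), of a] a by simp
  next
    fix y assume y: "y \<in> zcl UNIV A"
    define e where "e y = poly (pev (\<lambda>j. g j y) H) (u y)" for y
    have e_sum: "e y = (\<Sum>i\<le>d. coeff H i (\<lambda>j. g j y) * u y ^ i)" for y
      unfolding e_def using poly_altdef_le[OF degree_pev, of "\<lambda>j. g j y" H] by (simp add: degH)
    have pe: "pfun UNIV e" unfolding e_sum[abs_def]
    proof (intro pfun_sum' pfun_mult pfun_pow u)
      fix i have "pfun J (coeff H i)" unfolding cH using h tr by auto
      then show "pfun UNIV (\<lambda>y. coeff H i (\<lambda>j. g j y))" by (rule pfun_comp) (rule g)
    qed
    have pl: "pfun UNIV (\<lambda>y. l (adjoin g u y))"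
      by (rule pfun_comp[OF l]) (auto simp: V0_def g)
    have "van A ((\<lambda>y. l (adjoin g u y)) * e)"
    proof (rule vanI)
      fix y assume "y \<in> A"
      then have "ev t P (adjoin g u y) = 0" using P'(2) by (auto simp: van_def A'_def)
      then have "poly (pev (adjoin g u y) P) (u y) = 0" by (simp add: ev_pev t_def)
      then have "poly (smult (l (adjoin g u y)) (pev (\<lambda>j. g j y) H)) (u y) = 0"
        using smH[of "adjoin g u y"] by simp
      then show "((\<lambda>y. l (adjoin g u y)) * e) y = 0" by (simp add: e_def)
    qed
    moreover have "\<not> van A (\<lambda>y. l (adjoin g u y))" using P'(3) by (auto simp: van_def A'_def l_def)
    ultimately have "van A e" using irrD[OF A pl pe] by blast
    from zclD[OF y pe this] show "poly (pev (\<lambda>j. g j y) H) (u y) = 0" by (simp add: e_def)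
  next
    fix x c assume x: "G (tr x) \<noteq> 0" "poly (pev x H) c = 0"
    have "poly (smult (l (tr x)) (pev x H)) c = 0" using x(2) by simp
    moreover have "smult (l (tr x)) (pev x H) = pev (tr x) P" using smH[of "tr x"] by (simp add: tr_def)
    ultimately have "poly (pev (tr x) P) c = 0" by (simp only:)
    from attain[OF x(1) this] show "\<exists>y\<in>zcl UNIV A. (\<forall>j\<in>J. g j y = x j) \<and> u y = c \<and> f y \<noteq> 0"
      by (simp add: tr_def)
  qed
qed

section \<open>Density of generic points\<close>

text \<open>The value of a monic polynomial at \<open>\<tau>\<close> is, in modulus, the product of
  the distances to its roots, so the nearest root satisfies the estimate. This is the continuity of
  roots in quantitative form.\<close>

lemma near_root:
  fixes q :: "complex poly"
  assumes "degree q = Suc n" "lead_coeff q = 1"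
  shows "\<exists>c. poly q c = 0 \<and> cmod (\<tau> - c) ^ Suc n \<le> cmod (poly q \<tau>)"
  using assms
proof (induction n arbitrary: q)
  case (0 q)
  then have q: "coeff q 1 = 1" "degree q \<le> 1" by auto
  have "poly q x = coeff q 0 + x" for x
    using poly_altdef_le[OF q(2)] q(1) by simp
  then show ?case by (intro exI[of _ "- coeff q 0"]) (simp add: add.commute)
next
  case (Suc n q)
  have "\<not> constant (poly q)" using Suc.prems by (simp add: constant_degree)
  then obtain c where c: "poly q c = 0" using Fundamental_Theorem_Algebra.fundamental_theorem_of_algebra by blast
  then obtain r where r: "q = [:-c, 1:] * r" by (auto simp: poly_eq_0_iff_dvd dvd_def)
  then have r0: "r \<noteq> 0" using Suc.prems by auto
  have "degree q = degree [:-c, 1:] + degree r" unfolding r by (rule degree_mult_eq) (use r0 in auto)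
  then have dr: "degree r = Suc n" using Suc.prems by simp
  have lr: "lead_coeff r = 1" using Suc.prems(2) unfolding r lead_coeff_mult by simp
  obtain c' where c': "poly r c' = 0" "cmod (\<tau> - c') ^ Suc n \<le> cmod (poly r \<tau>)"
    using Suc.IH[OF dr lr] by blast
  have qt: "cmod (poly q \<tau>) = cmod (\<tau> - c) * cmod (poly r \<tau>)"
    unfolding r by (simp flip: norm_mult add: algebra_simps)
  show ?case
  proof (cases "cmod (\<tau> - c) \<le> cmod (\<tau> - c')")
    case True
    have "cmod (\<tau> - c) ^ Suc (Suc n) = cmod (\<tau> - c) * cmod (\<tau> - c) ^ Suc n" by simp
    also have "\<dots> \<le> cmod (\<tau> - c) * cmod (\<tau> - c') ^ Suc n"
      using True by (intro mult_left_mono power_mono) auto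
    also have "\<dots> \<le> cmod (poly q \<tau>)" unfolding qt using c'(2) by (intro mult_left_mono) auto
    finally show ?thesis using c by blast
  next
    case False
    have "cmod (\<tau> - c') ^ Suc (Suc n) = cmod (\<tau> - c') * cmod (\<tau> - c') ^ Suc n" by simp
    also have "\<dots> \<le> cmod (poly q \<tau>)" unfolding qt using c'(2) False by (intro mult_mono) auto
    finally show ?thesis using c' r by auto
  qed
qed

text \<open>Choose a polynomial function \<open>w\<close> that vanishes on the fibre of the normalization through \<open>y0\<close> except at \<open>y0\<close>.
  Over generic base points near that of \<open>y0\<close>, continuity of roots gives points where \<open>w\<close> is close to \<open>w y0\<close>; by
  properness they accumulate, and only \<open>y0\<close> can be a limit.\<close>

theorem irr_dense:
  fixes A :: "('v::finite \<Rightarrow> complex) set"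
  assumes A: "irr A" and f: "pfun UNIV f" "\<not> van A f" and y0: "y0 \<in> zcl UNIV A" and \<epsilon>: "\<epsilon> > 0"
  shows "\<exists>y\<in>zcl UNIV A. f y \<noteq> 0 \<and> (\<forall>v. cmod (y v - y0 v) < \<epsilon>)"
proof -
  define Z where "Z = zcl UNIV A"
  have "Z \<noteq> {}" using y0 by (auto simp: Z_def)
  from noether_normalization[OF this] obtain J :: "'v set" and g where
    g: "\<And>j. pfun UNIV (g j)" and pr: "proper_on Z J g" and
    ind: "\<forall>Q. pfun J Q \<longrightarrow> (\<forall>y\<in>Z. Q (\<lambda>j. g j y) = 0) \<longrightarrow> Q = 0" by blast
  note mr = monic_relation[where g = g and J = J, OF A g pr[unfolded Z_def] ind[unfolded Z_def], folded Z_def]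
  define x0 where "x0 = (\<lambda>j. g j y0)"
  define Fb where "Fb = {y\<in>Z. \<forall>j\<in>J. g j y = x0 j}"
  have pevJ: "pev x P = pev x' P" if "pcoef J P" "\<And>j. j \<in> J \<Longrightarrow> x j = x' j" for P x x'
  proof (rule poly_eqI)
    fix i
    have "pfun J (coeff P i)" using that(1) by (simp add: pcoef_def)
    from pfun_cong[OF this that(2)] show "coeff (pev x P) i = coeff (pev x' P) i" by simp
  qed
  \<comment> \<open>Each coordinate function satisfies a monic relation over the base, whose
    specialization at \<open>x0\<close> is nonzero; hence the fibre through \<open>y0\<close> is
    finite.\<close>
  have "\<exists>R. finite R \<and> (\<forall>y\<in>Fb. y v \<in> R)" for v
  proof -
    from mr[OF pfun_var[OF UNIV_I] f] obtain P where P: "pcoef J P" "lead_coeff P = 1"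
      "\<And>y. y \<in> Z \<Longrightarrow> poly (pev (\<lambda>j. g j y) P) (y v) = 0" by blast
    have "coeff (pev x0 P) (degree P) = 1" using P(2) by simp
    then have "pev x0 P \<noteq> 0" by (metis coeff_0 zero_neq_one)
    then have "finite {c. poly (pev x0 P) c = 0}" by (rule poly_roots_finite)
    moreover have "y v \<in> {c. poly (pev x0 P) c = 0}" if "y \<in> Fb" for y
      using P(3)[of y] pevJ[OF P(1), of "\<lambda>j. g j y" x0] that by (simp add: Fb_def)
    ultimately show ?thesis by blast
  qed
  then obtain R where R: "\<And>v. finite (R v)" "\<And>v y. y \<in> Fb \<Longrightarrow> y v \<in> R v" by metis
  have "Fb \<subseteq> Pi\<^sub>E UNIV R" using R(2) by (auto simp: PiE_def)
  moreover have "finite (Pi\<^sub>E UNIV R)" using R(1) by (intro finite_PiE) auto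
  ultimately have finF: "finite Fb" by (rule finite_subset)
  \<comment> \<open>\<open>d y\<close> is a coordinate in which \<open>y\<close> differs from
    \<open>y0\<close>; the product \<open>w\<close> of the corresponding linear factors separates
    \<open>y0\<close> from the rest of the fibre.\<close>
  have "\<forall>y. \<exists>v. y \<noteq> y0 \<longrightarrow> y v \<noteq> y0 v" by auto
  then obtain d where d: "\<And>y. y \<noteq> y0 \<Longrightarrow> y (d y) \<noteq> y0 (d y)" by metis
  define w where "w y = (\<Prod>y'\<in>Fb - {y0}. y (d y') - y' (d y'))" for y
  have w: "pfun UNIV w" unfolding w_def[abs_def]
    by (intro pfun_prod pfun_diff pfun_var pfun_const) auto
  have "y0 (d y') - y' (d y') \<noteq> 0" if "y' \<in> Fb - {y0}" for y' using d[of y'] that by auto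
  then have w0: "w y0 \<noteq> 0" using finF by (auto simp: w_def)
  have w1: "w y = 0" if "y \<in> Fb" "y \<noteq> y0" for y
    unfolding w_def using that finF by (intro prod_zero) auto
  from mr[OF w f] obtain P G a where P: "pcoef J P" "lead_coeff P = 1" "pfun J G" "G a \<noteq> 0"
    "\<And>y. y \<in> Z \<Longrightarrow> poly (pev (\<lambda>j. g j y) P) (w y) = 0"
    "\<And>x c. G x \<noteq> 0 \<Longrightarrow> poly (pev x P) c = 0 \<Longrightarrow> \<exists>y\<in>Z. (\<forall>j\<in>J. g j y = x j) \<and> w y = c \<and> f y \<noteq> 0"
    by blast
  define \<tau> where "\<tau> = w y0"
  have root: "poly (pev x0 P) \<tau> = 0" using P(5)[of y0] y0 by (simp add: x0_def \<tau>_def Z_def)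
  have deg: "degree (pev x P) = degree P" "lead_coeff (pev x P) = 1" for x
  proof -
    have *: "coeff (pev x P) (degree P) = 1" using P(2) by simp
    then show "degree (pev x P) = degree P" using degree_pev[of x P] le_degree[of "pev x P" "degree P"] by simp
    with * show "lead_coeff (pev x P) = 1" by simp
  qed
  have "degree P \<noteq> 0"
  proof
    assume d0: "degree P = 0"
    have "pev x0 P = [:1:]" by (rule poly_eqI) (use P(2) d0 in \<open>auto simp: coeff_pCons coeff_eq_0 split: nat.splits\<close>)
    with root show False by simp
  qed
  then obtain n0 where n0: "degree P = Suc n0" by (cases "degree P") auto
  have "\<forall>n::nat. \<exists>x. G x \<noteq> 0 \<and> (\<forall>j\<in>J. cmod (x j - x0 j) < inverse (real (Suc n)))"
    using pfun_dense[OF P(3,4) finite, of _ x0] by (meson inverse_positive_iff_positive of_nat_0_less_iff zero_less_Suc)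
  then obtain x where x: "\<And>n. G (x n) \<noteq> 0" "\<And>n j. j \<in> J \<Longrightarrow> cmod (x n j - x0 j) < inverse (real (Suc n))" by metis
  have xlim: "(\<lambda>n. x n j) \<longlonglongrightarrow> x0 j" if "j \<in> J" for j
  proof -
    have "(\<lambda>n. x n j - x0 j) \<longlonglongrightarrow> 0"
      using x(2)[OF that] by (intro Lim_null_comparison[OF _ LIMSEQ_inverse_real_of_nat]) (auto intro!: always_eventually less_imp_le)
    then show ?thesis by (simp add: LIM_zero_iff)
  qed
  have "\<exists>c. poly (pev (x n) P) c = 0 \<and> cmod (\<tau> - c) ^ Suc n0 \<le> cmod (poly (pev (x n) P) \<tau>)" for n
    by (rule near_root) (use deg n0 in auto)
  then obtain c where c: "\<And>n. poly (pev (x n) P) (c n) = 0"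
    "\<And>n. cmod (\<tau> - c n) ^ Suc n0 \<le> cmod (poly (pev (x n) P) \<tau>)" by metis
  have ps: "poly (pev x P) \<tau> = (\<Sum>i\<le>degree P. coeff P i x * \<tau> ^ i)" for x
    using poly_altdef_le[OF degree_pev, of x P \<tau>] by simp
  have "(\<lambda>n. poly (pev (x n) P) \<tau>) \<longlonglongrightarrow> poly (pev x0 P) \<tau>" unfolding ps
  proof (intro tendsto_intros)
    fix i have "pfun J (coeff P i)" using P(1) by (simp add: pcoef_def)
    from pfun_tendsto[OF this xlim] show "(\<lambda>n. coeff P i (x n)) \<longlonglongrightarrow> coeff P i x0" .
  qed
  then have plim: "(\<lambda>n. cmod (poly (pev (x n) P) \<tau>)) \<longlonglongrightarrow> 0" using root tendsto_norm_zero by auto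
  have "(\<lambda>n. cmod (\<tau> - c n) ^ Suc n0) \<longlonglongrightarrow> 0"
    by (rule tendsto_sandwich[OF _ _ tendsto_const plim]) (auto intro!: always_eventually c(2) simp del: power_Suc)
  from tendsto_real_root[OF this, of "Suc n0"] have "(\<lambda>n. cmod (\<tau> - c n)) \<longlonglongrightarrow> 0"
    by (simp add: real_root_power_cancel del: power_Suc)
  then have "(\<lambda>n. \<tau> - c n) \<longlonglongrightarrow> 0" by (rule tendsto_norm_zero_cancel)
  then have clim: "c \<longlonglongrightarrow> \<tau>" using tendsto_diff[OF tendsto_const[of \<tau>], of "\<lambda>n. \<tau> - c n" 0] by simp
  have "\<exists>y\<in>Z. (\<forall>j\<in>J. g j y = x n j) \<and> w y = c n \<and> f y \<noteq> 0" for n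
    by (rule P(6)[OF x(1) c(1)])
  then obtain y where y: "\<And>n. y n \<in> Z" "\<And>n j. j \<in> J \<Longrightarrow> g j (y n) = x n j" "\<And>n. w (y n) = c n" "\<And>n. f (y n) \<noteq> 0"
    by metis
  define B where "B = Max (insert 0 ((\<lambda>j. cmod (x0 j) + 1) ` J))"
  obtain M where M: "\<And>y v. y \<in> Z \<Longrightarrow> (\<forall>j\<in>J. cmod (g j y) \<le> B) \<Longrightarrow> cmod (y v) \<le> M"
    using pr unfolding proper_on_def by blast
  have "cmod (y n v) \<le> M" for n v
  proof (rule M[OF y(1)], intro ballI)
    fix j assume j: "j \<in> J"
    have "cmod (x n j) \<le> cmod (x0 j) + cmod (x n j - x0 j)" by (metis add.commute diff_add_cancel norm_triangle_ineq)
    also have "\<dots> \<le> cmod (x0 j) + inverse (real (Suc n))" using x(2)[OF j, of n] by (intro add_mono) auto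
    also have "\<dots> \<le> cmod (x0 j) + 1" by (simp add: field_simps)
    also have "\<dots> \<le> B" unfolding B_def using j by (intro Max_ge) auto
    finally show "cmod (g j (y n)) \<le> B" using y(2)[OF j] by simp
  qed
  from fun_convergent_subseq[of y, OF this] obtain y' s where s: "strict_mono s" "\<And>v. (\<lambda>n. y (s n) v) \<longlonglongrightarrow> y' v" by blast
  have "y' \<in> Z" unfolding Z_def by (rule zcl_tendsto[OF y(1)[unfolded Z_def] s(2)])
  moreover have "g j y' = x0 j" if j: "j \<in> J" for j
  proof -
    have "(\<lambda>n. g j (y (s n))) \<longlonglongrightarrow> g j y'" by (rule pfun_tendsto[OF g s(2)])
    then have "(\<lambda>n. x (s n) j) \<longlonglongrightarrow> g j y'" using y(2)[OF j] by simp
    moreover have "(\<lambda>n. x (s n) j) \<longlonglongrightarrow> x0 j"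
      using LIMSEQ_subseq_LIMSEQ[OF xlim[OF j] s(1)] by (simp add: o_def)
    ultimately show ?thesis by (rule LIMSEQ_unique)
  qed
  ultimately have "y' \<in> Fb" by (simp add: Fb_def)
  moreover have "w y' = \<tau>"
  proof -
    have "(\<lambda>n. w (y (s n))) \<longlonglongrightarrow> w y'" by (rule pfun_tendsto[OF w s(2)])
    then have "(\<lambda>n. c (s n)) \<longlonglongrightarrow> w y'" using y(3) by simp
    moreover have "(\<lambda>n. c (s n)) \<longlonglongrightarrow> \<tau>"
      using LIMSEQ_subseq_LIMSEQ[OF clim s(1)] by (simp add: o_def)
    ultimately show ?thesis by (rule LIMSEQ_unique)
  qed
  ultimately have "y' = y0" using w1[of y'] w0 unfolding \<tau>_def by metis
  then have "\<forall>\<^sub>F n in sequentially. cmod (y (s n) v - y0 v) < \<epsilon>" for v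
    using tendstoD[OF s(2) \<epsilon>, of v] by (simp add: dist_norm)
  then have "\<forall>\<^sub>F n in sequentially. \<forall>v. cmod (y (s n) v - y0 v) < \<epsilon>" by (simp add: eventually_all_finite)
  then obtain n where "\<forall>v. cmod (y (s n) v - y0 v) < \<epsilon>" by (auto simp: eventually_sequentially)
  then show ?thesis using y(1,4)[of "s n"] by (auto simp: Z_def)
qed

text \<open>Setting all coordinates outside \<open>V\<close> to 0 turns the closure in the variables
  \<open>V\<close> into a full Zariski closure, to which \<open>irr_dense\<close> applies.\<close>

corollary irr_dense_vars:
  fixes A :: "('v::finite \<Rightarrow> complex) set"
  assumes A: "irr A" and f: "pfun V f" "\<not> van A f" and y0: "y0 \<in> zcl V A" and \<epsilon>: "\<epsilon> > 0"
  shows "\<exists>y\<in>zcl V A. f y \<noteq> 0 \<and> (\<forall>v\<in>V. cmod (y v - y0 v) < \<epsilon>)"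
proof -
  define r where "r y = (\<lambda>v. if v \<in> V then y v else 0)" for y :: "'v \<Rightarrow> complex"
  have pr: "pfun V (\<lambda>y. h (r y))" if "pfun UNIV h" for h
  proof (rule pfun_comp[OF that])
    show "pfun V (\<lambda>y. r y i)" for i
      by (cases "i \<in> V") (auto simp: r_def intro: pfun_var)
  qed
  have rr: "h (r y) = h y" if "pfun V h" for h y
    by (rule pfun_cong[OF that]) (simp add: r_def)
  have "irr (r ` A)" 
  proof (rule irr_image[OF A])
    show "pfun UNIV (\<lambda>y. r y i)" for i
      by (cases "i \<in> V") (auto simp: r_def intro: pfun_var)
  qed
  moreover have "pfun UNIV f" using f(1) by (rule pfun_mono) simp
  moreover have "\<not> van (r ` A) f" using f by (auto simp: van_def rr)
  moreover have "r y0 \<in> zcl UNIV (r ` A)"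
  proof (rule zclI)
    fix h assume h: "pfun UNIV h" "van (r ` A) h"
    then have "van A (\<lambda>y. h (r y))" by (auto simp: van_def)
    from zclD[OF y0 pr[OF h(1)] this] show "h (r y0) = 0" .
  qed
  ultimately obtain y where y: "y \<in> zcl UNIV (r ` A)" "f y \<noteq> 0" "\<And>v. cmod (y v - r y0 v) < \<epsilon>"
    using irr_dense[OF _ _ _ _ \<epsilon>] by blast
  have "y \<in> zcl V A"
  proof (rule zclI)
    fix h assume h: "pfun V h" "van A h"
    then have "van (r ` A) h" by (auto simp: van_def rr)
    then show "h y = 0" using h(1) by (intro zclD[OF y(1)]) (auto intro: pfun_mono)
  qed
  moreover have "cmod (y v - y0 v) < \<epsilon>" if "v \<in> V" for v using y(3)[of v] that by (simp add: r_def)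
  ultimately show ?thesis using y(2) by blast
qed

lemma zcl_Union:
  assumes "finite \<A>" "z \<in> zcl V (\<Union>\<A>)"
  shows "\<exists>A\<in>\<A>. z \<in> zcl V A"
proof (rule ccontr)
  assume "\<not> ?thesis"
  then have "\<forall>A\<in>\<A>. \<exists>f. pfun V f \<and> van A f \<and> f z \<noteq> 0" by (auto simp: zcl_def)
  from bchoice[OF this] obtain f where f: "\<forall>A\<in>\<A>. pfun V (f A) \<and> van A (f A) \<and> f A z \<noteq> 0" by (elim exE)
  define h where "h x = (\<Prod>A\<in>\<A>. f A x)" for x
  have "pfun V h" unfolding h_def[abs_def] using f by (intro pfun_prod) auto
  moreover have "van (\<Union>\<A>) h"
  proof (rule vanI)
    fix x assume "x \<in> \<Union>\<A>"
    then obtain A where A: "A \<in> \<A>" "x \<in> A" by blast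
    then have "f A x = 0" using f by (auto simp: van_def)
    then show "h x = 0" unfolding h_def using A(1) assms(1) by (intro prod_zero) auto
  qed
  ultimately have "h z = 0" using assms(2) by (auto dest: zclD)
  then show False using f assms(1) by (auto simp: h_def)
qed

text \<open>One irreducible piece \<open>A\<close> of \<open>S\<close> has \<open>z0\<close> in its
  projected closure. Points of that closure near \<open>z0\<close> can be chosen generic, and
  generic points lift with an inequation \<open>g\<close> preserved, so the lift lies in
  \<open>S\<close> although it is only known to lie in the closure of \<open>A\<close>.\<close>

theorem closure_locally_closed:
  fixes S :: "('v::finite \<Rightarrow> complex) set"
  assumes F: "\<And>f. f \<in> F \<Longrightarrow> pfun UNIV f" and G: "\<And>g. g \<in> G \<Longrightarrow> pfun UNIV g"
    and S: "S = {x. (\<forall>f\<in>F. f x = 0) \<and> (\<exists>g\<in>G. g x \<noteq> 0)}"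
    and z0: "z0 \<in> zcl V S" and \<epsilon>: "\<epsilon> > 0"
  shows "\<exists>x\<in>S. \<forall>i\<in>V. cmod (x i - z0 i) < \<epsilon>"
proof -
  from irr_decomposition[of S] obtain \<A> where \<A>: "finite \<A>" "S = \<Union>\<A>" "\<And>A. A \<in> \<A> \<Longrightarrow> irr A" by blast
  from zcl_Union[OF \<A>(1), of z0 V] z0 obtain A where A: "A \<in> \<A>" "z0 \<in> zcl V A" by (auto simp flip: \<A>(2))
  have AS: "A \<subseteq> S" "irr A" using A \<A> by auto
  obtain a where "a \<in> A" using AS(2) by (auto simp: irr_def)
  then obtain g where g: "g \<in> G" "g a \<noteq> 0" using AS(1) S by auto
  then have ng: "\<not> van A g" using \<open>a \<in> A\<close> by (auto simp: van_def)
  have T: "finite (- V)" "- V \<inter> V = {}" "V \<union> - V = UNIV" by auto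
  from extend[OF AS(2) T(1,2), unfolded T(3), OF G[OF g(1)] ng] obtain L where L: "pfun V L" "\<not> van A L"
    "\<And>z. z \<in> zcl V A \<Longrightarrow> L z \<noteq> 0 \<Longrightarrow> \<exists>z'. (\<forall>i\<in>V. z' i = z i) \<and> z' \<in> zcl UNIV A \<and> g z' \<noteq> 0"
    by (metis (no_types, lifting) ComplD)
  from irr_dense_vars[OF AS(2) L(1,2) A(2) \<epsilon>] obtain z where z: "z \<in> zcl V A" "L z \<noteq> 0"
    "\<And>v. v \<in> V \<Longrightarrow> cmod (z v - z0 v) < \<epsilon>" by blast
  from L(3)[OF z(1,2)] obtain z' where z': "\<And>i. i \<in> V \<Longrightarrow> z' i = z i" "z' \<in> zcl UNIV A" "g z' \<noteq> 0" by blast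
  have "f z' = 0" if f: "f \<in> F" for f
    using AS(1) S f by (intro zclD[OF z'(2) F[OF f]]) (auto simp: van_def)
  then have "z' \<in> S" using z'(3) g(1) S by auto
  moreover have "cmod (z' i - z0 i) < \<epsilon>" if "i \<in> V" for i using z(3)[OF that] z'(1)[OF that] by simp
  ultimately show ?thesis by blast
qed

section \<open>Dimension\<close>

definition indep_on :: "'v set \<Rightarrow> ('v \<Rightarrow> complex) set \<Rightarrow> bool" where
  "indep_on I A \<longleftrightarrow> (\<forall>f. pfun I f \<longrightarrow> van A f \<longrightarrow> f = 0)"

lemma indep_onD: "indep_on I A \<Longrightarrow> pfun I f \<Longrightarrow> van A f \<Longrightarrow> f = 0"
  by (simp add: indep_on_def)

lemma indep_on_mono: "indep_on I A \<Longrightarrow> A \<subseteq> B \<Longrightarrow> indep_on I B"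
  unfolding indep_on_def van_def by blast

lemma indep_on_zcl: "indep_on I (zcl UNIV A) \<longleftrightarrow> indep_on I A"
proof -
  have "van (zcl UNIV A) f \<longleftrightarrow> van A f" if "pfun I f" for f
    using pfun_mono[OF that subset_UNIV] by (rule van_zcl)
  then show ?thesis by (auto simp: indep_on_def)
qed

lemma indep_on_empty: "A \<noteq> {} \<Longrightarrow> indep_on {} A"
proof -
  assume A: "A \<noteq> {}"
  show ?thesis unfolding indep_on_def
  proof (intro allI impI)
    fix f assume f: "pfun {} f" "van A f"
    from pfun_empty[OF f(1)] obtain c where c: "f = (\<lambda>x. c)" by (elim exE)
    with f(2) A show "f = 0" by (auto simp: van_def fun_eq_iff)
  qed
qed

lemma zcl_indep: "indep_on I A \<Longrightarrow> zcl I A = UNIV"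
  by (auto simp: indep_on_def zcl_def)

lemma indep_on_insert:
  assumes "indep_on I A" "\<not> alg_over A I t"
  shows "indep_on (insert t I) A"
  unfolding indep_on_def
proof (intro allI impI)
  fix f assume f: "pfun (insert t I) f" "van A f"
  from pfun_ev_ex[OF f(1) subset_refl] obtain P where P: "pcoef I P" "f = ev t P" by (elim exE conjE)
  have "van A (coeff P i)" for i using not_van_ev[OF assms(2) P(1)] f(2) P(2) by blast
  then have "coeff P i = 0" for i using P(1) by (intro indep_onD[OF assms(1)]) (auto simp: pcoef_def)
  then have "P = 0" by (intro poly_eqI) simp
  then show "f = 0" using P by simp
qed

text \<open>A proper closed subset has smaller transcendence degree: if all other coordinates were
  algebraic over \<open>I\<close> on \<open>A\<close>, elimination would turn \<open>f\<close> into
  a nonzero polynomial in \<open>I\<close> vanishing on \<open>W\<close>.\<close>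

lemma indep_on_extend:
  fixes A :: "('v::finite \<Rightarrow> complex) set"
  assumes A: "irr A" and WA: "W \<subseteq> A" and f: "pfun UNIV f" "van W f" "\<not> van A f" and I: "indep_on I W"
  shows "\<exists>t. t \<notin> I \<and> indep_on (insert t I) A"
proof (rule ccontr)
  assume n: "\<not> ?thesis"
  have IA: "indep_on I A" by (rule indep_on_mono[OF I WA])
  have alg: "alg_over A I t" if "t \<in> - I" for t using n that indep_on_insert[OF IA] by auto
  have T: "finite (- I)" "- I \<inter> I = {}" "I \<union> - I = UNIV" by auto
  from eliminate[OF A T(1,2) alg, unfolded T(3), OF _ f(1,3)] obtain b S where
    b: "pfun I b" "\<not> van A b" "van A (b - S * f)" by blast
  have "van W b" using b(3) f(2) WA unfolding van_def by fastforce
  then have "b = 0" by (rule indep_onD[OF I b(1)])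
  with b(2) show False by (simp add: van_def)
qed

lemma pfun_common_nonzero:
  assumes "pfun V f" "pfun W g" "f a \<noteq> 0" "g b \<noteq> 0"
  obtains z where "f z \<noteq> 0" "g z \<noteq> 0"
proof -
  define l where "l s = (\<lambda>i. a i + s * (b i - a i))" for s
  have "\<exists>s. f (l s) \<noteq> 0 \<and> g (l s) \<noteq> 0" unfolding l_def by (rule pfun_prod_nonzero[of V f W g a b, OF assms])
  then obtain s where s: "f (l s) \<noteq> 0 \<and> g (l s) \<noteq> 0" by (rule exE)
  show thesis by (rule that[of "l s"]) (use s in auto)
qed

lemma pfun_family_nonzero:
  assumes "finite \<A>" "\<And>W. W \<in> \<A> \<Longrightarrow> pfun V (Q W) \<and> Q W \<noteq> 0"
  shows "\<exists>h x. pfun V h \<and> h x \<noteq> 0 \<and> (\<forall>W\<in>\<A>. \<forall>y. Q W y = 0 \<longrightarrow> h y = 0)"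
  using assms
proof (induction \<A>)
  case empty
  show ?case by (rule exI[of _ "\<lambda>_. 1"]) auto
next
  case (insert W \<A>)
  then obtain h x where h: "pfun V h" "h x \<noteq> 0" "\<And>W y. W \<in> \<A> \<Longrightarrow> Q W y = 0 \<Longrightarrow> h y = 0" by blast
  from insert.prems[of W] obtain w where w: "pfun V (Q W)" "Q W w \<noteq> 0" by (auto simp: fun_eq_iff)
  from pfun_common_nonzero[of V h V "Q W" x w, OF h(1) w(1) h(2) w(2)] obtain z where "h z \<noteq> 0" "Q W z \<noteq> 0" .
  then have "h z * Q W z \<noteq> 0" by simp
  moreover have "pfun V (\<lambda>y. h y * Q W y)" by (rule pfun_mult[OF h(1) w(1)])
  moreover have "\<forall>W'\<in>insert W \<A>. \<forall>y. Q W' y = 0 \<longrightarrow> h y * Q W y = 0" using h(3) by auto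
  ultimately show ?case by (intro exI[of _ "\<lambda>y. h y * Q W y"] exI[of _ z]) simp
qed

text \<open>A generic hyperplane \<open>y i = c\<close> meets \<open>A\<close> in a set still
  dominating the remaining coordinates of \<open>I\<close>; one of its finitely many irreducible
  pieces must then dominate them already.\<close>

lemma indep_on_slice:
  fixes A :: "('v::finite \<Rightarrow> complex) set"
  assumes A: "irr A" "zcl UNIV A = A" and I: "indep_on I A" and i: "i \<in> I"
  shows "\<exists>W. irr W \<and> zcl UNIV W = W \<and> W \<subset> A \<and> indep_on (I - {i}) W"
proof -
  have T: "finite (- I)" "- I \<inter> I = {}" "I \<union> - I = UNIV" by auto
  have n1: "\<not> van A (\<lambda>_. 1)" using A by (auto simp: irr_def van_def)
  from extend[OF A(1) T(1,2) pfun_1(2) n1] obtain L where L: "pfun I L" "\<not> van A L"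
    "\<And>z. L z \<noteq> 0 \<Longrightarrow> \<exists>z'. (\<forall>j\<in>I. z' j = z j) \<and> z' \<in> A"
    unfolding T(3) zcl_indep[OF I] A(2) by (metis (no_types, lifting) ComplD UNIV_I)
  obtain a where a: "L a \<noteq> 0" using L(2) by (auto simp: van_def)
  \<comment> \<open>With this value \<open>L\<close> does not vanish identically on the hyperplane,
    so generic choices of the remaining coordinates lift to points of the slice.\<close>
  define c where "c = a i"
  from irr_decomposition[of "{y\<in>A. y i = c}"] obtain \<A> where
    \<A>': "finite \<A>" "{y\<in>A. y i = c} = \<Union>\<A>" "\<forall>W\<in>\<A>. irr W" by (elim exE conjE)
  then have \<A>: "finite \<A>" "{y\<in>A. y i = c} = \<Union>\<A>" "\<And>W. W \<in> \<A> \<Longrightarrow> irr W" by auto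
  have "\<exists>W\<in>\<A>. indep_on (I - {i}) W"
  proof (rule ccontr)
    assume "\<not> ?thesis"
    then have "\<forall>W\<in>\<A>. \<exists>Q. pfun (I - {i}) Q \<and> van W Q \<and> Q \<noteq> 0" unfolding indep_on_def by blast
    from bchoice[OF this] obtain Q where Q: "\<forall>W\<in>\<A>. pfun (I - {i}) (Q W) \<and> van W (Q W) \<and> Q W \<noteq> 0" by (elim exE)
    then obtain h x where h: "pfun (I - {i}) h" "h x \<noteq> 0" "\<And>W y. W \<in> \<A> \<Longrightarrow> Q W y = 0 \<Longrightarrow> h y = 0"
      using pfun_family_nonzero[OF \<A>(1), of "I - {i}" Q] by blast
    define L' where "L' y = L (y(i := c))" for y
    have L': "pfun (I - {i}) L'" unfolding L'_def
    proof (rule pfun_comp[OF L(1)])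
      show "pfun (I - {i}) (\<lambda>y. (y(i := c)) j)" if "j \<in> I" for j
        using that by (cases "j = i") (auto intro: pfun_var pfun_const)
    qed
    have "L' a \<noteq> 0" using a by (simp add: L'_def c_def)
    from pfun_common_nonzero[of "I - {i}" h "I - {i}" L' x a, OF h(1) L' h(2) this] obtain z where z: "h z \<noteq> 0" "L' z \<noteq> 0" .
    from L(3)[of "z(i := c)"] z(2) obtain y where y: "\<And>j. j \<in> I \<Longrightarrow> y j = (z(i := c)) j" "y \<in> A"
      by (auto simp: L'_def)
    have "y i = c" using y(1)[OF i] by simp
    with y(2) \<A>(2) obtain W where W: "W \<in> \<A>" "y \<in> W" by blast
    then have "Q W y = 0" using Q by (auto simp: van_def)
    then have "h y = 0" by (rule h(3)[OF W(1)])
    moreover have "h y = h z" by (rule pfun_cong[OF h(1)]) (use y(1) in auto)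
    ultimately show False using z(1) by simp
  qed
  then obtain W where W: "W \<in> \<A>" "indep_on (I - {i}) W" by blast
  have WA: "W \<subseteq> A" using W(1) \<A>(2) by blast
  then have sub: "zcl UNIV W \<subseteq> A" using zcl_mono[of W A UNIV] A(2) by simp
  have pf: "pfun I (\<lambda>y. y i - c)" using i by (intro pfun_diff pfun_var pfun_const)
  have "van W (\<lambda>y. y i - c)" using W(1) \<A>(2) by (auto simp: van_def)
  then have v: "van (zcl UNIV W) (\<lambda>y. y i - c)" using pfun_mono[OF pf subset_UNIV] by (simp add: van_zcl)
  have "zcl UNIV W \<noteq> A"
  proof
    assume "zcl UNIV W = A"
    with v have "(\<lambda>y :: 'v \<Rightarrow> complex. y i - c) = 0" by (intro indep_onD[OF I pf]) simp
    from fun_cong[OF this, of "\<lambda>_. c + 1"] show False by simp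
  qed
  with sub W \<A>(3) show ?thesis
    by (intro exI[of _ "zcl UNIV W"]) (auto simp: indep_on_zcl intro: irr_zcl)
qed

text \<open>Each strict inclusion yields one more independent coordinate. Together with the converse
  \<open>indep_chain\<close>, which cuts by hyperplanes, this identifies Krull dimension with
  transcendence degree.\<close>

lemma chain_indep:
  fixes Z :: "nat \<Rightarrow> ('v::finite \<Rightarrow> complex) set"
  assumes "\<And>i. i \<le> n \<Longrightarrow> irr (Z i) \<and> zcl UNIV (Z i) = Z i" "\<And>i. i < n \<Longrightarrow> Z i \<subset> Z (Suc i)"
  shows "\<exists>I. card I = n \<and> indep_on I (Z n)"
  using assms
proof (induction n)
  case 0
  then show ?case by (intro exI[of _ "{}"]) (auto intro!: indep_on_empty simp: irr_def)
next
  case (Suc n)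
  then obtain I where I: "card I = n" "indep_on I (Z n)" by auto
  obtain z where z: "z \<in> Z (Suc n)" "z \<notin> Z n" using Suc.prems(2)[of n] by auto
  have "z \<notin> zcl UNIV (Z n)" using z Suc.prems(1)[of n] by simp
  then obtain f where f: "pfun UNIV f" "van (Z n) f" "f z \<noteq> 0" unfolding zcl_def by blast
  have "\<not> van (Z (Suc n)) f" using f z by (auto simp: van_def)
  from indep_on_extend[OF _ _ f(1,2) this I(2)] Suc.prems(1)[of "Suc n"] Suc.prems(2)[of n]
  obtain t where "t \<notin> I" "indep_on (insert t I) (Z (Suc n))" by blast
  then show ?case using I(1) by (intro exI[of _ "insert t I"]) auto
qed

lemma indep_chain:
  fixes A :: "('v::finite \<Rightarrow> complex) set"
  assumes "irr A" "zcl UNIV A = A" "indep_on I A"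
  shows "\<exists>Z. (\<forall>i\<le>card I. irr (Z i) \<and> zcl UNIV (Z i) = Z i) \<and> (\<forall>i<card I. Z i \<subset> Z (Suc i)) \<and> Z (card I) = A"
proof -
  have "card I = n \<Longrightarrow> irr A \<Longrightarrow> zcl UNIV A = A \<Longrightarrow> indep_on I A \<Longrightarrow>
      \<exists>Z. (\<forall>i\<le>n. irr (Z i) \<and> zcl UNIV (Z i) = Z i) \<and> (\<forall>i<n. Z i \<subset> Z (Suc i)) \<and> Z n = A" for n
  proof (induction n arbitrary: I A)
    case 0
    then show ?case by (intro exI[of _ "\<lambda>_. A"]) auto
  next
    case (Suc n)
    then obtain i where i: "i \<in> I" by fastforce
    from indep_on_slice[OF Suc.prems(2,3,4) i] obtain W where
      W: "irr W" "zcl UNIV W = W" "W \<subset> A" "indep_on (I - {i}) W" by blast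
    have "card (I - {i}) = n" using Suc.prems(1) i by simp
    from Suc.IH[OF this W(1,2,4)] obtain Z where Z: "\<And>i. i \<le> n \<Longrightarrow> irr (Z i) \<and> zcl UNIV (Z i) = Z i"
      "\<And>i. i < n \<Longrightarrow> Z i \<subset> Z (Suc i)" "Z n = W" by blast
    define Z' where "Z' = Z(Suc n := A)"
    have "irr (Z' i) \<and> zcl UNIV (Z' i) = Z' i" if "i \<le> Suc n" for i
      using that Z(1)[of i] Suc.prems by (cases "i = Suc n") (auto simp: Z'_def)
    moreover have "Z' i \<subset> Z' (Suc i)" if "i < Suc n" for i
      using that Z(2)[of i] Z(3) W(3) by (cases "i = n") (auto simp: Z'_def)
    ultimately show ?case by (intro exI[of _ Z']) (auto simp: Z'_def)
  qed
  from this[OF refl assms] show ?thesis .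
qed

section \<open>Directional derivatives and generic smoothness\<close>

text \<open>Taken along a complex line, where the restriction of a polynomial function is a
  univariate polynomial and so differentiable.\<close>

definition dird :: "(('v \<Rightarrow> complex) \<Rightarrow> complex) \<Rightarrow> ('v \<Rightarrow> complex) \<Rightarrow> ('v \<Rightarrow> complex) \<Rightarrow> complex" where
  "dird f y v = deriv (\<lambda>s. f (\<lambda>i. y i + s * v i)) 0"

lemma has_dird:
  assumes "pfun V f"
  shows "((\<lambda>s. f (\<lambda>i. y i + s * v i)) has_field_derivative dird f y v) (at 0)"
proof -
  from pfun_line[OF assms, of y v] obtain q where q: "\<forall>s. f (\<lambda>i. y i + s * v i) = poly q s" by (elim exE)
  then have "(\<lambda>s. f (\<lambda>i. y i + s * v i)) = poly q" by auto
  moreover have "(poly q has_field_derivative deriv (poly q) 0) (at 0)"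
    using poly_DERIV[of q 0] DERIV_imp_deriv by fastforce
  ultimately show ?thesis by (simp add: dird_def)
qed

lemma dird_const [simp]: "dird (\<lambda>x. c) y v = 0"
  by (simp add: dird_def)

lemma dird_var [simp]: "dird (\<lambda>x. x i) y v = v i"
  unfolding dird_def by (rule DERIV_imp_deriv) (auto intro!: derivative_eq_intros)

lemma dird_add: "pfun V f \<Longrightarrow> pfun W g \<Longrightarrow> dird (\<lambda>x. f x + g x) y v = dird f y v + dird g y v"
  unfolding dird_def[of "\<lambda>x. f x + g x"]
  by (rule DERIV_imp_deriv) (intro DERIV_add has_dird; assumption)

lemma dird_mult: "pfun V f \<Longrightarrow> pfun W g \<Longrightarrow> dird (\<lambda>x. f x * g x) y v = dird f y v * g y + f y * dird g y v"
  unfolding dird_def[of "\<lambda>x. f x * g x"]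
  by (rule DERIV_imp_deriv) (use DERIV_mult[OF has_dird[of V f y v] has_dird[of W g y v]] in \<open>simp add: mult.commute\<close>)

lemma dird_linear:
  "pfun V f \<Longrightarrow> dird f y (\<lambda>i. a * v i + w i) = a * dird f y v + dird f y w"
proof (induction rule: pfun.induct)
  case (pfun_add f g)
  then show ?case by (simp add: dird_add[OF pfun_add.hyps] algebra_simps)
next
  case (pfun_mult f g)
  then show ?case by (simp add: dird_mult[OF pfun_mult.hyps] algebra_simps)
qed auto

lemma dird_cong:
  assumes "pfun V f" "\<And>i. i \<in> V \<Longrightarrow> y i = y' i" "\<And>i. i \<in> V \<Longrightarrow> v i = v' i"
  shows "dird f y v = dird f y' v'"
proof -
  have "(\<lambda>s. f (\<lambda>i. y i + s * v i)) = (\<lambda>s. f (\<lambda>i. y' i + s * v' i))"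
    by (intro ext pfun_cong[OF assms(1)]) (use assms in auto)
  then show ?thesis by (simp add: dird_def)
qed

lemma dird_sum:
  assumes "\<And>i. i \<in> S \<Longrightarrow> pfun V (F i)"
  shows "dird (\<lambda>x. \<Sum>i\<in>S. F i x) y v = (\<Sum>i\<in>S. dird (F i) y v)"
  using assms
proof (induction S rule: infinite_finite_induct)
  case (insert i S)
  have "pfun V (F i)" "pfun V (\<lambda>x. \<Sum>i\<in>S. F i x)" using insert.prems by (auto intro: pfun_sum')
  from dird_add[OF this] insert show ?case by simp
qed auto

lemma pfun_dird:
  "pfun V f \<Longrightarrow> pfun (Inl ` V \<union> Inr ` V) (\<lambda>z. dird f (\<lambda>i. z (Inl i)) (\<lambda>i. z (Inr i)))"
proof (induction rule: pfun.induct)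
  case (pfun_add f g)
  then show ?case by (simp add: dird_add[OF pfun_add.hyps] pfun.pfun_add)
next
  case (pfun_mult f g)
  have "pfun (Inl ` V \<union> Inr ` V) (\<lambda>z. h (\<lambda>i. z (Inl i)))" if "pfun V h" for h
    by (rule pfun_comp[OF that]) (auto intro: pfun_var)
  with pfun_mult show ?case by (simp add: dird_mult[OF pfun_mult.hyps] pfun.pfun_add pfun.pfun_mult)
qed (auto intro: pfun.intros)

definition fderiv :: "(('v \<Rightarrow> complex) \<Rightarrow> complex) poly \<Rightarrow> (('v \<Rightarrow> complex) \<Rightarrow> complex) poly" where
  "fderiv P = (\<Sum>i<degree P. monom (\<lambda>x. of_nat (Suc i) * coeff P (Suc i) x) i)"

lemma coeff_fderiv: "coeff (fderiv P) i = (if i < degree P then (\<lambda>x. of_nat (Suc i) * coeff P (Suc i) x) else 0)"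
  by (auto simp: fderiv_def coeff_sum)

lemma pev_fderiv: "pev y (fderiv P) = pderiv (pev y P)"
  by (rule poly_eqI) (auto simp: coeff_fderiv coeff_pderiv coeff_eq_0)

lemma pcoef_fderiv: "pcoef V P \<Longrightarrow> pcoef V (fderiv P)"
  unfolding pcoef_def coeff_fderiv
proof
  fix i assume P: "\<forall>i. pfun V (coeff P i)"
  have "pfun V (\<lambda>x. of_nat (Suc i) * coeff P (Suc i) x)"
    by (rule pfun_mult[OF pfun_const]) (use P in blast)
  then show "pfun V (if i < degree P then (\<lambda>x. of_nat (Suc i) * coeff P (Suc i) x) else 0)"
    by (cases "i < degree P") (simp_all only: if_True if_False pfun_0)
qed

text \<open>Linearity in the direction splits off the component \<open>v t\<close>. Tangency to the
  relation \<open>P\<close> thus becomes a linear equation for \<open>v t\<close>, with the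
  derivative of \<open>P\<close> in \<open>t\<close> as coefficient.\<close>

lemma dird_ev:
  assumes P: "pcoef V P" and t: "t \<notin> V"
  shows "dird (ev t P) y v = dird (ev t P) y (v(t := 0)) + v t * ev t (fderiv P) y"
proof -
  define e where "e = (\<lambda>i. if i = t then 1 else 0 :: complex)"
  have "ev t P (\<lambda>i. y i + s * e i) = poly (pev y P) (y t + s)" for s
  proof -
    have "(\<lambda>i. y i + s * e i) = y(t := y t + s)" by (auto simp: e_def)
    then show ?thesis by (simp only: ev_upd[OF P t])
  qed
  then have "dird (ev t P) y e = deriv (\<lambda>s. poly (pev y P) (y t + s)) 0" by (simp add: dird_def)
  also have "\<dots> = poly (pderiv (pev y P)) (y t)"
    by (rule DERIV_imp_deriv) (auto intro!: derivative_eq_intros)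
  also have "\<dots> = ev t (fderiv P) y" by (simp add: ev_pev pev_fderiv)
  finally have e: "dird (ev t P) y e = ev t (fderiv P) y" .
  have "v = (\<lambda>i. v t * e i + (v(t := 0)) i)" by (auto simp: e_def)
  then have "dird (ev t P) y v = v t * dird (ev t P) y e + dird (ev t P) y (v(t := 0))"
    using dird_linear[OF pfun_ev[OF P, of t], of y "v t" e "v(t := 0)"] by metis
  then show ?thesis by (simp add: e)
qed

definition tang :: "('v \<Rightarrow> complex) set \<Rightarrow> 'v set \<Rightarrow> ('v \<Rightarrow> complex) \<Rightarrow> ('v \<Rightarrow> complex) \<Rightarrow> bool" where
  "tang A V y v \<longleftrightarrow> (\<forall>f. pfun V f \<longrightarrow> van A f \<longrightarrow> dird f y v = 0)"

text \<open>Generic smoothness: over a transcendence basis the minimal relations are separable, so at generic points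
  a tangent vector is freely and uniquely determined by its coordinates in the basis.\<close>

lemma generic_tangent:
  assumes A: "irr A" and I: "indep_on I A" and alg: "\<And>t. t \<notin> I \<Longrightarrow> alg_over A I t"
    and T: "finite T" "T \<inter> I = {}"
  shows "\<exists>L. pfun (I \<union> T) L \<and> \<not> van A L \<and> (\<forall>y\<in>zcl (I \<union> T) A. L y \<noteq> 0 \<longrightarrow>
     (\<forall>a. \<exists>v. tang A (I \<union> T) y v \<and> (\<forall>i\<in>I. v i = a i) \<and>
        (\<forall>v'. tang A (I \<union> T) y v' \<longrightarrow> (\<forall>i\<in>I. v' i = a i) \<longrightarrow> (\<forall>i\<in>I \<union> T. v' i = v i))))"
  using T
proof (induction T)
  case empty
  have "tang A I y v" for y v
    unfolding tang_def
  proof (intro allI impI)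
    fix f assume "pfun I f" "van A f"
    then have "f = (\<lambda>x. 0)" using indep_onD[OF I] by (simp add: func_zero)
    then show "dird f y v = 0" by simp
  qed
  moreover have "\<not> van A (\<lambda>_. 1)" using A by (auto simp: irr_def van_def)
  ultimately show ?case by (intro exI[of _ "\<lambda>_. 1"]) auto
next
  case (insert t T)
  define V where "V = I \<union> T"
  have t: "t \<notin> V" "t \<notin> I" using insert by (auto simp: V_def)
  have VT: "I \<union> insert t T = insert t V" by (auto simp: V_def)
  from insert.IH[folded V_def] insert.prems obtain L where L: "pfun V L" "\<not> van A L"
    "\<And>y a. y \<in> zcl V A \<Longrightarrow> L y \<noteq> 0 \<Longrightarrow> \<exists>v. tang A V y v \<and> (\<forall>i\<in>I. v i = a i) \<and>
        (\<forall>v'. tang A V y v' \<longrightarrow> (\<forall>i\<in>I. v' i = a i) \<longrightarrow> (\<forall>i\<in>V. v' i = v i))" by blast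
  have "alg_over A V t" by (rule alg_over_mono[OF alg]) (use t in \<open>auto simp: V_def\<close>)
  from minpol_exists[OF this] obtain P where P: "minpol A V t P" by (elim exE)
  then have P': "pcoef V P" "van A (ev t P)" "\<not> van A (lead_coeff P)"
    and min: "\<And>R i. pcoef V R \<Longrightarrow> van A (ev t R) \<Longrightarrow> (\<forall>i\<ge>degree P. coeff R i = 0) \<Longrightarrow> van A (coeff R i)"
    by (auto simp: minpol_def)
  define l where "l = lead_coeff P"
  define D where "D = ev t (fderiv P)"
  have l: "pfun V l" "pfun (insert t V) l" using P'(1) by (auto simp: l_def pcoef_def intro: pfun_mono)
  have D: "pfun (insert t V) D" unfolding D_def by (rule pfun_ev[OF pcoef_fderiv[OF P'(1)]])
  \<comment> \<open>Separability in characteristic 0: the derivative has smaller degree than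
    \<open>P\<close>, and its top coefficient is a nonzero integer times the leading
    coefficient.\<close>
  have nD: "\<not> van A D"
  proof
    assume "van A D"
    then have "van A (coeff (fderiv P) (degree P - 1))"
      unfolding D_def by (intro min[OF pcoef_fderiv[OF P'(1)]]) (auto simp: coeff_fderiv)
    then have "van A (lead_coeff P)" using minpol_degree[OF P] by (auto simp: coeff_fderiv van_def simp del: of_nat_Suc)
    with P'(3) show False by simp
  qed
  have L': "pfun (insert t V) L" using L(1) by (rule pfun_mono) auto
  define L1 where "L1 = L * (l * D)"
  have pL1: "pfun (insert t V) L1" unfolding L1_def by (intro pfun_times L' l D)
  have nL1: "\<not> van A L1"
    unfolding L1_def using irrD[OF A L' pfun_times[OF l(2) D]] irrD[OF A l(2) D] L(2) P'(3) nD by (auto simp: l_def)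
  show ?case unfolding VT
  proof (intro exI[of _ L1] conjI ballI impI allI pL1 nL1)
    fix y a assume y: "y \<in> zcl (insert t V) A" "L1 y \<noteq> 0"
    have nz: "L y \<noteq> 0" "l y \<noteq> 0" "D y \<noteq> 0" using y(2) by (auto simp: L1_def)
    have yV: "y \<in> zcl V A" using y(1) zcl_vars_mono[of V "insert t V" A] by auto
    from L(3)[OF this nz(1), of a] obtain v where v: "tang A V y v" "\<forall>i\<in>I. v i = a i"
      "\<And>v'. tang A V y v' \<Longrightarrow> (\<forall>i\<in>I. v' i = a i) \<Longrightarrow> (\<forall>i\<in>V. v' i = v i)" by blast
    \<comment> \<open>The new component is the solution of the linear equation expressing tangency
      to \<open>P\<close>.\<close>
    define v1 where "v1 = v(t := - dird (ev t P) y (v(t := 0)) / D y)"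
    have evP0: "ev t P y = 0" by (rule zclD[OF y(1) pfun_ev[OF P'(1)] P'(2)])
    have dP: "dird (ev t P) y v1 = 0"
    proof -
      have "v1(t := 0) = v(t := 0)" "v1 t = - dird (ev t P) y (v(t := 0)) / D y" by (auto simp: v1_def)
      with dird_ev[OF P'(1) t(1), of y v1, folded D_def] show ?thesis using nz(3) by simp
    qed
    \<comment> \<open>Up to a power of \<open>l\<close>, any \<open>f\<close> in the ideal is a
      multiple of \<open>P\<close> plus a remainder whose coefficients are relations in
      \<open>V\<close>; \<open>v\<close> is tangent to those by induction.\<close>
    have "tang A (insert t V) y v1" unfolding tang_def
    proof (intro allI impI)
      fix f assume f: "pfun (insert t V) f" "van A f"
      from pfun_ev_ex[OF f(1) subset_refl] obtain F where F: "pcoef V F" "f = ev t F" by (elim exE conjE)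
      from pseudo_division[OF P'(1) F(1)] obtain N S R where *: "pcoef V S" "pcoef V R"
        "smult (l ^ N) F = S * P + R" "\<forall>i\<ge>degree P. coeff R i = 0" unfolding l_def by (elim exE conjE)
      have eq: "l x ^ N * f x = ev t S x * ev t P x + ev t R x" for x
        using arg_cong[OF *(3), of "\<lambda>p. ev t p x"] by (simp add: F power_fun_apply)
      have "van A (ev t R)"
      proof (rule vanI)
        fix x assume "x \<in> A"
        then show "ev t R x = 0" using eq[of x] f(2) P'(2) by (simp add: van_def)
      qed
      then have vR: "van A (coeff R i)" for i by (rule min[OF *(2) _ *(4)])
      have pR: "pfun V (coeff R i)" for i using *(2) by (simp add: pcoef_def)
      have "dird (ev t R) y v1 = (\<Sum>i\<le>degree R. dird (\<lambda>x. coeff R i x * x t ^ i) y v1)"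
        unfolding ev_altdef[abs_def]
        by (rule dird_sum[where V = "insert t V"], intro pfun_mult[OF pfun_mono[OF pR]] pfun_pow pfun_var) auto
      also have "\<dots> = 0"
      proof (intro sum.neutral ballI)
        fix i
        have "dird (coeff R i) y v1 = dird (coeff R i) y v" by (rule dird_cong[OF pR]) (use t in \<open>auto simp: v1_def\<close>)
        also have "\<dots> = 0" using v(1) pR vR by (simp add: tang_def)
        finally have "dird (coeff R i) y v1 = 0" .
        moreover have "coeff R i y = 0" by (rule zclD[OF yV pR vR])
        moreover have "pfun UNIV (\<lambda>x. x t ^ i)" by (intro pfun_pow pfun_var) simp
        ultimately show "dird (\<lambda>x. coeff R i x * x t ^ i) y v1 = 0" by (simp add: dird_mult[OF pR])
      qed
      finally have dR: "dird (ev t R) y v1 = 0" .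
      have fy: "f y = 0" by (rule zclD[OF y(1) f])
      have pl: "pfun V (\<lambda>x. l x ^ N)" by (rule pfun_pow[OF l(1)])
      have "dird (\<lambda>x. l x ^ N * f x) y v1 = l y ^ N * dird f y v1"
        by (simp add: dird_mult[OF pl f(1)] fy)
      moreover have "dird (\<lambda>x. ev t S x * ev t P x + ev t R x) y v1 = 0"
        using dird_add[OF pfun_mult[OF pfun_ev[OF *(1), of t] pfun_ev[OF P'(1), of t]] pfun_ev[OF *(2), of t], where y = y and v = v1]
          dird_mult[OF pfun_ev[OF *(1), of t] pfun_ev[OF P'(1), of t], where y = y and v = v1] evP0 dP dR by simp
      ultimately show "dird f y v1 = 0" using nz(2) eq by simp
    qed
    moreover have "\<forall>i\<in>I. v1 i = a i" using v(2) t(2) by (auto simp: v1_def)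
    moreover have "\<forall>i\<in>insert t V. v' i = v1 i" if v': "tang A (insert t V) y v'" "\<forall>i\<in>I. v' i = a i" for v'
    proof -
      have "tang A V y v'" unfolding tang_def
      proof (intro allI impI)
        fix f assume f: "pfun V f" "van A f"
        have "pfun (insert t V) f" using f(1) by (rule pfun_mono) auto
        with v'(1) f(2) show "dird f y v' = 0" by (simp add: tang_def)
      qed
      from v(3)[OF this v'(2)] have vv: "\<forall>i\<in>V. v' i = v i" .
      have "dird (ev t P) y v' = 0" using v'(1) pfun_ev[OF P'(1), of t] P'(2) by (simp add: tang_def)
      then have "dird (ev t P) y (v'(t := 0)) + v' t * D y = 0" using dird_ev[OF P'(1) t(1), of y v'] by (simp add: D_def)
      moreover have "dird (ev t P) y (v'(t := 0)) = dird (ev t P) y (v(t := 0))"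
        by (rule dird_cong[OF pfun_ev[OF P'(1)]]) (use vv in auto)
      ultimately have "v' t = v1 t" using nz(3) by (simp add: v1_def field_simps eq_neg_iff_add_eq_0)
      then show ?thesis using vv t by (auto simp: v1_def)
    qed
    ultimately show "\<exists>v. tang A (insert t V) y v \<and> (\<forall>i\<in>I. v i = a i) \<and>
        (\<forall>v'. tang A (insert t V) y v' \<longrightarrow> (\<forall>i\<in>I. v' i = a i) \<longrightarrow> (\<forall>i\<in>insert t V. v' i = v i))" by blast
  qed
qed

section \<open>Algebraic sets of vectors\<close>

text \<open>Vectors are turned into functions on the index type, so that auxiliary variables can be adjoined freely.\<close>

definition fn :: "(complex^'m) set \<Rightarrow> ('m::finite \<Rightarrow> complex) set" where
  "fn X = vec_nth ` X"

lemma mem_fn [simp]: "vec_nth p \<in> fn X \<longleftrightarrow> p \<in> X"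
  by (auto simp: fn_def vec_nth_inject)

lemma vec_nth_lambda [simp]: "vec_nth (vec_lambda z) = z"
  by (rule ext) simp

lemma mem_fn_iff: "z \<in> fn X \<longleftrightarrow> vec_lambda z \<in> X"
  using mem_fn[of "vec_lambda z" X] by simp

lemma fn_subset: "fn X \<subseteq> fn Y \<longleftrightarrow> X \<subseteq> Y"
  by (auto simp: fn_def vec_nth_inject image_subset_iff)

lemma fn_eq: "fn X = fn Y \<longleftrightarrow> X = Y"
  by (auto simp: set_eq_subset fn_subset)

lemma fn_psubset: "fn X \<subset> fn Y \<longleftrightarrow> X \<subset> Y"
  by (auto simp: psubset_eq fn_subset fn_eq)

lemma fn_surj: "\<exists>X. fn X = A"
proof
  show "fn (vec_lambda ` A) = A" by (auto simp: fn_def image_image)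
qed

lemma van_fn: "van (fn X) f \<longleftrightarrow> (\<forall>x\<in>X. f (vec_nth x) = 0)"
  by (auto simp: van_def fn_def)

lemma cpoly_imp_pfun:
  "cpoly_fun f \<Longrightarrow> pfun UNIV (\<lambda>x. f (vec_lambda x))"
  by (induction rule: cpoly_fun.induct) (auto intro: pfun_const pfun_var pfun_add pfun_mult)

lemma pfun_imp_cpoly:
  "pfun V g \<Longrightarrow> cpoly_fun (\<lambda>x. g (vec_nth x))"
  by (induction rule: pfun.induct) (auto intro: cpoly_fun.intros)

lemma algebraic_set_iff: "algebraic_set X \<longleftrightarrow> zcl UNIV (fn X) = fn X"
proof
  assume "algebraic_set X"
  then obtain F where F: "\<forall>f\<in>F. cpoly_fun f" "X = {x. \<forall>f\<in>F. f x = 0}" by (auto simp: algebraic_set_def)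
  have "z \<in> fn X" if z: "z \<in> zcl UNIV (fn X)" for z
  proof -
    have "f (vec_lambda z) = 0" if f: "f \<in> F" for f
    proof (rule zclD[OF z, of "\<lambda>x. f (vec_lambda x)"])
      show "pfun UNIV (\<lambda>x. f (vec_lambda x))" using F(1) f by (intro cpoly_imp_pfun) auto
      show "van (fn X) (\<lambda>x. f (vec_lambda x))" using F(2) f by (auto simp: van_fn)
    qed
    then show ?thesis using F(2) by (simp add: mem_fn_iff)
  qed
  then show "zcl UNIV (fn X) = fn X" using subset_zcl by blast
next
  assume cl: "zcl UNIV (fn X) = fn X"
  define F where "F = {f. cpoly_fun f \<and> (\<forall>x\<in>X. f x = 0)}"
  have "x \<in> X" if x: "\<forall>f\<in>F. f x = 0" for x
  proof -
    have "vec_nth x \<in> zcl UNIV (fn X)"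
    proof (rule zclI)
      fix f assume "pfun UNIV f" "van (fn X) f"
      then have "(\<lambda>x. f (vec_nth x)) \<in> F" by (auto simp: F_def van_fn intro: pfun_imp_cpoly)
      then show "f (vec_nth x) = 0" using x by auto
    qed
    then show ?thesis using cl by simp
  qed
  moreover have "f x = 0" if "x \<in> X" "f \<in> F" for f x using that by (simp add: F_def)
  ultimately have "X = {x. \<forall>f\<in>F. f x = 0}" by blast
  moreover have "\<forall>f\<in>F. cpoly_fun f" by (auto simp: F_def)
  ultimately show "algebraic_set X" unfolding algebraic_set_def by (intro exI[of _ F] conjI)
qed

lemma zcl_section:
  assumes "zcl UNIV A = A" "pfun UNIV f"
  shows "zcl UNIV {x\<in>A. f x = 0} = {x\<in>A. f x = 0}"
proof -
  have "z \<in> A \<and> f z = 0" if z: "z \<in> zcl UNIV {x\<in>A. f x = 0}" for z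
  proof
    have "zcl UNIV {x\<in>A. f x = 0} \<subseteq> zcl UNIV A" by (rule zcl_mono) auto
    with z assms(1) show "z \<in> A" by auto
    show "f z = 0" by (rule zclD[OF z assms(2)]) (auto simp: van_def)
  qed
  then show ?thesis using subset_zcl[of "{x\<in>A. f x = 0}" UNIV] by blast
qed

text \<open>The usual equivalence of indecomposability with primeness of the vanishing ideal:
  factors give closed pieces, and closed pieces are separated by polynomials.\<close>

lemma irreducible_algebraic_iff:
  "irreducible_algebraic Z \<longleftrightarrow> irr (fn Z) \<and> zcl UNIV (fn Z) = fn Z"
proof
  assume Z: "irreducible_algebraic Z"
  then have cl: "zcl UNIV (fn Z) = fn Z" and ne: "fn Z \<noteq> {}"
    by (auto simp: irreducible_algebraic_def algebraic_set_iff fn_def)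
  have "van (fn Z) f \<or> van (fn Z) g" if fg: "pfun UNIV f" "pfun UNIV g" "van (fn Z) (\<lambda>x. f x * g x)" for f g
  proof -
    define S where "S h = {x\<in>Z. h (vec_nth x) = 0}" for h :: "('a \<Rightarrow> complex) \<Rightarrow> complex"
    have S: "algebraic_set (S h)" if "pfun UNIV h" for h
    proof -
      have "fn (S h) = {x\<in>fn Z. h x = 0}" by (auto simp: S_def fn_def)
      then show ?thesis using zcl_section[OF cl that] by (simp add: algebraic_set_iff)
    qed
    have "Z = S f \<union> S g" using fg(3) by (auto simp: S_def van_fn)
    with Z S[OF fg(1)] S[OF fg(2)] have "Z = S f \<or> Z = S g" unfolding irreducible_algebraic_def by blast
    then show ?thesis by (auto simp: S_def van_fn)
  qed
  with cl ne show "irr (fn Z) \<and> zcl UNIV (fn Z) = fn Z" by (simp add: irr_def)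
next
  assume Z: "irr (fn Z) \<and> zcl UNIV (fn Z) = fn Z"
  have "Z = A \<or> Z = B" if AB: "algebraic_set A" "algebraic_set B" "Z = A \<union> B" for A B
  proof (rule ccontr)
    assume n: "\<not> (Z = A \<or> Z = B)"
    have sep: "\<exists>f. pfun UNIV f \<and> van (fn C) f \<and> \<not> van (fn Z) f" if C: "algebraic_set C" "C \<subseteq> Z" "C \<noteq> Z" for C
    proof -
      obtain c where c: "c \<in> Z" "c \<notin> C" using C by blast
      then have "vec_nth c \<notin> zcl UNIV (fn C)" using C(1) by (simp add: algebraic_set_iff)
      then obtain f where "pfun UNIV f" "van (fn C) f" "f (vec_nth c) \<noteq> 0" unfolding zcl_def by blast
      with c show ?thesis by (auto simp: van_fn)
    qed
    from sep[OF AB(1)] n AB(3) obtain f where f: "pfun UNIV f" "van (fn A) f" "\<not> van (fn Z) f" by blast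
    from sep[OF AB(2)] n AB(3) obtain g where g: "pfun UNIV g" "van (fn B) g" "\<not> van (fn Z) g" by blast
    have "van (fn Z) (f * g)" using f(2) g(2) AB(3) by (auto simp: van_fn)
    with irrD[OF _ f(1) g(1)] Z f(3) g(3) show False by blast
  qed
  then show "irreducible_algebraic Z"
    using Z by (auto simp: irreducible_algebraic_def algebraic_set_iff irr_def fn_def)
qed

lemma alg_dim_le:
  assumes "\<And>Z I. irreducible_algebraic Z \<Longrightarrow> Z \<subseteq> X \<Longrightarrow> indep_on I (fn Z) \<Longrightarrow> card I \<le> d"
  shows "alg_dim X \<le> enat d"
  unfolding alg_dim_def
proof (rule SUP_least, clarify)
  fix n and Z :: "nat \<Rightarrow> (complex^'a) set"
  assume Z: "\<forall>i\<le>n. irreducible_algebraic (Z i) \<and> Z i \<subseteq> X" "\<forall>i<n. Z i \<subset> Z (Suc i)"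
  have "\<exists>I. card I = n \<and> indep_on I (fn (Z n))"
    by (rule chain_indep[of n "\<lambda>i. fn (Z i)"]) (use Z in \<open>auto simp: irreducible_algebraic_iff fn_psubset\<close>)
  then obtain I where "card I = n" "indep_on I (fn (Z n))" by blast
  with assms[of "Z n" I] Z(1) show "enat n \<le> enat d" by auto
qed

lemma card_indep_le_alg_dim:
  assumes "irreducible_algebraic Z" "Z \<subseteq> X" "indep_on I (fn Z)"
  shows "enat (card I) \<le> alg_dim X"
proof -
  from assms(1) have Z: "irr (fn Z)" "zcl UNIV (fn Z) = fn Z" by (auto simp: irreducible_algebraic_iff)
  from indep_chain[OF Z assms(3)] obtain C where
    C: "\<And>i. i \<le> card I \<Longrightarrow> irr (C i) \<and> zcl UNIV (C i) = C i" "\<And>i. i < card I \<Longrightarrow> C i \<subset> C (Suc i)" "C (card I) = fn Z" by blast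
  from fn_surj have "\<forall>i. \<exists>X. fn X = C i" by blast
  then obtain D where D: "\<And>i. fn (D i) = C i" by metis
  have sub: "D i \<subseteq> Z" if "i \<le> card I" for i
    using that
  proof (induction i rule: inc_induct)
    case base
    show ?case using C(3) D by (metis fn_eq order_refl)
  next
    case (step i)
    have "fn (D i) \<subset> fn (D (Suc i))" using C(2)[of i] step D by simp
    then show ?case using step by (auto simp: fn_psubset)
  qed
  have "\<forall>i\<le>card I. irreducible_algebraic (D i) \<and> D i \<subseteq> X"
    using C(1) subset_trans[OF sub assms(2)] by (simp add: irreducible_algebraic_iff D)
  moreover have "\<forall>i<card I. D i \<subset> D (Suc i)"
    using C(2) D by (metis fn_psubset)
  ultimately show ?thesis unfolding alg_dim_def by (intro SUP_upper) auto
qed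

lemma alg_dim_indep:
  assumes "irreducible_algebraic Z" "alg_dim Z = enat k"
  shows "\<exists>I. card I = k \<and> indep_on I (fn Z)"
proof -
  have up: "card I \<le> k" if "indep_on I (fn Z)" for I
    using card_indep_le_alg_dim[OF assms(1) subset_refl that] assms(2) by simp
  have "\<exists>n\<ge>k. \<exists>C. (\<forall>i\<le>n. irreducible_algebraic (C i) \<and> C i \<subseteq> Z) \<and> (\<forall>i<n. C i \<subset> C (Suc i))"
  proof (rule ccontr)
    assume n: "\<not> ?thesis"
    \<comment> \<open>Needed because the bound \<open>k - 1\<close> below is truncated subtraction;
      for \<open>k = 0\<close> the one-term chain already suffices.\<close>
    have k: "k > 0"
    proof (rule ccontr)
      assume "\<not> k > 0"
      then have "k \<le> 0" by simp
      moreover have "\<exists>C. (\<forall>i\<le>0::nat. irreducible_algebraic (C i) \<and> C i \<subseteq> Z) \<and> (\<forall>i<0::nat. C i \<subset> C (Suc i))"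
        using assms(1) by (intro exI[of _ "\<lambda>_. Z"]) auto
      ultimately show False using n by blast
    qed
    have "alg_dim Z \<le> enat (k - 1)" unfolding alg_dim_def
    proof (rule SUP_least)
      fix m assume "m \<in> {n. \<exists>C. (\<forall>i\<le>n. irreducible_algebraic (C i) \<and> C i \<subseteq> Z) \<and> (\<forall>i<n. C i \<subset> C (Suc i))}"
      then have "\<exists>C. (\<forall>i\<le>m. irreducible_algebraic (C i) \<and> C i \<subseteq> Z) \<and> (\<forall>i<m. C i \<subset> C (Suc i))"
        by (rule CollectD)
      with n have "\<not> k \<le> m" by iprover
      then have "m < k" by simp
      then show "enat m \<le> enat (k - 1)" by auto
    qed
    with assms(2) k show False by simp
  qed
  then obtain n C where C: "n \<ge> k" "\<And>i. i \<le> n \<Longrightarrow> irreducible_algebraic (C i) \<and> C i \<subseteq> Z" "\<And>i. i < n \<Longrightarrow> C i \<subset> C (Suc i)"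
    by blast
  have "\<exists>I. card I = n \<and> indep_on I (fn (C n))"
    by (rule chain_indep[of n "\<lambda>i. fn (C i)"]) (use C in \<open>auto simp: irreducible_algebraic_iff fn_psubset\<close>)
  then obtain I where I: "card I = n" "indep_on I (fn (C n))" by blast
  have "indep_on I (fn Z)" by (rule indep_on_mono[OF I(2)]) (use C(2)[of n] in \<open>simp add: fn_subset\<close>)
  with up[OF this] C(1) I(1) show ?thesis by auto
qed

text \<open>Connects the real Frechet derivative in the definition of the tangent space with complex
  directional derivatives.\<close>

lemma cpoly_has_derivative:
  "cpoly_fun f \<Longrightarrow> (f has_derivative (\<lambda>v. dird (\<lambda>x. f (vec_lambda x)) (vec_nth p) (vec_nth v))) (at p)"
proof (induction rule: cpoly_fun.induct)
  case (coord i)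
  show ?case by (simp add: bounded_linear_imp_has_derivative bounded_linear_vec_nth)
next
  case (add f g)
  from has_derivative_add[OF add.IH] show ?case
    by (simp add: dird_add[OF cpoly_imp_pfun[OF add.hyps(1)] cpoly_imp_pfun[OF add.hyps(2)]])
next
  case (mult f g)
  from has_derivative_mult[OF mult.IH] show ?case
    by (simp add: dird_mult[OF cpoly_imp_pfun[OF mult.hyps(1)] cpoly_imp_pfun[OF mult.hyps(2)]] add.commute)
qed simp

lemma tangent_space_iff: "v \<in> tangent_space X p \<longleftrightarrow> tang (fn X) UNIV (vec_nth p) (vec_nth v)"
proof -
  have D: "frechet_derivative f (at p) v = dird (\<lambda>x. f (vec_lambda x)) (vec_nth p) (vec_nth v)" if "cpoly_fun f" for f
    using frechet_derivative_at[OF cpoly_has_derivative[OF that, of p]] by metis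
  show ?thesis
  proof
    assume v: "v \<in> tangent_space X p"
    show "tang (fn X) UNIV (vec_nth p) (vec_nth v)" unfolding tang_def
    proof (intro allI impI)
      fix f assume f: "pfun UNIV f" "van (fn X) f"
      have c: "cpoly_fun (\<lambda>x. f (vec_nth x))" by (rule pfun_imp_cpoly[OF f(1)])
      moreover have "\<forall>x\<in>X. f (vec_nth x) = 0" using f(2) by (simp add: van_fn)
      ultimately have "frechet_derivative (\<lambda>x. f (vec_nth x)) (at p) v = 0" using v unfolding tangent_space_def by blast
      then show "dird f (vec_nth p) (vec_nth v) = 0" using D[OF c] by simp
    qed
  next
    assume t: "tang (fn X) UNIV (vec_nth p) (vec_nth v)"
    have "frechet_derivative f (at p) v = 0" if f: "cpoly_fun f" "\<forall>x\<in>X. f x = 0" for f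
    proof -
      have "van (fn X) (\<lambda>x. f (vec_lambda x))" using f(2) by (simp add: van_fn)
      then show ?thesis using t cpoly_imp_pfun[OF f(1)] D[OF f(1)] by (simp add: tang_def)
    qed
    then show "v \<in> tangent_space X p" by (simp add: tangent_space_def)
  qed
qed

text \<open>Tangent vectors are moved back to the vector type, where \<open>vec.dim\<close> is
  available.\<close>

definition tset :: "('v::finite \<Rightarrow> complex) set \<Rightarrow> ('v \<Rightarrow> complex) \<Rightarrow> (complex^'v) set" where
  "tset A y = {v. tang A UNIV y (vec_nth v)}"

lemma tangent_space_tset: "tangent_space X p = tset (fn X) (vec_nth p)"
  by (auto simp: tset_def tangent_space_iff)

lemma dird_zero: "pfun V f \<Longrightarrow> dird f y (\<lambda>_. 0) = 0"
  using dird_linear[of V f y 0 "\<lambda>_. 0" "\<lambda>_. 0"] dird_linear[of V f y 1 "\<lambda>_. 0" "\<lambda>_. 0"] by simp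

lemma subspace_tset: "vec.subspace (tset A y)"
  unfolding vec.subspace_def
proof (intro conjI ballI allI)
  show "0 \<in> tset A y" by (auto simp: tset_def tang_def zero_vec_def dird_zero)
next
  fix v w assume "v \<in> tset A y" "w \<in> tset A y"
  then show "v + w \<in> tset A y"
    using dird_linear[of UNIV _ y 1 "vec_nth v" "vec_nth w"] by (auto simp: tset_def tang_def plus_vec_def)
next
  fix c v assume v: "v \<in> tset A y"
  show "c *s v \<in> tset A y"
    using v dird_linear[of UNIV _ y c "vec_nth v" "\<lambda>_. 0"]
    by (auto simp: tset_def tang_def vector_scalar_mult_def dird_zero)
qed

text \<open>The hypotheses make projection to the coordinates \<open>I\<close> an isomorphism on
  \<open>S\<close>; preimages of the unit vectors form a basis.\<close>

lemma dim_eq_card_coordinates: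
  fixes S :: "(complex^'v::finite) set"
  assumes S: "vec.subspace S" and ex: "\<And>a. \<exists>v\<in>S. \<forall>i\<in>I. v $ i = a i"
    and uniq: "\<And>v. v \<in> S \<Longrightarrow> (\<forall>i\<in>I. v $ i = 0) \<Longrightarrow> v = 0"
  shows "vec.dim S = card I"
proof -
  have "\<forall>j. \<exists>v\<in>S. \<forall>i\<in>I. v $ i = (if i = j then 1 else 0)"
    by (intro allI ex)
  then obtain b where b: "\<And>j. b j \<in> S" "\<And>i j. i \<in> I \<Longrightarrow> b j $ i = (if i = j then 1 else 0)" by metis
  have inj: "inj_on b I" by (rule inj_onI) (metis b(2) zero_neq_one)
  have comb: "(\<Sum>j\<in>I. c j *s b j) $ i = c i" if "i \<in> I" for c i
    using that by (simp add: sum_component b(2) if_distrib[of "\<lambda>x. _ * x"] cong: if_cong)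
  show ?thesis
  proof (rule vec.dim_unique[of "b ` I"])
    show "b ` I \<subseteq> S" using b(1) by auto
    show "S \<subseteq> vec.span (b ` I)"
    proof
      fix v assume v: "v \<in> S"
      define w where "w = (\<Sum>j\<in>I. (v $ j) *s b j)"
      have "w \<in> S" unfolding w_def using b(1) by (intro vec.subspace_sum[OF S] vec.subspace_scale[OF S])
      then have "v - w \<in> S" using v by (intro vec.subspace_diff[OF S])
      moreover have "\<forall>i\<in>I. (v - w) $ i = 0" using comb[of _ "vec_nth v"] by (simp only: w_def vector_minus_component) simp
      ultimately have "v = w" using uniq[of "v - w"] by simp
      moreover have "w \<in> vec.span (b ` I)" unfolding w_def
        by (intro vec.span_sum vec.span_scale vec.span_base imageI)
      ultimately show "v \<in> vec.span (b ` I)" by simp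
    qed
    show "vec.independent (b ` I)"
    proof
      assume "vec.dependent (b ` I)"
      then obtain u j where u: "j \<in> I" "u (b j) \<noteq> 0" "(\<Sum>v\<in>b ` I. u v *s v) = 0"
        using vec.dependent_finite[of "b ` I"] by auto
      then have "(\<Sum>i\<in>I. u (b i) *s b i) = 0" by (simp add: sum.reindex[OF inj])
      then have "u (b j) = 0" using comb[OF u(1), of "\<lambda>i. u (b i)"] by simp
      with u(2) show False by simp
    qed
    show "card (b ` I) = card I" by (rule card_image[OF inj])
  qed
qed

text \<open>Maximality makes \<open>I\<close> a transcendence basis, so
  \<open>generic_tangent\<close> applies with all remaining variables adjoined and \<open>I\<close>
  parametrizes the tangent space.\<close>

lemma generic_dim:
  fixes A :: "('v::finite \<Rightarrow> complex) set"
  assumes A: "irr A" and I: "indep_on I A" and max: "\<And>t. t \<notin> I \<Longrightarrow> \<not> indep_on (insert t I) A"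
  shows "\<exists>L. pfun UNIV L \<and> \<not> van A L \<and> (\<forall>y\<in>zcl UNIV A. L y \<noteq> 0 \<longrightarrow> vec.dim (tset A y) = card I)"
proof -
  have alg: "alg_over A I t" if "t \<notin> I" for t using max[OF that] indep_on_insert[OF I] by auto
  have T: "finite (- I)" "- I \<inter> I = {}" "I \<union> - I = UNIV" by auto
  from generic_tangent[OF A I alg T(1,2), unfolded T(3)] obtain L where L: "pfun UNIV L" "\<not> van A L"
    "\<And>y a. y \<in> zcl UNIV A \<Longrightarrow> L y \<noteq> 0 \<Longrightarrow> \<exists>v. tang A UNIV y v \<and> (\<forall>i\<in>I. v i = a i) \<and>
        (\<forall>v'. tang A UNIV y v' \<longrightarrow> (\<forall>i\<in>I. v' i = a i) \<longrightarrow> (\<forall>i\<in>UNIV. v' i = v i))" by blast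
  have "vec.dim (tset A y) = card I" if y: "y \<in> zcl UNIV A" "L y \<noteq> 0" for y
  proof (rule dim_eq_card_coordinates[OF subspace_tset])
    fix a from L(3)[OF y, of a] obtain v where v: "tang A UNIV y v" "\<forall>i\<in>I. v i = a i" by blast
    then show "\<exists>v\<in>tset A y. \<forall>i\<in>I. v $ i = a i" by (intro bexI[of _ "vec_lambda v"]) (auto simp: tset_def)
  next
    fix v assume v: "v \<in> tset A y" "\<forall>i\<in>I. v $ i = 0"
    from L(3)[OF y, of "\<lambda>_. 0"] obtain w where
      w: "\<And>v'. tang A UNIV y v' \<Longrightarrow> (\<forall>i\<in>I. v' i = 0) \<Longrightarrow> (\<forall>i. v' i = w i)" by auto
    have "tang A UNIV y (\<lambda>_. 0)" by (auto simp: tang_def dird_zero)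
    from w[OF this] w[of "vec_nth v"] v show "v = 0" by (auto simp: tset_def vec_eq_iff)
  qed
  with L(1,2) show ?thesis by blast
qed

lemma indep_on_maximal:
  fixes A :: "('v::finite \<Rightarrow> complex) set"
  assumes "indep_on I A"
  shows "\<exists>J. I \<subseteq> J \<and> indep_on J A \<and> (\<forall>t. t \<notin> J \<longrightarrow> \<not> indep_on (insert t J) A)"
proof -
  have "card K \<le> card (UNIV :: 'v set)" for K :: "'v set" by (rule card_mono) auto
  then obtain J where J: "I \<subseteq> J" "indep_on J A" "\<And>K. I \<subseteq> K \<Longrightarrow> indep_on K A \<Longrightarrow> card K \<le> card J"
    using ex_has_greatest_nat[of "\<lambda>J. I \<subseteq> J \<and> indep_on J A" I card "Suc (card (UNIV :: 'v set))"] assms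
      by (auto simp: less_Suc_eq_le)
  have "\<not> indep_on (insert t J) A" if "t \<notin> J" for t
    using J(3)[of "insert t J"] J(1) that by auto
  with J(1,2) show ?thesis by blast
qed

section \<open>Jacobian minors\<close>

lemma dim_le_card_coordinates:
  fixes S :: "(complex^'v::finite) set"
  assumes S: "vec.subspace S" and uniq: "\<And>v. v \<in> S \<Longrightarrow> (\<forall>i\<in>I. v $ i = 0) \<Longrightarrow> v = 0"
  shows "vec.dim S \<le> card I"
proof -
  define D :: "complex^'v^'v" where "D = (\<chi> i j. if i = j \<and> i \<in> I then 1 else 0)"
  have D: "(D *v v) $ i = (if i \<in> I then v $ i else 0)" for v i
    by (cases "i \<in> I") (simp_all add: D_def matrix_vector_mult_def if_distrib[of "\<lambda>x. x * _"] cong: if_cong)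
  have inj: "inj_on ((*v) D) S"
  proof (rule inj_onI)
    fix v w assume vw: "v \<in> S" "w \<in> S" "D *v v = D *v w"
    have "(v - w) $ i = 0" if "i \<in> I" for i
      using arg_cong[OF vw(3), of "\<lambda>u. u $ i"] that by (simp add: D)
    then show "v = w" using uniq[of "v - w"] vec.subspace_diff[OF S vw(1,2)] by auto
  qed
  have "vec.dim S = vec.dim ((*v) D ` S)"
    using inj by (intro vec.dim_image_eq[symmetric] matrix_vector_mul_linear_gen) (simp add: vec.span_eq_iff[THEN iffD2, OF S])
  also have "\<dots> \<le> card ((\<lambda>i. axis i (1::complex)) ` I)"
  proof (rule vec.dim_le_card)
    show "(*v) D ` S \<subseteq> vec.span ((\<lambda>i. axis i (1::complex)) ` I)"
    proof clarify
      fix v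
      have "D *v v = (\<Sum>i\<in>I. (v $ i) *s axis i 1)"
        by (vector D) (auto simp: D sum_component axis_def if_distrib[of "\<lambda>x. _ * x"] cong: if_cong)
      also have "\<dots> \<in> vec.span ((\<lambda>i. axis i (1::complex)) ` I)"
        by (intro vec.span_sum vec.span_scale vec.span_base imageI)
      finally show "D *v v \<in> vec.span ((\<lambda>i. axis i (1::complex)) ` I)" .
    qed
  qed simp
  also have "\<dots> \<le> card I" by (rule card_image_le) simp
  finally show ?thesis .
qed

text \<open>The pairing is bilinear, without conjugation: elements of \<open>R\<close> are thought
  of as gradients, that is, as linear forms.\<close>

definition annih :: "(complex^'v::finite) set \<Rightarrow> (complex^'v) set" where
  "annih R = {v. \<forall>r\<in>R. (\<Sum>i\<in>UNIV. r $ i * v $ i) = 0}"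

text \<open>Unit rows pad every system of linear forms to a square matrix. Invertibility says that
  the forms \<open>F t\<close>, for \<open>t\<close> outside \<open>I\<close>, determine the other
  coordinates of their common zeros from those in \<open>I\<close>.\<close>

definition frame :: "'v set \<Rightarrow> ('v \<Rightarrow> complex^'v) \<Rightarrow> complex^'v^'v::finite" where
  "frame I F = (\<chi> t. if t \<in> I then axis t 1 else F t)"

lemma frame_mult: "(frame I F *v v) $ t = (if t \<in> I then v $ t else (\<Sum>i\<in>UNIV. F t $ i * v $ i))"
  by (simp add: frame_def matrix_vector_mult_def axis_def if_distrib[of "\<lambda>x. x * _"] cong: if_cong)

lemma annih_inj:
  fixes v :: "complex^'v::finite"
  assumes F: "\<And>t. F t \<in> R" and det: "det (frame I F) \<noteq> 0" and v: "v \<in> annih R" "\<forall>i\<in>I. v $ i = 0"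
  shows "v = 0"
proof -
  have "frame I F *v v = 0"
  proof (rule vec_eq_iff[THEN iffD2], rule allI)
    fix t show "(frame I F *v v) $ t = 0 $ t"
      using v F[of t] by (simp add: frame_mult annih_def)
  qed
  moreover have "invertible (frame I F)" using det by (simp add: invertible_det_nz)
  then obtain N where "N ** frame I F = mat 1" by (auto simp: invertible_def)
  ultimately show ?thesis
    by (metis matrix_vector_mul_assoc matrix_vector_mul_lid matrix_vector_mult_0_right)
qed

lemma subspace_annih: "vec.subspace (annih R)"
  unfolding vec.subspace_def annih_def
  by (auto simp: distrib_left sum.distrib mult.left_commute simp flip: sum_distrib_left)

text \<open>Steinitz exchange: a basis \<open>C\<close> of \<open>R\<close> is completed by unit
  vectors to a basis of the whole space. Their indices form \<open>I\<close>, and a count shows that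
  \<open>C\<close> exactly fills the remaining rows.\<close>

lemma frame_exists:
  fixes R :: "(complex^'v::finite) set"
  assumes R: "vec.subspace R"
  shows "\<exists>I F. card I = vec.dim (annih R) \<and> (\<forall>t. F t \<in> R) \<and> det (frame I F) \<noteq> 0"
proof -
  obtain C where C: "C \<subseteq> R" "vec.independent C" "R \<subseteq> vec.span C" using vec.basis_exists by metis
  define E where "E = range (\<lambda>i::'v. axis i (1::complex))"
  obtain B where B: "C \<subseteq> B" "B \<subseteq> C \<union> E" "vec.independent B" "C \<union> E \<subseteq> vec.span B"
    using vec.maximal_independent_subset_extend[of C "C \<union> E"] C(2) by blast
  have "(v :: complex^'v) \<in> vec.span B" for v
  proof -
    have "v = (\<Sum>i\<in>UNIV. (v $ i) *s axis i 1)"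
      by (vector) (simp add: sum_component axis_def if_distrib[of "\<lambda>x. _ * x"] cong: if_cong)
    also have "\<dots> \<in> vec.span B" using B(4) by (intro vec.span_sum vec.span_scale) (auto simp: E_def)
    finally show ?thesis .
  qed
  then have "vec.dim (UNIV :: (complex^'v) set) = card B"
    by (intro vec.dim_unique[OF subset_UNIV _ B(3) refl]) auto
  then have cB: "card B = CARD('v)" by (simp only: vec_dim_card)
  have fB: "finite B" by (rule vec.finiteI_independent[OF B(3)])
  have axinj: "inj (\<lambda>i::'v. axis i (1::complex))" by (rule injI) (auto simp: axis_eq_axis)
  define I where "I = {i. axis i 1 \<in> B - C}"
  have BI: "B - C = (\<lambda>i. axis i 1) ` I" using B(2) by (auto simp: I_def E_def)
  have "card (B - C) = card I" unfolding BI by (rule card_image) (rule inj_on_subset[OF axinj subset_UNIV])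
  moreover have "card (B - C) = card B - card C" using B(1) fB by (intro card_Diff_subset) (auto intro: finite_subset)
  moreover have "card C \<le> card B" by (rule card_mono[OF fB B(1)])
  moreover have "card (- I) = CARD('v) - card I" by (simp add: Compl_eq_Diff_UNIV card_Diff_subset)
  moreover have "card I \<le> CARD('v)" by (rule card_mono) auto
  ultimately have "card (- I) = card C" using cB by simp
  then obtain h where h: "bij_betw h (- I) C"
    using finite_same_card_bij[of "- I" C] finite_subset[OF B(1) fB] by auto
  \<comment> \<open>The value 0 on \<open>I\<close> is only a filler that lies in \<open>R\<close>;
    \<open>frame\<close> replaces these rows by unit rows.\<close>
  define F where "F t = (if t \<in> I then 0 else h t)" for t
  define s where "s t = (if t \<in> I then axis t 1 else h t)" for t
  have FR: "F t \<in> R" for t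
  proof (cases "t \<in> I")
    case False
    then have "h t \<in> C" using h by (auto simp: bij_betw_def)
    then show ?thesis using C(1) False by (auto simp: F_def)
  qed (simp add: F_def vec.subspace_0[OF R])
  have sI: "s ` I = B - C" unfolding BI by (auto simp: s_def image_iff)
  have sN: "s ` (- I) = C" using h by (auto simp: s_def bij_betw_def)
  have sB: "s ` UNIV = B" using image_Un[of s I "- I"] sI sN B(1) by auto
  have sinj: "inj s" using cB sB by (intro eq_card_imp_inj_on) auto
  have "det (frame I F) \<noteq> 0"
  proof -
    have row: "row t (frame I F) = s t" for t
      by (simp add: row_def frame_def s_def F_def vec_eq_iff)
    have "\<forall>t. c t = 0" if c: "(\<Sum>t\<in>UNIV. c t *s s t) = 0" for c
    proof (rule ccontr)
      assume "\<not> ?thesis"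
      then obtain t where t: "c t \<noteq> 0" by blast
      define u where "u b = c (inv s b)" for b
      have us: "u (s t) = c t" for t using sinj by (simp add: u_def)
      have "(\<Sum>b\<in>B. u b *s b) = 0" using c by (simp add: sum.reindex[OF sinj] us flip: sB)
      moreover have "u (s t) \<noteq> 0" "s t \<in> B" using t us sB by auto
      ultimately have "vec.dependent B" unfolding vec.dependent_finite[OF fB] by blast
      with B(3) show False by simp
    qed
    then have "\<exists>N. frame I F ** N = mat 1" unfolding matrix_right_invertible_independent_rows row by blast
    then have "invertible (frame I F)" by (metis invertible_def matrix_left_right_inverse)
    then show ?thesis by (simp add: invertible_det_nz)
  qed
  moreover have "vec.dim (annih R) = card I"
  proof (rule dim_eq_card_coordinates[OF subspace_annih])
    show "v = 0" if "v \<in> annih R" "\<forall>i\<in>I. v $ i = 0" for v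
      by (rule annih_inj[OF FR \<open>det (frame I F) \<noteq> 0\<close> that])
    fix a :: "'v \<Rightarrow> complex"
    have "invertible (frame I F)" using \<open>det (frame I F) \<noteq> 0\<close> by (simp add: invertible_det_nz)
    then obtain N where N: "frame I F ** N = mat 1" by (auto simp: invertible_def)
    define v where "v = N *v (\<chi> i. if i \<in> I then a i else 0)"
    have Fv: "frame I F *v v = (\<chi> i. if i \<in> I then a i else 0)"
      unfolding v_def by (simp add: matrix_vector_mul_assoc N)
    have "v \<in> annih R" unfolding annih_def
    proof (intro CollectI ballI)
      fix r assume "r \<in> R"
      then have "r \<in> vec.span C" using C(3) by auto
      then show "(\<Sum>i\<in>UNIV. r $ i * v $ i) = 0"
      proof (induction rule: vec.span_induct_alt)
        case (step c x y)
        from step(1) obtain t where t: "t \<notin> I" "x = h t" using h by (auto simp: bij_betw_def)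
        have "(\<Sum>i\<in>UNIV. x $ i * v $ i) = (frame I F *v v) $ t" using t by (simp add: frame_mult F_def)
        also have "\<dots> = 0" using t by (simp add: Fv)
        finally have "(\<Sum>i\<in>UNIV. x $ i * v $ i) = 0" .
        then show ?case using step(2)
          by (simp add: distrib_right sum.distrib mult.assoc flip: sum_distrib_left)
      qed simp
    qed
    moreover have "v $ i = a i" if "i \<in> I" for i
      using arg_cong[OF Fv, of "\<lambda>u. u $ i"] that by (simp add: frame_mult)
    ultimately show "\<exists>v\<in>annih R. \<forall>i\<in>I. v $ i = a i" by blast
  qed
  ultimately show ?thesis using FR by metis
qed

lemma dird_coords:
  fixes f :: "('v::finite \<Rightarrow> complex) \<Rightarrow> complex"
  shows "pfun V f \<Longrightarrow> dird f y v = (\<Sum>i\<in>UNIV. dird f y (\<lambda>j. if j = i then 1 else 0) * v i)"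
proof (induction rule: pfun.induct)
  case (pfun_var i)
  then show ?case by (simp add: if_distrib[of "\<lambda>x. x * _"] cong: if_cong)
next
  case (pfun_add f g)
  show ?case
    using pfun_add.IH by (simp add: dird_add[OF pfun_add.hyps] distrib_right sum.distrib)
next
  case (pfun_mult f g)
  then show ?case by (simp add: dird_mult[OF pfun_mult.hyps] distrib_left distrib_right sum.distrib sum_distrib_left sum_distrib_right mult_ac)
qed simp

lemma pfun_dird_fix: "pfun V f \<Longrightarrow> pfun V (\<lambda>y. dird f y v)"
proof (induction rule: pfun.induct)
  case (pfun_add f g)
  then show ?case by (simp add: dird_add[OF pfun_add.hyps] pfun.pfun_add)
next
  case (pfun_mult f g)
  then show ?case by (simp add: dird_mult[OF pfun_mult.hyps] pfun.pfun_add pfun.pfun_mult)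
qed (auto intro: pfun_const)

definition grad :: "(('v \<Rightarrow> complex) \<Rightarrow> complex) \<Rightarrow> ('v \<Rightarrow> complex) \<Rightarrow> complex^'v::finite" where
  "grad f y = (\<chi> i. dird f y (\<lambda>j. if j = i then 1 else 0))"

definition van_ideal :: "('v \<Rightarrow> complex) set \<Rightarrow> (('v \<Rightarrow> complex) \<Rightarrow> complex) set" where
  "van_ideal A = {f. pfun UNIV f \<and> van A f}"

lemma tset_annih: "tset A y = annih ((\<lambda>f. grad f y) ` van_ideal A)"
proof -
  have "dird f y (vec_nth v) = (\<Sum>i\<in>UNIV. grad f y $ i * v $ i)" if "pfun UNIV f" for f v
    using dird_coords[OF that, of y "vec_nth v"] by (simp add: grad_def)
  then show ?thesis by (auto simp: tset_def tang_def annih_def van_ideal_def)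
qed

lemma subspace_grads: "vec.subspace ((\<lambda>f. grad f y) ` van_ideal A)"
  unfolding vec.subspace_def
proof (intro conjI ballI allI)
  have "(\<lambda>_. 0) \<in> van_ideal A" "grad (\<lambda>_. 0) y = 0" by (auto simp: van_ideal_def van_def grad_def vec_eq_iff)
  then show "0 \<in> (\<lambda>f. grad f y) ` van_ideal A" by force
next
  fix v w assume "v \<in> (\<lambda>f. grad f y) ` van_ideal A" "w \<in> (\<lambda>f. grad f y) ` van_ideal A"
  then obtain f g where fg: "v = grad f y" "w = grad g y" "pfun UNIV f" "van A f" "pfun UNIV g" "van A g"
    by (auto simp: van_ideal_def)
  have "v + w = grad (\<lambda>x. f x + g x) y" by (simp add: fg grad_def vec_eq_iff dird_add[OF fg(3,5)])
  moreover have "(\<lambda>x. f x + g x) \<in> van_ideal A" using fg by (auto simp: van_ideal_def van_def intro: pfun_add)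
  ultimately show "v + w \<in> (\<lambda>f. grad f y) ` van_ideal A" by blast
next
  fix c v assume "v \<in> (\<lambda>f. grad f y) ` van_ideal A"
  then obtain f where f: "v = grad f y" "pfun UNIV f" "van A f" by (auto simp: van_ideal_def)
  have "c *s v = grad (\<lambda>x. c * f x) y" by (simp add: f grad_def vec_eq_iff dird_mult[OF pfun_const f(2)])
  moreover have "(\<lambda>x. c * f x) \<in> van_ideal A" using f by (auto simp: van_ideal_def van_def intro: pfun_mult pfun_const)
  ultimately show "c *s v \<in> (\<lambda>f. grad f y) ` van_ideal A" by blast
qed

text \<open>Jacobian minors, padded to full square matrices by unit rows: they cut out the locus where the
  Zariski tangent space has a given dimension.\<close>

definition minor :: "'v set \<Rightarrow> ('v \<Rightarrow> ('v \<Rightarrow> complex) \<Rightarrow> complex) \<Rightarrow> ('v::finite \<Rightarrow> complex) \<Rightarrow> complex" where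
  "minor I F y = det (frame I (\<lambda>t. grad (F t) y))"

lemma pfun_minor:
  assumes "\<And>t. pfun UNIV (F t)"
  shows "pfun UNIV (minor I F)"
proof -
  have "pfun UNIV (\<lambda>y. frame I (\<lambda>t. grad (F t) y) $ i $ j)" for i j
    using pfun_dird_fix[OF assms, of i] by (cases "i \<in> I") (auto simp: frame_def grad_def intro: pfun_const)
  then show ?thesis unfolding minor_def[abs_def] det_def
    by (intro pfun_sum' pfun_mult pfun_const pfun_prod)
qed

lemma minor_inj:
  fixes v :: "complex^'v::finite"
  assumes "\<And>t. F t \<in> van_ideal A" "minor I F y \<noteq> 0" "v \<in> tset A y" "\<forall>i\<in>I. v $ i = 0"
  shows "v = 0"
  using annih_inj[of "\<lambda>t. grad (F t) y" "(\<lambda>f. grad f y) ` van_ideal A" I v] assms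
  by (auto simp: minor_def tset_annih)

lemma dim_tset_le:
  assumes "\<And>t. F t \<in> van_ideal A" "minor I F y \<noteq> 0"
  shows "vec.dim (tset A y) \<le> card I"
  by (rule dim_le_card_coordinates[OF subspace_tset minor_inj[OF assms]])

lemma minor_exists:
  "\<exists>I F. card I = vec.dim (tset A y) \<and> (\<forall>t. F t \<in> van_ideal A) \<and> minor I F y \<noteq> 0"
proof -
  from frame_exists[OF subspace_grads, of y A] obtain I G where
    G: "card I = vec.dim (tset A y)" "\<forall>t. G t \<in> (\<lambda>f. grad f y) ` van_ideal A" "det (frame I G) \<noteq> 0"
    unfolding tset_annih by blast
  then have "\<forall>t. \<exists>f. f \<in> van_ideal A \<and> G t = grad f y" by blast
  from choice[OF this] obtain F where F: "\<forall>t. F t \<in> van_ideal A \<and> G t = grad (F t) y" by (elim exE)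
  then have "G = (\<lambda>t. grad (F t) y)" by auto
  with G F show ?thesis unfolding minor_def by blast
qed

text \<open>Vanishing of the minors with fewer than \<open>k\<close> unit rows bounds the dimension
  from below, one nonzero minor with \<open>k\<close> unit rows bounds it from above. The stratum is
  thereby given by equations and inequations.\<close>

lemma dim_tset_eq_iff:
  "vec.dim (tset A y) = k \<longleftrightarrow>
    (\<forall>I F. card I < k \<longrightarrow> (\<forall>t. F t \<in> van_ideal A) \<longrightarrow> minor I F y = 0) \<and>
    (\<exists>I F. card I = k \<and> (\<forall>t. F t \<in> van_ideal A) \<and> minor I F y \<noteq> 0)"
  (is "?L \<longleftrightarrow> ?R1 \<and> ?R2")
proof
  assume k: ?L
  have "minor I F y = 0" if "card I < k" "\<forall>t. F t \<in> van_ideal A" for I F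
    using dim_tset_le[of F A I y] that k by auto
  moreover have ?R2 using minor_exists[of A y] unfolding k .
  ultimately show "?R1 \<and> ?R2" by blast
next
  assume R: "?R1 \<and> ?R2"
  then obtain I F where "card I = k" "\<forall>t. F t \<in> van_ideal A" "minor I F y \<noteq> 0" by blast
  then have le: "vec.dim (tset A y) \<le> k" using dim_tset_le[of F A I y] by simp
  from minor_exists[of A y] obtain I' F' where
    *: "card I' = vec.dim (tset A y)" "\<forall>t. F' t \<in> van_ideal A" "minor I' F' y \<noteq> 0" by blast
  with R have "\<not> card I' < k" by blast
  with le * show ?L by simp
qed

section \<open>The tangent cone at infinity\<close>

lemma irr_prod:
  assumes A: "irr A" and "finite \<C>" "\<And>C. C \<in> \<C> \<Longrightarrow> pfun UNIV (f C) \<and> \<not> van A (f C)"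
  shows "\<not> van A (\<lambda>x. \<Prod>C\<in>\<C>. f C x)"
  using assms(2,3)
proof (induction \<C>)
  case empty
  then show ?case using A by (auto simp: irr_def van_def)
next
  case (insert C \<C>)
  have p: "pfun UNIV (f C)" "pfun UNIV (\<lambda>x. \<Prod>C\<in>\<C>. f C x)"
    using insert.prems by (auto intro!: pfun_prod)
  have "\<not> van A (f C * (\<lambda>x. \<Prod>C\<in>\<C>. f C x))"
    using irrD[OF A p] insert by blast
  then show ?case using insert by (simp add: times_fun_def)
qed

text \<open>An irreducible algebraic subset lies in the closure of one of the finitely many pieces,
  since otherwise a product of separating polynomials would vanish on it. So the maximal ones among
  these closures are components.\<close>

lemma component_exists:
  fixes X :: "(complex^'m::finite) set"
  assumes X: "algebraic_set X"
  shows "\<exists>\<Z>. finite \<Z> \<and> X = \<Union>\<Z> \<and> (\<forall>Z\<in>\<Z>. irreducible_component Z X)"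
proof -
  from irr_decomposition[of "fn X"] obtain \<A> where \<A>': "finite \<A>" "fn X = \<Union>\<A>" "\<forall>A\<in>\<A>. irr A"
    by (elim exE conjE)
  define \<B> where "\<B> = (\<lambda>A. vec_lambda ` zcl UNIV A) ` \<A>"
  have fnB: "fn (vec_lambda ` zcl UNIV A) = zcl UNIV A" for A :: "('m \<Rightarrow> complex) set"
    by (auto simp: fn_def image_image)
  have sub: "zcl UNIV A \<subseteq> fn X" if "A \<in> \<A>" for A
  proof -
    have "zcl UNIV A \<subseteq> zcl UNIV (fn X)" by (rule zcl_mono) (use that \<A>'(2) in blast)
    then show ?thesis using X by (simp add: algebraic_set_iff)
  qed
  have B: "finite \<B>" "\<And>Z. Z \<in> \<B> \<Longrightarrow> irreducible_algebraic Z \<and> Z \<subseteq> X"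
  proof -
    show "finite \<B>" using \<A>'(1) by (simp add: \<B>_def)
    fix Z assume "Z \<in> \<B>"
    then obtain A where A: "A \<in> \<A>" "fn Z = zcl UNIV A" by (auto simp: \<B>_def fnB)
    then show "irreducible_algebraic Z \<and> Z \<subseteq> X"
      using \<A>'(3) sub[OF A(1)] irr_zcl by (auto simp: irreducible_algebraic_iff simp flip: fn_subset)
  qed
  have XB: "\<exists>Z\<in>\<B>. W \<subseteq> Z" if W: "irreducible_algebraic W" "W \<subseteq> X" for W
  proof -
    have W': "irr (fn W)" "fn W \<subseteq> fn X" using W by (auto simp: irreducible_algebraic_iff fn_subset)
    have "\<exists>A\<in>\<A>. fn W \<subseteq> zcl UNIV A"
    proof (rule ccontr)
      assume n: "\<not> ?thesis"
      have "\<forall>A\<in>\<A>. \<exists>f. pfun UNIV f \<and> van A f \<and> \<not> van (fn W) f"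
      proof
        fix A assume "A \<in> \<A>"
        with n obtain z where z: "z \<in> fn W" "z \<notin> zcl UNIV A" by blast
        then obtain f where "pfun UNIV f" "van A f" "f z \<noteq> 0" unfolding zcl_def by blast
        with z show "\<exists>f. pfun UNIV f \<and> van A f \<and> \<not> van (fn W) f" by (auto simp: van_def)
      qed
      from bchoice[OF this] obtain f where f: "\<forall>A\<in>\<A>. pfun UNIV (f A) \<and> van A (f A) \<and> \<not> van (fn W) (f A)" by (elim exE)
      have "\<not> van (fn W) (\<lambda>x. \<Prod>A\<in>\<A>. f A x)"
        by (rule irr_prod[OF W'(1) \<A>'(1)]) (use f in blast)
      then obtain w where w: "w \<in> fn W" "(\<Prod>A\<in>\<A>. f A w) \<noteq> 0" by (auto simp: van_def)
      then obtain A where A: "A \<in> \<A>" "w \<in> A" using W'(2) \<A>'(2) by blast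
      then have "f A w = 0" using f by (auto simp: van_def)
      then have "(\<Prod>A\<in>\<A>. f A w) = 0" using A(1) \<A>'(1) by (intro prod_zero) auto
      with w(2) show False by simp
    qed
    then obtain A where A: "A \<in> \<A>" "fn W \<subseteq> zcl UNIV A" by blast
    then have "W \<subseteq> vec_lambda ` zcl UNIV A" by (simp add: fnB flip: fn_subset)
    with A(1) show ?thesis by (auto simp: \<B>_def)
  qed
  define \<Z> where "\<Z> = {Z\<in>\<B>. \<forall>W\<in>\<B>. Z \<subseteq> W \<longrightarrow> W = Z}"
  have "irreducible_component Z X" if Z: "Z \<in> \<Z>" for Z
    unfolding irreducible_component_def
  proof (intro conjI allI impI)
    show "irreducible_algebraic Z" "Z \<subseteq> X" using Z B(2) by (auto simp: \<Z>_def)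
    fix W assume W: "irreducible_algebraic W \<and> Z \<subseteq> W \<and> W \<subseteq> X"
    then obtain Z' where Z': "Z' \<in> \<B>" "W \<subseteq> Z'" using XB by blast
    then have "Z \<subseteq> Z'" using W by blast
    then have "Z' = Z" using Z Z'(1) by (simp add: \<Z>_def)
    with W Z' show "W = Z" by blast
  qed
  moreover have "X = \<Union>\<Z>"
  proof
    show "\<Union>\<Z> \<subseteq> X" using B(2) by (auto simp: \<Z>_def)
    show "X \<subseteq> \<Union>\<Z>"
    proof
      fix p assume "p \<in> X"
      then have "vec_nth p \<in> \<Union>\<A>" by (simp flip: \<A>'(2))
      then obtain A where A: "A \<in> \<A>" "vec_nth p \<in> A" by blast
      define Y where "Y = vec_lambda ` zcl UNIV A"
      have Y: "Y \<in> \<B>" "p \<in> Y" using A subset_zcl[of A UNIV] mem_fn[of p Y] unfolding Y_def fnB by (auto simp: \<B>_def)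
      obtain Z where Z: "Z \<in> \<B>" "Y \<subseteq> Z" "\<forall>W\<in>\<B>. Z \<subseteq> W \<longrightarrow> Z = W"
        using finite_has_maximal2[OF B(1) Y(1)] by auto
      then have "Z \<in> \<Z>" by (auto simp: \<Z>_def)
      with Z Y show "p \<in> \<Union>\<Z>" by blast
    qed
  qed
  moreover have "finite \<Z>" using B(1) by (simp add: \<Z>_def)
  ultimately show ?thesis by blast
qed

text \<open>Purity makes the local dimension equal to \<open>k\<close> at every point of
  \<open>X\<close>, so regularity becomes one condition on the tangent space.\<close>

lemma regular_iff:
  assumes X: "algebraic_set X" and k: "pure_dim X k"
  shows "p \<in> X - Sing X \<longleftrightarrow> p \<in> X \<and> vec.dim (tangent_space X p) = k"
proof -
  have "local_alg_dim X p = enat k" if p: "p \<in> X"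
  proof -
    from component_exists[OF X] obtain \<Z> where "X = \<Union>\<Z>" "\<forall>Z\<in>\<Z>. irreducible_component Z X" by blast
    with p obtain Z where Z: "irreducible_component Z X" "p \<in> Z" by blast
    have "alg_dim Z' = enat k" if "irreducible_component Z' X" for Z' using k that by (simp add: pure_dim_def)
    then show ?thesis unfolding local_alg_dim_def
      by (intro antisym SUP_least SUP_upper2[of Z]) (use Z in auto)
  qed
  then show ?thesis by (auto simp: Sing_def)
qed

lemma norm_le_card_mult:
  fixes v :: "complex^'m::finite"
  assumes "\<And>i. cmod (v $ i) \<le> \<epsilon>"
  shows "norm v \<le> real CARD('m) * \<epsilon>"
proof -
  have "norm v \<le> (\<Sum>i\<in>UNIV. norm (v $ i))" unfolding norm_vec_def by (rule L2_set_le_sum) simp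
  also have "\<dots> \<le> (\<Sum>i\<in>(UNIV :: 'm set). \<epsilon>)" using assms by (intro sum_mono) simp
  finally show ?thesis by simp
qed

section \<open>Charts at infinity and algebraicity\<close>

lemma escaping_sequence:
  fixes X :: "(complex^'m::finite) set"
  assumes R: "\<forall>\<epsilon>>0. \<exists>p\<in>X - Sing X. \<exists>w\<in>tangent_space X p. cmod (p $ i) > 1 / \<epsilon> \<and> (\<forall>j. cmod (w $ j - v $ j) < \<epsilon>)"
  obtains p w where "\<And>n. p n \<in> X - Sing X" "\<And>n. w n \<in> tangent_space X (p n)"
     "\<And>n. cmod (p n $ i) > real (Suc n)" "w \<longlonglongrightarrow> v"
proof -
  have "\<forall>n. \<exists>p w. p \<in> X - Sing X \<and> w \<in> tangent_space X p \<and>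
     cmod (p $ i) > real (Suc n) \<and> (\<forall>j. cmod (w $ j - v $ j) < inverse (real (Suc n)))"
  proof
    fix n
    have "inverse (real (Suc n)) > 0" by simp
    from R[rule_format, OF this] show "\<exists>p w. p \<in> X - Sing X \<and> w \<in> tangent_space X p \<and>
     cmod (p $ i) > real (Suc n) \<and> (\<forall>j. cmod (w $ j - v $ j) < inverse (real (Suc n)))"
      by (simp add: divide_inverse del: of_nat_Suc) blast
  qed
  then obtain p w where pw: "\<And>n. p n \<in> X - Sing X" "\<And>n. w n \<in> tangent_space X (p n)"
     "\<And>n. cmod (p n $ i) > real (Suc n)" "\<And>n j. cmod (w n $ j - v $ j) < inverse (real (Suc n))" by metis
  have "w \<longlonglongrightarrow> v"
  proof (rule vec_tendstoI)
    fix j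
    have "(\<lambda>n. w n $ j - v $ j) \<longlonglongrightarrow> 0"
      by (rule Lim_null_comparison[OF always_eventually LIMSEQ_inverse_real_of_nat]) (intro allI less_imp_le pw(4))
    then show "(\<lambda>n. w n $ j) \<longlonglongrightarrow> v $ j" by (simp add: LIM_zero_iff)
  qed
  with pw(1,2,3) show thesis by (rule that)
qed

text \<open>Among finitely many coordinates, one must be responsible for the escape to infinity: if
  each coordinate failed for some threshold, the least threshold would bound the norm. A fixed such
  coordinate can be inverted.\<close>

lemma C4_inf_iff:
  fixes X :: "(complex^'m::finite) set"
  shows "v \<in> C4_inf X \<longleftrightarrow> (\<exists>i. \<forall>\<epsilon>>0. \<exists>p\<in>X - Sing X. \<exists>w\<in>tangent_space X p.
     cmod (p $ i) > 1 / \<epsilon> \<and> (\<forall>j. cmod (w $ j - v $ j) < \<epsilon>))"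
proof
  assume "v \<in> C4_inf X"
  then obtain p w where pw: "\<And>j. p j \<in> X - Sing X" "\<And>j. w j \<in> tangent_space X (p j)"
    "filterlim (\<lambda>j. norm (p j)) at_top sequentially" "w \<longlonglongrightarrow> v" unfolding C4_inf_def by blast
  show "\<exists>i. \<forall>\<epsilon>>0. \<exists>p\<in>X - Sing X. \<exists>w\<in>tangent_space X p.
     cmod (p $ i) > 1 / \<epsilon> \<and> (\<forall>j. cmod (w $ j - v $ j) < \<epsilon>)"
  proof (rule ccontr)
    assume "\<not> ?thesis"
    then have "\<forall>i. \<exists>\<epsilon>>0. \<forall>p\<in>X - Sing X. \<forall>w\<in>tangent_space X p.
      (\<forall>j. cmod (w $ j - v $ j) < \<epsilon>) \<longrightarrow> cmod (p $ i) \<le> 1 / \<epsilon>" by (meson not_le)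
    then obtain e where e: "\<And>i. e i > 0" "\<And>i p w. p \<in> X - Sing X \<Longrightarrow> w \<in> tangent_space X p \<Longrightarrow>
      (\<forall>j. cmod (w $ j - v $ j) < e i) \<Longrightarrow> cmod (p $ i) \<le> 1 / e i" by metis
    define \<epsilon> where "\<epsilon> = Min (range e)"
    have \<epsilon>: "\<epsilon> > 0" "\<And>i. \<epsilon> \<le> e i" using e(1) by (auto simp: \<epsilon>_def)
    have "\<forall>\<^sub>F n in sequentially. dist (w n) v < \<epsilon>" by (rule tendstoD[OF pw(4) \<epsilon>(1)])
    moreover have "\<forall>\<^sub>F n in sequentially. norm (p n) > real CARD('m) * (1 / \<epsilon>)"
      using pw(3) by (simp add: filterlim_at_top_dense)
    ultimately have "\<forall>\<^sub>F n in sequentially. dist (w n) v < \<epsilon> \<and> norm (p n) > real CARD('m) * (1 / \<epsilon>)"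
      by (rule eventually_conj)
    then obtain n where n: "dist (w n) v < \<epsilon>" "norm (p n) > real CARD('m) * (1 / \<epsilon>)"
      by (auto simp: eventually_sequentially)
    have "cmod (p n $ i) \<le> 1 / \<epsilon>" for i
    proof -
      have "cmod (w n $ j - v $ j) < e i" for j
        using Finite_Cartesian_Product.norm_nth_le[of "w n - v" j] n(1) \<epsilon>(2)[of i] by (simp add: dist_norm)
      then have "cmod (p n $ i) \<le> 1 / e i" by (intro e(2)[OF pw(1,2)]) auto
      also have "\<dots> \<le> 1 / \<epsilon>" using \<epsilon> e(1)[of i] by (intro divide_left_mono) auto
      finally show ?thesis .
    qed
    from norm_le_card_mult[OF this] n(2) show False by simp
  qed
next
  assume "\<exists>i. \<forall>\<epsilon>>0. \<exists>p\<in>X - Sing X. \<exists>w\<in>tangent_space X p.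
     cmod (p $ i) > 1 / \<epsilon> \<and> (\<forall>j. cmod (w $ j - v $ j) < \<epsilon>)"
  then obtain i where "\<forall>\<epsilon>>0. \<exists>p\<in>X - Sing X. \<exists>w\<in>tangent_space X p.
     cmod (p $ i) > 1 / \<epsilon> \<and> (\<forall>j. cmod (w $ j - v $ j) < \<epsilon>)" by blast
  then obtain p w where pw: "\<And>n. p n \<in> X - Sing X" "\<And>n. w n \<in> tangent_space X (p n)"
     "\<And>n. cmod (p n $ i) > real (Suc n)" "w \<longlonglongrightarrow> v" by (rule escaping_sequence) blast
  have "real n \<le> norm (p n)" for n using Finite_Cartesian_Product.norm_nth_le[of "p n" i] pw(3)[of n] by simp
  then have "filterlim (\<lambda>n. norm (p n)) at_top sequentially"
    by (intro filterlim_at_top_mono[OF filterlim_real_sequentially]) auto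
  then show "v \<in> C4_inf X" unfolding C4_inf_def using pw(1,2,4) by blast
qed

lemma algebraic_set_UN:
  fixes C :: "'i::finite \<Rightarrow> (complex^'m::finite) set"
  assumes "\<And>i. algebraic_set (C i)"
  shows "algebraic_set (\<Union>i. C i)"
proof -
  have "z \<in> fn (\<Union>i. C i)" if "z \<in> zcl UNIV (fn (\<Union>i. C i))" for z
  proof -
    have "fn (\<Union>i. C i) = \<Union>(range (\<lambda>i. fn (C i)))" by (auto simp: fn_def)
    with that have "z \<in> zcl UNIV (\<Union>(range (\<lambda>i. fn (C i))))" by simp
    from zcl_Union[OF _ this] obtain i where "z \<in> zcl UNIV (fn (C i))" by auto
    then have "z \<in> fn (C i)" using assms[of i] by (simp add: algebraic_set_iff)
    then show ?thesis by (auto simp: fn_def)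
  qed
  then show ?thesis unfolding algebraic_set_iff using subset_zcl by blast
qed

text \<open>The chart at infinity where the \<open>i\<close>-th coordinate of the base point tends to infinity: its inverse is the
  new coordinate \<open>None\<close>, so that \<open>C4_inf X\<close> is a union of slices at \<open>None = 0\<close> of Zariski closures.\<close>

definition chart :: "('m::finite \<Rightarrow> complex) set \<Rightarrow> nat \<Rightarrow> 'm \<Rightarrow> (('m + 'm) option \<Rightarrow> complex) set" where
  "chart A k i = {z. z None * z (Some (Inl i)) = 1 \<and> (\<lambda>j. z (Some (Inl j))) \<in> A \<and>
     vec.dim (tset A (\<lambda>j. z (Some (Inl j)))) = k \<and>
     tang A UNIV (\<lambda>j. z (Some (Inl j))) (\<lambda>j. z (Some (Inr j)))}"

text \<open>The chart is locally closed: \<open>F1\<close> says that \<open>None\<close> inverts the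
  coordinate, \<open>F2\<close> places the base point in \<open>A\<close>, \<open>F3\<close> is
  tangency, and \<open>F4\<close> with the inequations \<open>G\<close> fixes the dimension of the
  tangent space.\<close>

lemma chart_closure:
  fixes A :: "('m::finite \<Rightarrow> complex) set"
  assumes A: "zcl UNIV A = A" and z0: "z0 \<in> zcl V (chart A k i)" and \<epsilon>: "\<epsilon> > 0"
  shows "\<exists>z\<in>chart A k i. \<forall>j\<in>V. cmod (z j - z0 j) < \<epsilon>"
proof -
  define bp :: "(('m + 'm) option \<Rightarrow> complex) \<Rightarrow> 'm \<Rightarrow> complex" where "bp z = (\<lambda>j. z (Some (Inl j)))" for z
  define tv :: "(('m + 'm) option \<Rightarrow> complex) \<Rightarrow> 'm \<Rightarrow> complex" where "tv z = (\<lambda>j. z (Some (Inr j)))" for z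
  have bp: "pfun UNIV (\<lambda>z. f (bp z))" if "pfun UNIV f" for f
    unfolding bp_def by (rule pfun_comp[OF that]) (auto intro: pfun_var)
  define F1 where "F1 = {\<lambda>z :: ('m + 'm) option \<Rightarrow> complex. z None * z (Some (Inl i)) - 1}"
  define F2 where "F2 = (\<lambda>f z. f (bp z)) ` van_ideal A"
  define F3 where "F3 = (\<lambda>f z. dird f (bp z) (tv z)) ` van_ideal A"
  define F4 where "F4 = (\<lambda>(I, F) z. minor I F (bp z)) ` {(I, F). card I < k \<and> (\<forall>t. F t \<in> van_ideal A)}"
  define G where "G = (\<lambda>(I, F) z. minor I F (bp z)) ` {(I, F). card I = k \<and> (\<forall>t. F t \<in> van_ideal A)}"
  have vi: "pfun UNIV f" if "f \<in> van_ideal A" for f using that by (simp add: van_ideal_def)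
  have F: "pfun UNIV f" if f: "f \<in> F1 \<union> F2 \<union> F3 \<union> F4" for f
  proof -
    consider "f \<in> F1" | "f \<in> F2" | "f \<in> F3" | "f \<in> F4" using f by blast
    then show ?thesis
    proof cases
      case 1
      then show ?thesis unfolding F1_def singleton_iff
        by (simp only:) (intro pfun_diff pfun_mult pfun_var pfun_const UNIV_I)
    next
      case 2
      then show ?thesis using bp vi by (auto simp: F2_def)
    next
      case 3
      then obtain h where h: "h \<in> van_ideal A" "f = (\<lambda>z. dird h (bp z) (tv z))" by (auto simp: F3_def)
      have "pfun UNIV (\<lambda>z :: ('m + 'm) option \<Rightarrow> complex. (\<lambda>y. dird h (\<lambda>i. y (Inl i)) (\<lambda>i. y (Inr i))) (\<lambda>s. z (Some s)))"
        by (rule pfun_comp[OF pfun_dird[OF vi[OF h(1)]]]) (auto intro: pfun_var)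
      then show ?thesis by (simp add: h(2) bp_def tv_def)
    next
      case 4
      then obtain I H where "f = (\<lambda>z. minor I H (bp z))" "\<forall>t. H t \<in> van_ideal A" by (auto simp: F4_def)
      then show ?thesis using bp[OF pfun_minor[of H I]] vi by simp
    qed
  qed
  have G: "pfun UNIV g" if g: "g \<in> G" for g
  proof -
    obtain I H where "g = (\<lambda>z. minor I H (bp z))" "\<forall>t. H t \<in> van_ideal A" using g by (auto simp: G_def)
    then show ?thesis using bp[OF pfun_minor[of H I]] vi by simp
  qed
  have memA: "y \<in> A \<longleftrightarrow> (\<forall>f\<in>van_ideal A. f y = 0)" for y
    using A by (auto simp: van_ideal_def zcl_def van_def)
  have S: "chart A k i = {z. (\<forall>f\<in>F1 \<union> F2 \<union> F3 \<union> F4. f z = 0) \<and> (\<exists>g\<in>G. g z \<noteq> 0)}"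
  proof (rule set_eqI)
    fix z
    have 1: "(\<forall>f\<in>F1. f z = 0) \<longleftrightarrow> z None * z (Some (Inl i)) = 1" by (auto simp: F1_def)
    have 2: "(\<forall>f\<in>F2. f z = 0) \<longleftrightarrow> bp z \<in> A" by (auto simp: F2_def memA)
    have 3: "(\<forall>f\<in>F3. f z = 0) \<longleftrightarrow> tang A UNIV (bp z) (tv z)" by (auto simp: F3_def tang_def van_ideal_def)
    have 4: "(\<forall>f\<in>F4. f z = 0) \<and> (\<exists>g\<in>G. g z \<noteq> 0) \<longleftrightarrow> vec.dim (tset A (bp z)) = k"
      unfolding dim_tset_eq_iff F4_def G_def
      by (simp only: ball_simps bex_simps split_paired_Ball_Sigma split_paired_Bex_Sigma mem_Collect_eq case_prod_conv
          Ball_Collect[symmetric] split_beta) (simp add: imp_conjL)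
    have 5: "z \<in> chart A k i \<longleftrightarrow> z None * z (Some (Inl i)) = 1 \<and> bp z \<in> A \<and>
        vec.dim (tset A (bp z)) = k \<and> tang A UNIV (bp z) (tv z)"
      by (simp only: chart_def bp_def tv_def mem_Collect_eq)
    show "z \<in> chart A k i \<longleftrightarrow> z \<in> {z. (\<forall>f\<in>F1 \<union> F2 \<union> F3 \<union> F4. f z = 0) \<and> (\<exists>g\<in>G. g z \<noteq> 0)}"
      unfolding 5 mem_Collect_eq ball_Un 1 2 3 using 4 by blast
  qed
  from closure_locally_closed[OF F G S z0 \<epsilon>] show ?thesis .
qed

lemma algebraic_C4_inf:
  fixes X :: "(complex^'m::finite) set"
  assumes X: "algebraic_set X" and k: "pure_dim X k"
  shows "algebraic_set (C4_inf X)"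
proof -
  \<comment> \<open>Only the inverse coordinate and the tangent vector are kept; the base point is
    projected away.\<close>
  define V :: "('m + 'm) option set" where "V = insert None (range (Some \<circ> Inr))"
  \<comment> \<open>\<open>None\<close> is 0, the value at infinity. The base point entries are
    fillers, since \<open>V\<close> does not contain them.\<close>
  define pt :: "('m \<Rightarrow> complex) \<Rightarrow> ('m + 'm) option \<Rightarrow> complex" where "pt y = case_option 0 (case_sum (\<lambda>_. 0) y)" for y
  define C where "C i = {v. pt (vec_nth v) \<in> zcl V (chart (fn X) k i)}" for i
  have alg: "algebraic_set (C i)" for i
  proof -
    have "y \<in> fn (C i)" if y: "y \<in> zcl UNIV (fn (C i))" for y
    proof -
      have "pt y \<in> zcl V (chart (fn X) k i)"
      proof (rule zclI)
        fix f assume f: "pfun V f" "van (chart (fn X) k i) f"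
        have "pfun UNIV (\<lambda>y. f (pt y))"
        proof (rule pfun_comp[OF f(1)])
          fix s assume "s \<in> V"
          then consider "s = None" | j where "s = Some (Inr j)" by (auto simp: V_def)
          then show "pfun UNIV (\<lambda>y. pt y s)"
            by cases (simp_all add: pt_def pfun_const pfun_var)
        qed
        moreover have "van (fn (C i)) (\<lambda>y. f (pt y))"
          using f by (auto simp: van_fn C_def dest: zclD)
        ultimately show "f (pt y) = 0" by (rule zclD[OF y])
      qed
      then show ?thesis by (simp add: mem_fn_iff C_def)
    qed
    then show ?thesis unfolding algebraic_set_iff using subset_zcl by blast
  qed
  have reg: "p \<in> X - Sing X \<longleftrightarrow> vec_nth p \<in> fn X \<and> vec.dim (tset (fn X) (vec_nth p)) = k" for p
    by (simp only: regular_iff[OF X k] mem_fn tangent_space_tset)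
  \<comment> \<open>From left to right this is the density of the chart in its Zariski closure: a
    small \<open>None\<close> forces a large coordinate. The converse needs only the continuity of
    polynomials along an escaping sequence.\<close>
  have Ciff: "(v \<in> C i) \<longleftrightarrow> (\<forall>\<epsilon>>0. \<exists>p\<in>X - Sing X. \<exists>w\<in>tangent_space X p.
     cmod (p $ i) > 1 / \<epsilon> \<and> (\<forall>j. cmod (w $ j - v $ j) < \<epsilon>))" (is "_ \<longleftrightarrow> ?R") for v i
  proof
    assume v: "v \<in> C i"
    show ?R
    proof (intro allI impI)
      fix \<epsilon> :: real assume \<epsilon>: "\<epsilon> > 0"
      have "zcl UNIV (fn X) = fn X" using X by (simp add: algebraic_set_iff)
      from chart_closure[OF this _ \<epsilon>] v obtain z where z: "z \<in> chart (fn X) k i"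
        "\<forall>j\<in>V. cmod (z j - pt (vec_nth v) j) < \<epsilon>" unfolding C_def by blast
      define p where "p = vec_lambda (\<lambda>j. z (Some (Inl j)))"
      define w where "w = vec_lambda (\<lambda>j. z (Some (Inr j)))"
      have zp: "z None * p $ i = 1" "vec_nth p \<in> fn X" "vec.dim (tset (fn X) (vec_nth p)) = k"
        "tang (fn X) UNIV (vec_nth p) (vec_nth w)" using z(1) by (simp_all add: chart_def p_def w_def)
      have "cmod (z None) < \<epsilon>" using z(2) by (auto simp: V_def pt_def)
      moreover have "cmod (z None) * cmod (p $ i) = 1" using zp(1) by (metis norm_mult norm_one)
      moreover have "cmod (p $ i) > 0" using zp(1) by auto
      ultimately have "1 < \<epsilon> * cmod (p $ i)" using mult_strict_right_mono by metis
      then have "cmod (p $ i) > 1 / \<epsilon>" using \<epsilon> by (simp add: field_simps)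
      moreover have "cmod (w $ j - v $ j) < \<epsilon>" for j
        using z(2)[rule_format, of "Some (Inr j)"] by (simp add: V_def pt_def w_def)
      moreover have "p \<in> X - Sing X" using zp reg by blast
      moreover have "w \<in> tangent_space X p" using zp(4) by (simp add: tangent_space_iff)
      ultimately show "\<exists>p\<in>X - Sing X. \<exists>w\<in>tangent_space X p. cmod (p $ i) > 1 / \<epsilon> \<and> (\<forall>j. cmod (w $ j - v $ j) < \<epsilon>)"
        by blast
    qed
  next
    assume R: ?R
    from escaping_sequence[OF R] obtain p w where pw: "\<And>n. p n \<in> X - Sing X"
      "\<And>n. w n \<in> tangent_space X (p n)" "\<And>n. cmod (p n $ i) > real (Suc n)" "w \<longlonglongrightarrow> v" by blast
    define z where "z n = case_option (inverse (p n $ i)) (case_sum (vec_nth (p n)) (vec_nth (w n)))" for n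
    have zc: "z n \<in> chart (fn X) k i" for n
    proof -
      have "p n $ i \<noteq> 0" using pw(3)[of n] by auto
      then show ?thesis using pw(1)[of n] pw(2)[of n] reg by (simp add: chart_def z_def tangent_space_iff)
    qed
    have "pt (vec_nth v) \<in> zcl V (chart (fn X) k i)"
    proof (rule zcl_tendsto[of z])
      show "z n \<in> zcl V (chart (fn X) k i)" for n using zc subset_zcl by blast
      fix s assume "s \<in> V"
      then consider "s = None" | j where "s = Some (Inr j)" by (auto simp: V_def)
      then show "(\<lambda>n. z n s) \<longlonglongrightarrow> pt (vec_nth v) s"
      proof cases
        case 1
        have "cmod (inverse (p n $ i)) \<le> inverse (real (Suc n))" for n
          using pw(3)[of n] by (simp add: norm_inverse le_imp_inverse_le)
        then have "(\<lambda>n. inverse (p n $ i)) \<longlonglongrightarrow> 0"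
          by (intro Lim_null_comparison[OF always_eventually LIMSEQ_inverse_real_of_nat]) auto
        then show ?thesis by (simp add: 1 z_def pt_def)
      next
        case 2
        then show ?thesis using tendsto_vec_nth[OF pw(4)] by (simp add: z_def pt_def)
      qed
    qed
    then show "v \<in> C i" by (simp add: C_def)
  qed
  have "C4_inf X = (\<Union>i. C i)"
    by (rule set_eqI) (simp only: C4_inf_iff UN_iff Ciff bex_UNIV)
  then show ?thesis using algebraic_set_UN[of C, OF alg] by simp
qed

section \<open>The upper bound for the dimension\<close>

lemma tangent_bundle_dependent:
  fixes A :: "('m::finite \<Rightarrow> complex) set"
  assumes I: "card I > 2 * k"
  shows "\<exists>h. pfun I h \<and> h \<noteq> 0 \<and> (\<forall>p v. p \<in> A \<longrightarrow> vec.dim (tset A p) = k \<longrightarrow> tang A UNIV p v \<longrightarrow> h v = 0)"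
proof -
  define TX where "TX = {z :: 'm + 'm \<Rightarrow> complex. (\<lambda>i. z (Inl i)) \<in> A \<and> vec.dim (tset A (\<lambda>i. z (Inl i))) = k \<and>
     tang A UNIV (\<lambda>i. z (Inl i)) (\<lambda>i. z (Inr i))}"
  from irr_decomposition[of TX] obtain \<A> where \<A>: "finite \<A>" "TX = \<Union>\<A>" "\<forall>B\<in>\<A>. irr B" by (elim exE conjE)
  have "\<forall>B\<in>\<A>. \<exists>Q. pfun (Inr ` I) Q \<and> van B Q \<and> Q \<noteq> 0"
  proof
    fix B assume B: "B \<in> \<A>"
    have BT: "B \<subseteq> TX" "irr B" using B \<A> by auto
    \<comment> \<open>Independent coordinates extend to a transcendence basis \<open>J\<close> of
      \<open>B\<close>, and at a generic point the tangent space of \<open>B\<close> has dimension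
      \<open>card J\<close>; so it suffices to bound that dimension by \<open>2 * k\<close>.\<close>
    have "\<not> indep_on (Inr ` I) B"
    proof
      assume "indep_on (Inr ` I) B"
      from indep_on_maximal[OF this] obtain J where J: "Inr ` I \<subseteq> J" "indep_on J B"
        "\<And>t. t \<notin> J \<Longrightarrow> \<not> indep_on (insert t J) B" by blast
      from generic_dim[OF BT(2) J(2,3)] obtain L where L: "\<not> van B L"
        "\<And>y. y \<in> zcl UNIV B \<Longrightarrow> L y \<noteq> 0 \<Longrightarrow> vec.dim (tset B y) = card J" by blast
      then obtain z where z: "z \<in> B" "L z \<noteq> 0" by (auto simp: van_def)
      then have dJ: "vec.dim (tset B z) = card J" using L(2) subset_zcl by blast
      define p where "p = (\<lambda>i. z (Inl i))"
      define v where "v = (\<lambda>i. z (Inr i))"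
      have zT: "p \<in> A" "vec.dim (tset A p) = k" "tang A UNIV p v"
        using z(1) BT(1) by (auto simp: TX_def p_def v_def)
      obtain I0 F where I0: "card I0 = k" "\<forall>t. F t \<in> van_ideal A" "minor I0 F p \<noteq> 0"
        using minor_exists[of A p] zT(2) by blast
      \<comment> \<open>\<open>I0\<close> are coordinates that determine tangent vectors of
        \<open>A\<close> at \<open>p\<close>. Using them in both blocks forces first the base part
        \<open>a\<close> and then the vector part \<open>b\<close> to vanish.\<close>
      define K where "K = (Inl ` I0 \<union> Inr ` I0 :: ('m + 'm) set)"
      have "vec.dim (tset B z) \<le> card K"
      proof (rule dim_le_card_coordinates[OF subspace_tset])
        fix u assume u: "u \<in> tset B z" "\<forall>i\<in>K. u $ i = 0"
        define a where "a = vec_lambda (\<lambda>i. u $ Inl i)"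
        define b where "b = vec_lambda (\<lambda>i. u $ Inr i)"
        have ab0: "\<forall>i\<in>I0. a $ i = 0" "\<forall>i\<in>I0. b $ i = 0" using u(2) by (auto simp: a_def b_def K_def)
        have ut: "dird f z (vec_nth u) = 0" if "pfun UNIV f" "van B f" for f
          using u(1) that by (simp add: tset_def tang_def)
        have "a \<in> tset A p" unfolding tset_def tang_def
        proof (intro CollectI allI impI)
          fix f assume f: "pfun UNIV f" "van A f"
          have "van B (\<lambda>z. f (\<lambda>i. z (Inl i)))" using BT(1) f(2) by (auto simp: van_def TX_def)
          moreover have "pfun UNIV (\<lambda>z :: 'm + 'm \<Rightarrow> complex. f (\<lambda>i. z (Inl i)))"
            by (rule pfun_comp[OF f(1)]) (auto intro: pfun_var)
          ultimately have "dird (\<lambda>z. f (\<lambda>i. z (Inl i))) z (vec_nth u) = 0" by (intro ut)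
          then show "dird f p (vec_nth a) = 0" by (simp add: dird_def p_def a_def)
        qed
        then have a: "a = 0" using minor_inj[of F A I0 p a] I0 ab0(1) by blast
        have "b \<in> tset A p" unfolding tset_def tang_def
        proof (intro CollectI allI impI)
          fix f assume f: "pfun UNIV f" "van A f"
          \<comment> \<open>The tangency equation itself vanishes on \<open>B\<close>. Because
            \<open>a = 0\<close>, it is affine along \<open>u\<close>, and its slope is the
            derivative of \<open>f\<close> at \<open>p\<close> along \<open>b\<close>.\<close>
          define g :: "('m + 'm \<Rightarrow> complex) \<Rightarrow> complex" where "g = (\<lambda>z. dird f (\<lambda>i. z (Inl i)) (\<lambda>i. z (Inr i)))"
          have "van B g" using BT(1) f by (auto simp: van_def TX_def g_def tang_def)
          moreover have "pfun UNIV g" unfolding g_def using pfun_dird[OF f(1)] by (rule pfun_mono) simp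
          ultimately have "dird g z (vec_nth u) = 0" by (intro ut)
          moreover have "g (\<lambda>i. z i + s * u $ i) = dird f p v + s * dird f p (vec_nth b)" for s
          proof -
            have "u $ Inl i = 0" for i using a by (simp add: a_def vec_eq_iff)
            then have "g (\<lambda>i. z i + s * u $ i) = dird f p (\<lambda>i. s * b $ i + v i)"
              by (simp add: g_def p_def v_def b_def add.commute)
            then show ?thesis using dird_linear[OF f(1), of p s "vec_nth b" v] by (simp add: add.commute)
          qed
          then have "dird g z (vec_nth u) = dird f p (vec_nth b)"
            unfolding dird_def[of g] by (intro DERIV_imp_deriv) (auto intro!: derivative_eq_intros)
          ultimately show "dird f p (vec_nth b) = 0" by simp
        qed
        then have b: "b = 0" using minor_inj[of F A I0 p b] I0 ab0(2) by blast
        have "u $ s = 0" for s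
          using a b by (cases s) (auto simp: a_def b_def vec_eq_iff)
        then show "u = 0" by (simp add: vec_eq_iff)
      qed
      also have "card K \<le> card (Inl ` I0 :: ('m + 'm) set) + card (Inr ` I0 :: ('m + 'm) set)" unfolding K_def by (rule card_Un_le)
      also have "\<dots> = 2 * k" using I0(1) by (simp add: card_image)
      finally have "card J \<le> 2 * k" using dJ by simp
      moreover have "card (Inr ` I :: ('m + 'm) set) \<le> card J" using J(1) by (intro card_mono) auto
      ultimately show False using I by (simp add: card_image)
    qed
    then show "\<exists>Q. pfun (Inr ` I) Q \<and> van B Q \<and> Q \<noteq> 0" unfolding indep_on_def by blast
  qed
  from bchoice[OF this] obtain Q where Q: "\<forall>B\<in>\<A>. pfun (Inr ` I) (Q B) \<and> van B (Q B) \<and> Q B \<noteq> 0" by (elim exE)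
  then obtain h x where h: "pfun (Inr ` I) h" "h x \<noteq> 0" "\<And>B y. B \<in> \<A> \<Longrightarrow> Q B y = 0 \<Longrightarrow> h y = 0"
    using pfun_family_nonzero[OF \<A>(1), of "Inr ` I" Q] by blast
  define h' where "h' w = h (case_sum (\<lambda>_. 0) w)" for w
  have h': "h z = h' (\<lambda>i. z (Inr i))" for z
    unfolding h'_def by (rule pfun_cong[OF h(1)]) auto
  show ?thesis
  proof (intro exI[of _ h'] conjI allI impI)
    show "pfun I h'" unfolding h'_def by (rule pfun_comp[OF h(1)]) (auto intro: pfun_var)
    show "h' \<noteq> 0" using h(2) h'[of x] by auto
    fix p v assume pv: "p \<in> A" "vec.dim (tset A p) = k" "tang A UNIV p v"
    define z where "z = case_sum p v"
    have "z \<in> TX" using pv by (simp add: TX_def z_def)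
    then obtain B where "B \<in> \<A>" "z \<in> B" using \<A>(2) by blast
    then have "h z = 0" using Q h(3) by (auto simp: van_def)
    then show "h' v = 0" using h'[of z] by (simp add: z_def)
  qed
qed

text \<open>More than \<open>2 * k\<close> coordinates of a tangent vector satisfy a polynomial
  relation not mentioning the base point, so by continuity the relation holds for limits even though
  the base points diverge.\<close>

lemma alg_dim_C4_inf_le:
  fixes X :: "(complex^'m::finite) set"
  assumes X: "algebraic_set X" and k: "pure_dim X k"
  shows "alg_dim (C4_inf X) \<le> enat (2 * k)"
proof (rule alg_dim_le)
  fix Z I assume Z: "irreducible_algebraic Z" "Z \<subseteq> C4_inf X" "indep_on I (fn Z)"
  show "card I \<le> 2 * k"
  proof (rule ccontr)
    assume "\<not> card I \<le> 2 * k"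
    then have "card I > 2 * k" by simp
    from tangent_bundle_dependent[OF this, of "fn X"] obtain h where h: "pfun I h" "h \<noteq> 0"
      "\<And>p v. p \<in> fn X \<Longrightarrow> vec.dim (tset (fn X) p) = k \<Longrightarrow> tang (fn X) UNIV p v \<Longrightarrow> h v = 0" by blast
    have "h (vec_nth v) = 0" if v: "v \<in> Z" for v
    proof -
      from v Z(2) obtain p w where pw: "\<And>j. p j \<in> X - Sing X" "\<And>j. w j \<in> tangent_space X (p j)" "w \<longlonglongrightarrow> v"
        unfolding C4_inf_def by blast
      have "h (vec_nth (w j)) = 0" for j
        using pw(1)[of j] pw(2)[of j] unfolding regular_iff[OF X k] tangent_space_iff
        by (intro h(3)[of "vec_nth (p j)"]) (auto simp flip: tangent_space_tset)
      moreover have "(\<lambda>j. h (vec_nth (w j))) \<longlonglongrightarrow> h (vec_nth v)"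
        by (intro pfun_tendsto[OF h(1)] tendsto_vec_nth pw(3))
      ultimately show ?thesis by (simp add: LIMSEQ_const_iff)
    qed
    then have "van (fn Z) h" by (simp add: van_fn)
    with indep_onD[OF Z(3) h(1)] h(2) show False by blast
  qed
qed

section \<open>The lower bound for the dimension\<close>

lemma tset_component:
  assumes X: "X = \<Union>\<Z>" and Z: "Z \<in> \<Z>" and h: "pfun UNIV h" "\<And>W. W \<in> \<Z> \<Longrightarrow> W \<noteq> Z \<Longrightarrow> van (fn W) h"
    and y: "y \<in> fn Z" "h y \<noteq> 0"
  shows "tset (fn X) y = tset (fn Z) y"
proof -
  have ZX: "fn Z \<subseteq> fn X" using X Z by (auto simp: fn_subset)
  have "tang (fn X) UNIV y v \<longleftrightarrow> tang (fn Z) UNIV y v" for v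
  proof
    assume v: "tang (fn X) UNIV y v"
    show "tang (fn Z) UNIV y v" unfolding tang_def
    proof (intro allI impI)
      fix f assume f: "pfun UNIV f" "van (fn Z) f"
      \<comment> \<open>Multiplying by \<open>h\<close> extends a relation on \<open>Z\<close> to
        all of \<open>X\<close>. At \<open>y\<close> the product rule leaves only \<open>h y\<close>
        times the derivative of \<open>f\<close>, because \<open>f y = 0\<close>.\<close>
      have "f x * h x = 0" if "x \<in> fn X" for x
      proof -
        from that obtain W where W: "W \<in> \<Z>" "x \<in> fn W" unfolding X by (auto simp: fn_def)
        show ?thesis
        proof (cases "W = Z")
          case True
          then show ?thesis using f(2) W(2) by (simp add: van_def)
        next
          case False
          then show ?thesis using h(2)[OF W(1)] W(2) by (simp add: van_def)
        qed
      qed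
      then have "van (fn X) (\<lambda>x. f x * h x)" by (simp add: van_def)
      with v pfun_mult[OF f(1) h(1)] have "dird (\<lambda>x. f x * h x) y v = 0" by (simp add: tang_def)
      moreover have "f y = 0" using f(2) y(1) by (simp add: van_def)
      ultimately show "dird f y v = 0" using y(2) by (simp add: dird_mult[OF f(1) h(1)])
    qed
  next
    assume v: "tang (fn Z) UNIV y v"
    show "tang (fn X) UNIV y v" unfolding tang_def
    proof (intro allI impI)
      fix f assume f: "pfun UNIV f" "van (fn X) f"
      have "van (fn Z) f" using f(2) ZX by (auto simp: van_def)
      with v f(1) show "dird f y v = 0" by (simp add: tang_def)
    qed
  qed
  then show ?thesis by (simp add: tset_def)
qed

text \<open>On an unbounded component the points off all other components and with tangent space of
  dimension \<open>k\<close> are generic, hence found near every point, in particular near points of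
  large norm.\<close>

lemma regular_points_unbounded:
  fixes X :: "(complex^'m::finite) set"
  assumes X: "algebraic_set X" and k: "pure_dim X k" and nb: "\<not> bounded X"
  shows "\<exists>p\<in>X - Sing X. norm p > R"
proof -
  from component_exists[OF X] obtain \<Z> where
    Z: "finite \<Z>" "X = \<Union>\<Z>" "\<forall>Z\<in>\<Z>. irreducible_component Z X" by (elim exE conjE)
  obtain Z where ZZ: "Z \<in> \<Z>" "\<not> bounded Z" using nb bounded_Union[OF Z(1)] Z(2) by auto
  then have comp: "irreducible_component Z X" using Z(3) by blast
  then have irrZ: "irreducible_algebraic Z" and max: "\<And>W. irreducible_algebraic W \<Longrightarrow> Z \<subseteq> W \<Longrightarrow> W \<subseteq> X \<Longrightarrow> W = Z"
    by (auto simp: irreducible_component_def)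
  have dZ: "alg_dim Z = enat k" using k comp by (simp add: pure_dim_def)
  have A: "irr (fn Z)" "zcl UNIV (fn Z) = fn Z" using irrZ by (auto simp: irreducible_algebraic_iff)
  from alg_dim_indep[OF irrZ dZ] obtain I where I: "card I = k" "indep_on I (fn Z)" by blast
  have Imax: "\<not> indep_on (insert t I) (fn Z)" if "t \<notin> I" for t
    using card_indep_le_alg_dim[OF irrZ subset_refl, of "insert t I"] dZ I(1) that by auto
  from generic_dim[OF A(1) I(2) Imax] obtain L where L: "pfun UNIV L" "\<not> van (fn Z) L"
    "\<And>y. y \<in> fn Z \<Longrightarrow> L y \<noteq> 0 \<Longrightarrow> vec.dim (tset (fn Z) y) = k" unfolding A(2) I(1) by blast
  have "\<forall>W\<in>\<Z> - {Z}. \<exists>f. pfun UNIV f \<and> van (fn W) f \<and> \<not> van (fn Z) f"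
  proof
    fix W assume W: "W \<in> \<Z> - {Z}"
    then have W': "irreducible_algebraic W" "W \<subseteq> X" using Z(3) by (auto simp: irreducible_component_def)
    have "\<not> Z \<subseteq> W" using max[OF W'(1) _ W'(2)] W by blast
    then obtain z where z: "z \<in> Z" "z \<notin> W" by blast
    then have "vec_nth z \<notin> zcl UNIV (fn W)" using W'(1) by (simp add: irreducible_algebraic_iff)
    then obtain f where "pfun UNIV f" "van (fn W) f" "f (vec_nth z) \<noteq> 0" unfolding zcl_def by blast
    with z show "\<exists>f. pfun UNIV f \<and> van (fn W) f \<and> \<not> van (fn Z) f" by (auto simp: van_fn)
  qed
  from bchoice[OF this] obtain f where f: "\<forall>W\<in>\<Z> - {Z}. pfun UNIV (f W) \<and> van (fn W) (f W) \<and> \<not> van (fn Z) (f W)"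
    by (elim exE)
  define h where "h = (\<lambda>x. \<Prod>W\<in>\<Z> - {Z}. f W x)"
  have h: "pfun UNIV h" unfolding h_def using f by (intro pfun_prod) blast
  have nh: "\<not> van (fn Z) h" unfolding h_def by (rule irr_prod[OF A(1)]) (use f Z(1) in auto)
  have hW: "van (fn W) h" if "W \<in> \<Z>" "W \<noteq> Z" for W
  proof (rule vanI)
    fix x assume "x \<in> fn W"
    then have "f W x = 0" using f that by (auto simp: van_def)
    then show "h x = 0" unfolding h_def using that Z(1) by (intro prod_zero) auto
  qed
  have hL: "pfun UNIV (h * L)" "\<not> van (fn Z) (h * L)"
    using pfun_times[OF h L(1)] irrD[OF A(1) h L(1)] nh L(2) by auto
  \<comment> \<open>The margin \<open>CARD('m)\<close> pays for the approximation, which moves each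
    coordinate by less than 1.\<close>
  obtain q where q: "q \<in> Z" "norm q > R + real CARD('m)" using ZZ(2) by (meson bounded_iff not_le)
  have "vec_nth q \<in> zcl UNIV (fn Z)" unfolding A(2) using q(1) by simp
  from irr_dense[OF A(1) hL this, of 1] obtain y where y: "y \<in> fn Z" "h y * L y \<noteq> 0" "\<And>v. cmod (y v - q $ v) < 1"
    unfolding A(2) by auto
  define p where "p = vec_lambda y"
  have yp: "y = vec_nth p" by (simp add: p_def)
  have "cmod ((p - q) $ i) \<le> 1" for i using y(3)[of i] by (simp add: p_def)
  from norm_le_card_mult[OF this] have "norm (p - q) \<le> real CARD('m)" by simp
  then have "norm p > R" using q(2) norm_triangle_ineq2[of q p] by (simp add: norm_minus_commute)
  moreover have "p \<in> X - Sing X"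
  proof -
    have "tset (fn X) y = tset (fn Z) y" by (rule tset_component[OF Z(2) ZZ(1) h hW y(1)]) (use y(2) in auto)
    then have "vec.dim (tangent_space X p) = k" using L(3)[OF y(1)] y(2) by (simp add: tangent_space_tset yp)
    moreover have "p \<in> X" using y(1) ZZ(1) Z(2) unfolding yp by auto
    ultimately show ?thesis using regular_iff[OF X k, of p] by blast
  qed
  ultimately show ?thesis by blast
qed

lemma hyperplane_section_dim:
  fixes T :: "(complex^'m::finite) set"
  assumes T: "vec.subspace T"
  shows "vec.subspace {w\<in>T. (\<Sum>i\<in>UNIV. w $ i * c i) = 0}"
    "vec.dim T \<le> Suc (vec.dim {w\<in>T. (\<Sum>i\<in>UNIV. w $ i * c i) = 0})"
proof -
  let ?\<phi> = "\<lambda>w :: complex^'m. \<Sum>i\<in>UNIV. w $ i * c i"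
  let ?K = "{w\<in>T. ?\<phi> w = 0}"
  have add: "?\<phi> (v + w) = ?\<phi> v + ?\<phi> w" for v w by (simp add: distrib_right sum.distrib)
  have scale: "?\<phi> (a *s w) = a * ?\<phi> w" for a w by (simp add: sum_distrib_left mult.assoc)
  show K: "vec.subspace ?K" unfolding vec.subspace_def
  proof (intro conjI ballI allI)
    show "0 \<in> ?K" using vec.subspace_0[OF T] by simp
    show "v + w \<in> ?K" if "v \<in> ?K" "w \<in> ?K" for v w
      using that vec.subspace_add[OF T] by (simp only: mem_Collect_eq add) simp
    show "a *s w \<in> ?K" if "w \<in> ?K" for a w
      using that vec.subspace_scale[OF T] by (simp only: mem_Collect_eq scale) simp
  qed
  show "vec.dim T \<le> Suc (vec.dim ?K)"
  proof (cases "T = ?K")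
    case True
    then have "vec.dim T = vec.dim ?K" by simp
    then show ?thesis by linarith
  next
    case False
    then obtain u where u: "u \<in> T" "?\<phi> u \<noteq> 0" by auto
    have "T \<subseteq> vec.span (insert u ?K)"
    proof
      fix w assume w: "w \<in> T"
      define a where "a = ?\<phi> w / ?\<phi> u"
      have "w + (- a) *s u \<in> T" using w u by (intro vec.subspace_add[OF T] vec.subspace_scale[OF T])
      moreover have "?\<phi> (w + (- a) *s u) = 0" unfolding add scale a_def using u(2) by simp
      ultimately have "w + (- a) *s u \<in> vec.span (insert u ?K)" by (intro vec.span_base) simp
      moreover have "a *s u \<in> vec.span (insert u ?K)" by (intro vec.span_scale vec.span_base) simp
      ultimately have "(w + (- a) *s u) + a *s u \<in> vec.span (insert u ?K)" by (rule vec.span_add)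
      then show "w \<in> vec.span (insert u ?K)" by (simp add: vec.scale_minus_left)
    qed
    then have "vec.dim T \<le> vec.dim (vec.span (insert u ?K))" by (rule vec.dim_subset)
    also have "\<dots> \<le> Suc (vec.dim ?K)" by (simp add: vec.dim_insert)
    finally show ?thesis .
  qed
qed

text \<open>Each orthogonality condition lowers the dimension by at most one, so a nonzero solution
  remains and can be normalized.\<close>

lemma orthogonal_vector_exists:
  fixes T :: "(complex^'m::finite) set"
  assumes "finite B" "vec.subspace T" "card B < vec.dim T"
  shows "\<exists>w\<in>T. norm w = 1 \<and> (\<forall>b\<in>B. (\<Sum>i\<in>UNIV. w $ i * cnj (b $ i)) = 0)"
  using assms
proof (induction B arbitrary: T rule: finite_induct)
  case empty
  have "T \<noteq> {0}" using empty by auto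
  then obtain w where w: "w \<in> T" "w \<noteq> 0" using vec.subspace_0[OF empty(1)] by auto
  have "(of_real (1 / norm w) :: complex) *s w = (1 / norm w) *\<^sub>R w"
    by (simp only: vec_eq_iff vector_scaleR_component vector_smult_component) (simp add: scaleR_conv_of_real)
  moreover have "(of_real (1 / norm w) :: complex) *s w \<in> T" by (rule vec.subspace_scale[OF empty(1) w(1)])
  ultimately show ?case using w(2) by (intro bexI[of _ "(1 / norm w) *\<^sub>R w"]) auto
next
  case (insert b B)
  define K where "K = {w\<in>T. (\<Sum>i\<in>UNIV. w $ i * cnj (b $ i)) = 0}"
  have K: "vec.subspace K" "vec.dim T \<le> Suc (vec.dim K)"
    unfolding K_def using hyperplane_section_dim[OF insert.prems(1), of "\<lambda>i. cnj (b $ i)"] by auto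
  have "card B < vec.dim K" using insert K(2) by simp
  from insert.IH[OF K(1) this] show ?case by (auto simp: K_def)
qed

text \<open>The vectors are chosen from every \<open>T n\<close>, not just from infinitely many of
  them; the limits then form a subspace, which can only grow when passing to a subsequence.\<close>

definition limit_space :: "(nat \<Rightarrow> (complex^'m::finite) set) \<Rightarrow> (complex^'m) set" where
  "limit_space T = {v. \<exists>w. (\<forall>n. w n \<in> T n) \<and> w \<longlonglongrightarrow> v}"

lemma subspace_limit_space:
  assumes T: "\<And>n. vec.subspace (T n)"
  shows "vec.subspace (limit_space T)"
  unfolding vec.subspace_def
proof (intro conjI ballI allI)
  show "0 \<in> limit_space T" unfolding limit_space_def
    using vec.subspace_0[OF T] by (intro CollectI exI[of _ "\<lambda>_. 0"]) auto
next
  fix x y assume "x \<in> limit_space T" "y \<in> limit_space T"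
  then obtain v w where "\<And>n. v n \<in> T n" "v \<longlonglongrightarrow> x" "\<And>n. w n \<in> T n" "w \<longlonglongrightarrow> y" by (auto simp: limit_space_def)
  then show "x + y \<in> limit_space T" unfolding limit_space_def
    using vec.subspace_add[OF T] by (intro CollectI exI[of _ "\<lambda>n. v n + w n"]) (auto intro: tendsto_add)
next
  fix c x assume "x \<in> limit_space T"
  then obtain v where v: "\<And>n. v n \<in> T n" "v \<longlonglongrightarrow> x" by (auto simp: limit_space_def)
  have "(\<lambda>n. c *s v n) \<longlonglongrightarrow> c *s x"
    by (rule vec_tendstoI) (simp add: tendsto_mult tendsto_vec_nth[OF v(2)])
  then show "c *s x \<in> limit_space T" unfolding limit_space_def
    using vec.subspace_scale[OF T v(1)] by (intro CollectI exI[of _ "\<lambda>n. c *s v n"]) auto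
qed

text \<open>Compactness of the Grassmannian: a subsequence whose limit space has maximal dimension works, since
  otherwise unit tangent vectors orthogonal to that space would enlarge it.\<close>

lemma limit_space_dim:
  fixes T :: "nat \<Rightarrow> (complex^'m::finite) set"
  assumes T: "\<And>n. vec.subspace (T n)" and k: "\<And>n. k \<le> vec.dim (T n)"
  shows "\<exists>s. strict_mono s \<and> k \<le> vec.dim (limit_space (T \<circ> s))"
proof -
  define d where "d s = vec.dim (limit_space (T \<circ> s))" for s
  have bd: "d s \<le> CARD('m)" for s 
    unfolding d_def using vec.dim_subset[OF subset_UNIV, of "limit_space (T \<circ> s)"] by (simp only: vec_dim_card)
  have "\<exists>s. strict_mono s \<and> (\<forall>r. strict_mono r \<longrightarrow> d r \<le> d s)"
    using ex_has_greatest_nat[of "\<lambda>s::nat\<Rightarrow>nat. strict_mono s" id d "Suc CARD('m)"] bd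
    by (auto simp: strict_mono_id less_Suc_eq_le)
  then obtain s where s: "strict_mono s" "\<And>r. strict_mono r \<Longrightarrow> d r \<le> d s" by blast
  have "k \<le> d s"
  proof (rule ccontr)
    assume "\<not> k \<le> d s"
    then have lt: "d s < k" by simp
    have Ts: "vec.subspace (limit_space (T \<circ> r))" for r by (rule subspace_limit_space) (simp add: T)
    obtain B where B: "B \<subseteq> limit_space (T \<circ> s)" "vec.independent B" "limit_space (T \<circ> s) \<subseteq> vec.span B"
      "card B = d s" unfolding d_def using vec.basis_exists by metis
    have fB: "finite B" by (rule vec.finiteI_independent[OF B(2)])
    have "\<exists>w\<in>T (s n). norm w = 1 \<and> (\<forall>b\<in>B. (\<Sum>i\<in>UNIV. w $ i * cnj (b $ i)) = 0)" for n
      by (rule orthogonal_vector_exists[OF fB T]) (use B(4) lt k[of "s n"] in simp)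
    then obtain w where w: "\<And>n. w n \<in> T (s n)" "\<And>n. norm (w n) = 1"
      "\<And>n b. b \<in> B \<Longrightarrow> (\<Sum>i\<in>UNIV. w n $ i * cnj (b $ i)) = 0" by metis
    have "bounded (range w)" using w(2) by (auto simp: bounded_iff)
    then obtain x r where x: "strict_mono r" "(w \<circ> r) \<longlonglongrightarrow> x" using bounded_imp_convergent_subsequence by blast
    have sr: "strict_mono (s \<circ> r)" by (rule strict_mono_o[OF s(1) x(1)])
    have "x \<in> limit_space (T \<circ> (s \<circ> r))" unfolding limit_space_def using w(1) x(2)
      by (intro CollectI exI[of _ "w \<circ> r"]) auto
    moreover have sub: "limit_space (T \<circ> s) \<subseteq> limit_space (T \<circ> (s \<circ> r))"
    proof
      fix v assume "v \<in> limit_space (T \<circ> s)"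
      then obtain u where u: "\<And>n. u n \<in> T (s n)" "u \<longlonglongrightarrow> v" by (auto simp: limit_space_def)
      then show "v \<in> limit_space (T \<circ> (s \<circ> r))" unfolding limit_space_def
        using LIMSEQ_subseq_LIMSEQ[OF u(2) x(1)] by (intro CollectI exI[of _ "u \<circ> r"]) auto
    qed
    moreover have "x \<notin> limit_space (T \<circ> s)"
    proof
      assume "x \<in> limit_space (T \<circ> s)"
      then have xB: "x \<in> vec.span B" using B(3) by auto
      have orth: "(\<Sum>i\<in>UNIV. x $ i * cnj (b $ i)) = 0" if b: "b \<in> B" for b
      proof -
        have "(\<lambda>n. \<Sum>i\<in>UNIV. (w \<circ> r) n $ i * cnj (b $ i)) \<longlonglongrightarrow> (\<Sum>i\<in>UNIV. x $ i * cnj (b $ i))"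
          by (intro tendsto_intros x(2))
        then show ?thesis using w(3)[OF b] by (simp add: LIMSEQ_const_iff)
      qed
      have "(\<Sum>i\<in>UNIV. x $ i * cnj (y $ i)) = 0" if "y \<in> vec.span B" for y
        using that
      proof (induction rule: vec.span_induct_alt)
        case (step c b y)
        have "(\<Sum>i\<in>UNIV. x $ i * cnj ((c *s b + y) $ i)) =
          cnj c * (\<Sum>i\<in>UNIV. x $ i * cnj (b $ i)) + (\<Sum>i\<in>UNIV. x $ i * cnj (y $ i))"
          by (simp add: distrib_left sum.distrib sum_distrib_left mult_ac)
        then show ?case using orth[OF step(1)] step(2) by simp
      qed simp
      from this[OF xB] have "(\<Sum>i\<in>UNIV. complex_of_real ((cmod (x $ i))\<^sup>2)) = 0"
        by (simp only: complex_norm_square)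
      then have "(\<Sum>i\<in>UNIV. (cmod (x $ i))\<^sup>2) = 0" by (simp only: of_real_sum[symmetric] of_real_eq_0_iff)
      then have "x = 0" by (simp add: sum_nonneg_eq_0_iff vec_eq_iff)
      moreover have "norm x = 1"
        using tendsto_norm[OF x(2)] w(2) by (simp add: LIMSEQ_const_iff)
      ultimately show False by simp
    qed
    ultimately have "limit_space (T \<circ> s) \<noteq> limit_space (T \<circ> (s \<circ> r))" by blast
    with vec.subspace_dim_equal[OF Ts Ts sub] have "\<not> d (s \<circ> r) \<le> d s" unfolding d_def by blast
    with s(2)[OF sr] show False by simp
  qed
  with s(1) show ?thesis unfolding d_def by blast
qed

text \<open>A subspace is irreducible and contained in its own tangent space at each of its points.
  Comparison at a generic point bounds its linear dimension by the transcendence degree of its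
  closure, which lies in \<open>C\<close>.\<close>

lemma dim_subspace_le_alg_dim:
  fixes S :: "(complex^'m::finite) set"
  assumes S: "vec.subspace S" and C: "algebraic_set C" "S \<subseteq> C"
  shows "enat (vec.dim S) \<le> alg_dim C"
proof -
  have "irr (fn S)"
  proof (rule irr_affine)
    show "fn S \<noteq> {}" using vec.subspace_0[OF S] by (auto simp: fn_def)
    fix a b s assume "a \<in> fn S" "b \<in> fn S"
    then obtain v w where vw: "v \<in> S" "w \<in> S" "a = vec_nth v" "b = vec_nth w" by (auto simp: fn_def)
    have "v + s *s (w - v) \<in> S" using vw(1,2) by (intro vec.subspace_add[OF S] vec.subspace_scale[OF S] vec.subspace_diff[OF S])
    moreover have "(\<lambda>i. a i + s * (b i - a i)) = vec_nth (v + s *s (w - v))" by (rule ext) (simp add: vw(3,4) right_diff_distrib)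
    ultimately show "(\<lambda>i. a i + s * (b i - a i)) \<in> fn S" by simp
  qed
  obtain J where J: "indep_on J (fn S)" "\<And>t. t \<notin> J \<Longrightarrow> \<not> indep_on (insert t J) (fn S)"
    using indep_on_maximal[OF indep_on_empty] \<open>irr (fn S)\<close> by (metis irr_def)
  from generic_dim[OF \<open>irr (fn S)\<close> J] obtain L where L: "\<not> van (fn S) L"
    "\<And>y. y \<in> zcl UNIV (fn S) \<Longrightarrow> L y \<noteq> 0 \<Longrightarrow> vec.dim (tset (fn S) y) = card J" by blast
  then obtain u where u: "u \<in> S" "L (vec_nth u) \<noteq> 0" by (auto simp: van_fn)
  have "vec_nth u \<in> zcl UNIV (fn S)" using u(1) subset_zcl[of "fn S" UNIV] by auto
  from L(2)[OF this u(2)] have dJ: "vec.dim (tset (fn S) (vec_nth u)) = card J" .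
  have "S \<subseteq> tset (fn S) (vec_nth u)"
  proof
    fix v assume v: "v \<in> S"
    show "v \<in> tset (fn S) (vec_nth u)" unfolding tset_def tang_def
    proof (intro CollectI allI impI)
      fix f assume f: "van (fn S) f"
      have "f (\<lambda>i. u $ i + s * v $ i) = 0" for s
      proof -
        have "u + s *s v \<in> S" using u(1) v by (intro vec.subspace_add[OF S] vec.subspace_scale[OF S])
        then have "f (vec_nth (u + s *s v)) = 0" using f by (simp only: van_fn)
        moreover have "vec_nth (u + s *s v) = (\<lambda>i. u $ i + s * v $ i)" by (rule ext) simp
        ultimately show ?thesis by simp
      qed
      then show "dird f (vec_nth u) (vec_nth v) = 0" by (simp add: dird_def)
    qed
  qed
  then have "vec.dim S \<le> card J" using vec.dim_subset dJ by metis
  define Z where "Z = vec_lambda ` zcl UNIV (fn S)"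
  have fZ: "fn Z = zcl UNIV (fn S)" by (auto simp: Z_def fn_def image_image)
  have "irreducible_algebraic Z" using irr_zcl[OF \<open>irr (fn S)\<close>] by (simp add: irreducible_algebraic_iff fZ)
  moreover have "Z \<subseteq> C"
  proof -
    have "zcl UNIV (fn S) \<subseteq> zcl UNIV (fn C)" by (rule zcl_mono) (simp add: fn_subset C)
    then show ?thesis using C(1) by (simp add: algebraic_set_iff fZ flip: fn_subset)
  qed
  moreover have "indep_on J (fn Z)" using J(1) by (simp add: fZ indep_on_zcl)
  ultimately have "enat (card J) \<le> alg_dim C" by (rule card_indep_le_alg_dim)
  with \<open>vec.dim S \<le> card J\<close> show ?thesis by (metis enat_ord_simps(1) order_trans)
qed

lemma le_alg_dim_C4_inf:
  fixes X :: "(complex^'m::finite) set"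
  assumes X: "algebraic_set X" and k: "pure_dim X k" and nb: "\<not> bounded X"
  shows "enat k \<le> alg_dim (C4_inf X)"
proof -
  have "\<forall>n::nat. \<exists>p. p \<in> X - Sing X \<and> norm p > real n" using regular_points_unbounded[OF X k nb] by blast
  then obtain p where p: "\<And>n. p n \<in> X - Sing X" "\<And>n. norm (p n) > real n" by metis
  define T where "T n = tangent_space X (p n)" for n
  have T: "vec.subspace (T n)" "vec.dim (T n) = k" for n
    using p(1)[of n] unfolding T_def regular_iff[OF X k] by (simp_all add: tangent_space_tset subspace_tset)
  then obtain s where s: "strict_mono s" "k \<le> vec.dim (limit_space (T \<circ> s))"
    using limit_space_dim[of T k] by auto
  have inf: "filterlim (\<lambda>n. norm (p n)) at_top sequentially"
    by (rule filterlim_at_top_mono[OF filterlim_real_sequentially]) (auto intro: always_eventually less_imp_le p(2))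
  have "limit_space (T \<circ> s) \<subseteq> C4_inf X"
  proof
    fix v assume "v \<in> limit_space (T \<circ> s)"
    then obtain w where w: "\<And>n. w n \<in> T (s n)" "w \<longlonglongrightarrow> v" by (auto simp: limit_space_def)
    have "filterlim (\<lambda>n. norm (p (s n))) at_top sequentially"
      by (rule filterlim_compose[OF inf filterlim_subseq[OF s(1)]])
    then show "v \<in> C4_inf X" unfolding C4_inf_def using w p(1)
      by (intro CollectI exI[of _ "p \<circ> s"] exI[of _ w]) (auto simp: T_def)
  qed
  from dim_subspace_le_alg_dim[OF subspace_limit_space algebraic_C4_inf[OF X k] this] T(1)
  have "enat (vec.dim (limit_space (T \<circ> s))) \<le> alg_dim (C4_inf X)" by simp
  with s(2) show ?thesis by (metis enat_ord_simps(1) order_trans)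
qed

theorem proposition2p3:
  fixes X :: "(complex^'m::finite) set" and k :: nat
  assumes "algebraic_set X" and "pure_dim X k" and "\<not> bounded X"
  shows "algebraic_set (C4_inf X) \<and> enat k \<le> alg_dim (C4_inf X) \<and> alg_dim (C4_inf X) \<le> enat (2 * k + 1)"
proof (intro conjI)
  show "algebraic_set (C4_inf X)" by (rule algebraic_C4_inf[OF assms(1,2)])
  show "enat k \<le> alg_dim (C4_inf X)" by (rule le_alg_dim_C4_inf[OF assms])
  have "enat (2 * k) \<le> enat (2 * k + 1)" by simp
  with alg_dim_C4_inf_le[OF assms(1,2)] show "alg_dim (C4_inf X) \<le> enat (2 * k + 1)" by (rule order_trans)
qed

end
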